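(* The set $\mathscr A$ of all embedded closed minimal submanifolds of positive dimension in Euclidean spheres and the set $\mathscr B$ of all regular area-minimizing cones of dimension greater than $1$ in Euclidean spaces have the same cardinality.
   Context: Euclidean spheres are the unit spheres $\mathbb S^N\subset\mathbb R^{N+1}$, with $N\geq 1$ arbitrary. "Closed" means compact without boundary; submanifolds are smooth and "minimal" means vanishing mean curvature in the sphere. An element of $\mathscr A$ is a submanifold together with its ambient sphere: $A\subset\mathbb S^{N}$ and the same $A\subset\mathbb S^{N}\subset\mathbb S^{N+1}$ count as two distinct elements; similarly an element of $\mathscr B$ is a cone together with its ambient Euclidean space. For $L\subset\mathbb S^N$, $C(L)=\{tx:t\ge0,\ x\in L\}$. The cone $C(L)$ is regular if $L$ is an embedded closed smooth submanifold of $\mathbb S^N$. It is area-minimizing if the truncated cone $C(L)\cap \mathbf B^{N+1}(1)$ (with $\mathbf B^{N+1}(1)$ the unit ball) has least mass among all integral currents in $\mathbb R^{N+1}$ with boundary $L$. Submanifolds are understood to be oriented so that they and the truncated cones define integral currents. *)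

theory Defs
  imports "HOL-Analysis.Analysis" "HOL-Library.Equipollence"
begin

section \<open>All Euclidean spaces inside one inner product space\<close>

text \<open>
  The dimension of the ambient space varies inside the statement, so it cannot be a type.  The
  space \<open>\<real>\<^sup>n\<close> is the subspace \<open>euc n\<close> of the space of finitely supported real sequences with its
  standard inner product; for \<open>n \<le> m\<close> it is contained in \<open>euc m\<close> in the usual way.
\<close>

typedef rseq = "{x :: nat \<Rightarrow> real. finite {i. x i \<noteq> 0}}"
  morphisms coord Abs_rseq
  by (rule exI[of _ "\<lambda>_. 0"]) simp

setup_lifting type_definition_rseq

lemma finite_coord: "finite {i. coord x i \<noteq> 0}"
  using coord[of x] by simp

lemma rseq_eqI: "(\<And>i. coord x i = coord y i) \<Longrightarrow> x = y"
  by (simp add: coord_inject[symmetric] fun_eq_iff)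

instantiation rseq :: real_inner
begin

lift_definition zero_rseq :: rseq is "\<lambda>_. 0" by simp

lift_definition plus_rseq :: "rseq \<Rightarrow> rseq \<Rightarrow> rseq" is "\<lambda>x y i. x i + y i"
  by (erule (1) finite_subset[OF _ finite_UnI, rotated]) auto

lift_definition minus_rseq :: "rseq \<Rightarrow> rseq \<Rightarrow> rseq" is "\<lambda>x y i. x i - y i"
  by (erule (1) finite_subset[OF _ finite_UnI, rotated]) auto

lift_definition uminus_rseq :: "rseq \<Rightarrow> rseq" is "\<lambda>x i. - x i" by simp

lift_definition scaleR_rseq :: "real \<Rightarrow> rseq \<Rightarrow> rseq" is "\<lambda>c x i. c * x i"
  by (erule finite_subset[rotated]) auto

definition inner_rseq :: "rseq \<Rightarrow> rseq \<Rightarrow> real" where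
  "inner_rseq x y = (\<Sum>i | coord x i \<noteq> 0. coord x i * coord y i)"

definition norm_rseq :: "rseq \<Rightarrow> real" where
  "norm_rseq x = sqrt (inner x x)"

definition sgn_rseq :: "rseq \<Rightarrow> rseq" where
  "sgn_rseq x = inverse (norm x) *\<^sub>R x"

definition dist_rseq :: "rseq \<Rightarrow> rseq \<Rightarrow> real" where
  "dist_rseq x y = norm (x - y)"

definition uniformity_rseq :: "(rseq \<times> rseq) filter" where
  "uniformity_rseq = (INF e\<in>{0<..}. principal {(x, y). dist x y < e})"

definition open_rseq :: "rseq set \<Rightarrow> bool" where
  "open_rseq U \<longleftrightarrow> (\<forall>x\<in>U. eventually (\<lambda>(x', y). x' = x \<longrightarrow> y \<in> U) uniformity)"

lemma inner_rseq_superset: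
  assumes "finite S" "{i. coord x i \<noteq> 0} \<subseteq> S"
  shows "inner x y = (\<Sum>i\<in>S. coord x i * coord y i)"
  unfolding inner_rseq_def using assms by (intro sum.mono_neutral_left) auto

instance
proof
  fix x y z :: rseq and a b :: real
  show "x + y + z = x + (y + z)" "x + y = y + x" "0 + x = x" "- x + x = 0" "x - y = x + - y"
    "a *\<^sub>R (x + y) = a *\<^sub>R x + a *\<^sub>R y" "(a + b) *\<^sub>R x = a *\<^sub>R x + b *\<^sub>R x"
    "a *\<^sub>R b *\<^sub>R x = (a * b) *\<^sub>R x" "1 *\<^sub>R x = x"
    by (rule rseq_eqI; transfer; simp add: algebra_simps)+
  show "sgn x = inverse (norm x) *\<^sub>R x" "dist x y = norm (x - y)"
    "(uniformity :: (rseq \<times> rseq) filter) = (INF e\<in>{0<..}. principal {(x, y). dist x y < e})"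
    "norm x = sqrt (inner x x)"
    by (simp_all add: sgn_rseq_def dist_rseq_def uniformity_rseq_def norm_rseq_def)
  show "open U \<longleftrightarrow> (\<forall>x\<in>U. eventually (\<lambda>(x', y). x' = x \<longrightarrow> y \<in> U) uniformity)"
    for U :: "rseq set"
    by (simp add: open_rseq_def)
  let ?S = "{i. coord x i \<noteq> 0} \<union> {i. coord y i \<noteq> 0} \<union> {i. coord z i \<noteq> 0}"
  have fin: "finite ?S"
    by (simp add: finite_coord)
  have eq: "inner u v = (\<Sum>i\<in>?S. coord u i * coord v i)" if "{i. coord u i \<noteq> 0} \<subseteq> ?S" for u v
    using inner_rseq_superset[OF fin that] .
  show "inner x y = inner y x"
    by (subst (1 2) eq) (auto simp: mult.commute)
  show "inner (x + y) z = inner x z + inner y z"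
    by (subst (1 2 3) eq) (auto simp: plus_rseq.rep_eq algebra_simps sum.distrib)
  show "inner (a *\<^sub>R x) y = a * inner x y"
    by (subst (1 2) eq) (auto simp: scaleR_rseq.rep_eq algebra_simps sum_distrib_left)
  show "0 \<le> inner x x"
    by (auto simp: inner_rseq_def intro: sum_nonneg)
  show "inner x x = 0 \<longleftrightarrow> x = 0"
  proof
    assume "inner x x = 0"
    then have "\<forall>i\<in>{i. coord x i \<noteq> 0}. coord x i * coord x i = 0"
      unfolding inner_rseq_def by (subst (asm) sum_nonneg_eq_0_iff) (auto simp: finite_coord)
    then show "x = 0"
      by (intro rseq_eqI) (auto simp: zero_rseq.rep_eq)
  qed (simp add: inner_rseq_def zero_rseq.rep_eq)
qed

end

lift_definition ebasis :: "nat \<Rightarrow> rseq" is "\<lambda>i j. if i = j then 1 else 0" by simp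

definition euc :: "nat \<Rightarrow> rseq set" where
  "euc n = {x. \<forall>i\<ge>n. coord x i = 0}"

definition usphere :: "nat \<Rightarrow> rseq set" where
  "usphere N = sphere 0 1 \<inter> euc (N + 1)"

section \<open>Submanifolds\<close>

definition partial :: "nat \<Rightarrow> (rseq \<Rightarrow> 'b::real_normed_vector) \<Rightarrow> rseq \<Rightarrow> 'b" where
  "partial i f x = vector_derivative (\<lambda>t. f (x + t *\<^sub>R ebasis i)) (at 0)"

fun partials :: "nat list \<Rightarrow> (rseq \<Rightarrow> 'b::real_normed_vector) \<Rightarrow> rseq \<Rightarrow> 'b" where
  "partials [] f = f"
| "partials (i # is) f = partial i (partials is f)"

text \<open>\<open>C_on r k U f\<close>: the set \<open>U\<close> is open in \<open>\<real>\<^sup>k\<close> and \<open>f\<close> is of class \<open>C\<^sup>r\<close> on \<open>U\<close>, where \<open>r\<close>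
  may be \<open>\<infinity>\<close>; all partial derivatives of order at most \<open>r\<close> exist and are continuous.\<close>

definition C_on :: "enat \<Rightarrow> nat \<Rightarrow> rseq set \<Rightarrow> (rseq \<Rightarrow> 'b::real_normed_vector) \<Rightarrow> bool" where
  "C_on r k U f \<longleftrightarrow>
     openin (top_of_set (euc k)) U \<and>
     (\<forall>is. set is \<subseteq> {..<k} \<and> enat (length is) \<le> r \<longrightarrow> continuous_on U (partials is f)) \<and>
     (\<forall>is i. set (i # is) \<subseteq> {..<k} \<and> enat (length (i # is)) \<le> r \<longrightarrow>
        (\<forall>x\<in>U. (\<lambda>t. partials is f (x + t *\<^sub>R ebasis i)) differentiable (at (0::real))))"

text \<open>Local parametrizations are \<open>C\<^sup>r\<close> immersions that are homeomorphisms onto relatively open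
  subsets of \<open>M\<close>; this is embeddedness.\<close>

definition local_param :: "enat \<Rightarrow> nat \<Rightarrow> rseq set \<Rightarrow> rseq set \<Rightarrow> (rseq \<Rightarrow> rseq) \<Rightarrow> bool" where
  "local_param r k M U \<phi> \<longleftrightarrow>
     C_on r k U \<phi> \<and>
     openin (top_of_set M) (\<phi> ` U) \<and>
     (\<exists>\<psi>. homeomorphism U (\<phi> ` U) \<phi> \<psi>) \<and>
     (\<forall>u\<in>U. inj_on (\<lambda>i. partial i \<phi> u) {..<k} \<and> independent ((\<lambda>i. partial i \<phi> u) ` {..<k}))"

definition submanifold :: "enat \<Rightarrow> nat \<Rightarrow> nat \<Rightarrow> rseq set \<Rightarrow> bool" where
  "submanifold r k n M \<longleftrightarrow>
     M \<subseteq> euc n \<and> (\<forall>p\<in>M. \<exists>U \<phi>. local_param r k M U \<phi> \<and> p \<in> \<phi> ` U)"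

definition tangent_space :: "nat \<Rightarrow> rseq set \<Rightarrow> rseq \<Rightarrow> rseq set" where
  "tangent_space k M p =
     {v. \<exists>U \<phi> u. local_param 1 k M U \<phi> \<and> u \<in> U \<and> \<phi> u = p \<and>
           v \<in> span ((\<lambda>i. partial i \<phi> u) ` {..<k})}"

text \<open>Closed submanifolds are not required to be connected; the empty set is excluded.\<close>

definition closed_submanifold :: "nat \<Rightarrow> nat \<Rightarrow> rseq set \<Rightarrow> bool" where
  "closed_submanifold N k L \<longleftrightarrow>
     L \<noteq> {} \<and> L \<subseteq> usphere N \<and> compact L \<and> submanifold \<infinity> k (N + 1) L"

definition orthonormal :: "nat \<Rightarrow> (nat \<Rightarrow> rseq) \<Rightarrow> bool" where
  "orthonormal k v \<longleftrightarrow> (\<forall>i<k. \<forall>j<k. inner (v i) (v j) = (if i = j then 1 else 0))"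

section \<open>Minimal submanifolds of the sphere\<close>

definition orth_proj :: "rseq set \<Rightarrow> rseq \<Rightarrow> rseq" where
  "orth_proj V x = (THE w. w \<in> V \<and> (\<forall>v\<in>V. inner (x - w) v = 0))"

text \<open>The normal space of \<open>L\<close> at \<open>p\<close> within the tangent space of the sphere.\<close>

definition normal_space :: "nat \<Rightarrow> nat \<Rightarrow> rseq set \<Rightarrow> rseq \<Rightarrow> rseq set" where
  "normal_space N k L p =
     {w \<in> euc (N + 1). inner w p = 0 \<and> (\<forall>v\<in>tangent_space k L p. inner w v = 0)}"

text \<open>The second fundamental form of \<open>L\<close> in \<open>\<S>\<^sup>N\<close>, evaluated on the tangent vectors with
  coefficients \<open>a\<close> and \<open>b\<close> in the coordinate frame of \<open>\<phi>\<close>.  The Levi-Civita connection of the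
  sphere is the tangential part of the flat derivative, so the normal part of the covariant
  derivative is the projection of the flat second derivative to \<open>normal_space\<close>.\<close>

definition second_ff ::
  "nat \<Rightarrow> nat \<Rightarrow> rseq set \<Rightarrow> (rseq \<Rightarrow> rseq) \<Rightarrow> rseq \<Rightarrow> (nat \<Rightarrow> real) \<Rightarrow> (nat \<Rightarrow> real) \<Rightarrow> rseq" where
  "second_ff N k L \<phi> u a b =
     orth_proj (normal_space N k L (\<phi> u))
       (\<Sum>i<k. \<Sum>j<k. (a i * b j) *\<^sub>R partial i (partial j \<phi>) u)"

text \<open>\<open>H\<close> is the trace of the second fundamental form over an orthonormal basis \<open>e\<close> of the
  tangent space at \<open>p\<close>, where \<open>A l\<close> are the coefficients of \<open>e l\<close> in the coordinate frame.\<close>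

definition mean_curvature :: "nat \<Rightarrow> nat \<Rightarrow> rseq set \<Rightarrow> rseq \<Rightarrow> rseq \<Rightarrow> bool" where
  "mean_curvature N k L p H \<longleftrightarrow>
     (\<exists>U \<phi> u A. local_param \<infinity> k L U \<phi> \<and> u \<in> U \<and> \<phi> u = p \<and>
        orthonormal k (\<lambda>l. \<Sum>i<k. A l i *\<^sub>R partial i \<phi> u) \<and>
        H = (\<Sum>l<k. second_ff N k L \<phi> u (A l) (A l)))"

definition minimal :: "nat \<Rightarrow> nat \<Rightarrow> rseq set \<Rightarrow> bool" where
  "minimal N k L \<longleftrightarrow> (\<forall>p\<in>L. \<forall>H. mean_curvature N k L p H \<longrightarrow> H = 0)"

section \<open>Multivectors and orientations\<close>

text \<open>A \<open>k\<close>-vector is given by its coefficients with respect to the basis vectors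
  \<open>e\<^bsub>I!0\<^esub> \<and> \<dots> \<and> e\<^bsub>I!(k-1)\<^esub>\<close>, where \<open>I\<close> runs over strictly increasing lists of length \<open>k\<close>; it is
  zero at all other lists.  The coefficients of \<open>v 0 \<and> \<dots> \<and> v (k - 1)\<close> are minors.\<close>

type_synonym multivector = "nat list \<Rightarrow> real"

definition multi_idx :: "nat \<Rightarrow> nat \<Rightarrow> nat list set" where
  "multi_idx k n = {I. length I = k \<and> sorted_wrt (<) I \<and> set I \<subseteq> {..<n}}"

definition wedge :: "nat \<Rightarrow> (nat \<Rightarrow> rseq) \<Rightarrow> multivector" where
  "wedge k v I =
     (if length I = k \<and> sorted_wrt (<) I
      then \<Sum>\<pi> | \<pi> permutes {..<k}. of_int (sign \<pi>) * (\<Prod>i<k. coord (v i) (I ! \<pi> i))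
      else 0)"

text \<open>\<open>\<xi>\<close> is one of the two unit simple \<open>k\<close>-vectors of the \<open>k\<close>-dimensional subspace \<open>V\<close>.\<close>

definition orients :: "nat \<Rightarrow> rseq set \<Rightarrow> multivector \<Rightarrow> bool" where
  "orients k V \<xi> \<longleftrightarrow> (\<exists>v. orthonormal k v \<and> span (v ` {..<k}) = V \<and> \<xi> = wedge k v)"

text \<open>Orientations are extended by zero, so that there is only one function for each of them.\<close>

definition orientation :: "nat \<Rightarrow> rseq set \<Rightarrow> (rseq \<Rightarrow> multivector) \<Rightarrow> bool" where
  "orientation k M \<tau> \<longleftrightarrow>
     continuous_on M \<tau> \<and> (\<forall>p\<in>M. orients k (tangent_space k M p) (\<tau> p)) \<and>
     (\<forall>p. p \<notin> M \<longrightarrow> \<tau> p = (\<lambda>_. 0))"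

definition drop_nth :: "nat \<Rightarrow> 'a list \<Rightarrow> 'a list" where
  "drop_nth j I = take j I @ drop (Suc j) I"

section \<open>Hausdorff measure\<close>

definition hausdorff_content :: "nat \<Rightarrow> real \<Rightarrow> rseq set \<Rightarrow> ennreal" where
  "hausdorff_content k \<delta> A =
     (INF C \<in> {C :: nat \<Rightarrow> rseq set. A \<subseteq> (\<Union>i. C i) \<and> (\<forall>i. bounded (C i) \<and> diameter (C i) \<le> \<delta>)}.
        \<Sum>i. if C i = {} then 0
            else ennreal (unit_ball_vol (real k) * (diameter (C i) / 2) ^ k))"

definition hausdorff_outer :: "nat \<Rightarrow> rseq set \<Rightarrow> ennreal" where
  "hausdorff_outer k A = (SUP \<delta>\<in>{0<..}. hausdorff_content k \<delta> A)"

text \<open>The measurable sets are those satisfying the Caratheodory condition, so that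
  \<open>caratheodory_lemma\<close> applies.\<close>

definition hausdorff :: "nat \<Rightarrow> rseq measure" where
  "hausdorff k = measure_of UNIV (lambda_system UNIV (Pow UNIV) (hausdorff_outer k)) (hausdorff_outer k)"

section \<open>Differential forms and currents\<close>

text \<open>A form is given by its coefficients at strictly increasing lists.  The elements of
  \<open>test_forms k n\<close> are the smooth \<open>k\<close>-forms on \<open>\<real>\<^sup>n\<close> with compact support, extended by zero.\<close>

type_synonym form = "rseq \<Rightarrow> multivector"

definition test_forms :: "nat \<Rightarrow> nat \<Rightarrow> form set" where
  "test_forms k n =
     {\<omega>. (\<forall>x I. x \<notin> euc n \<or> I \<notin> multi_idx k n \<longrightarrow> \<omega> x I = 0) \<and>
         (\<forall>I. C_on \<infinity> n (euc n) (\<lambda>x. \<omega> x I)) \<and>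
         (\<exists>R. \<forall>x I. \<omega> x I \<noteq> 0 \<longrightarrow> norm x \<le> R)}"

definition pairing :: "nat \<Rightarrow> nat \<Rightarrow> multivector \<Rightarrow> multivector \<Rightarrow> real" where
  "pairing k n \<alpha> \<xi> = (\<Sum>I\<in>multi_idx k n. \<alpha> I * \<xi> I)"

definition ext_deriv :: "nat \<Rightarrow> form \<Rightarrow> form" where
  "ext_deriv n \<omega> x J =
     (if x \<in> euc n \<and> sorted_wrt (<) J \<and> set J \<subseteq> {..<n}
      then \<Sum>j<length J. (- 1) ^ j * partial (J ! j) (\<lambda>y. \<omega> y (drop_nth j J)) x
      else 0)"

type_synonym current = "form \<Rightarrow> real"

definition eq_current :: "nat \<Rightarrow> nat \<Rightarrow> current \<Rightarrow> current \<Rightarrow> bool" where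
  "eq_current k n S T \<longleftrightarrow> (\<forall>\<omega>\<in>test_forms k n. S \<omega> = T \<omega>)"

definition boundary :: "nat \<Rightarrow> current \<Rightarrow> current" where
  "boundary n T = (\<lambda>\<omega>. T (ext_deriv n \<omega>))"

definition comass_le_1 :: "nat \<Rightarrow> nat \<Rightarrow> multivector \<Rightarrow> bool" where
  "comass_le_1 k n \<alpha> \<longleftrightarrow>
     (\<forall>v. orthonormal k v \<and> (\<forall>i<k. v i \<in> euc n) \<longrightarrow> \<bar>pairing k n \<alpha> (wedge k v)\<bar> \<le> 1)"

definition mass :: "nat \<Rightarrow> nat \<Rightarrow> current \<Rightarrow> ereal" where
  "mass k n T = (SUP \<omega>\<in>{\<omega> \<in> test_forms k n. \<forall>x\<in>euc n. comass_le_1 k n (\<omega> x)}. ereal (T \<omega>))"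

text \<open>Integration over the set \<open>E\<close> with orientation \<open>\<xi>\<close> and multiplicity \<open>\<theta>\<close>.\<close>

definition current_of ::
  "nat \<Rightarrow> nat \<Rightarrow> rseq set \<Rightarrow> (rseq \<Rightarrow> nat) \<Rightarrow> (rseq \<Rightarrow> multivector) \<Rightarrow> current" where
  "current_of m n E \<theta> \<xi> =
     (\<lambda>\<omega>. set_lebesgue_integral (hausdorff m) E (\<lambda>x. real (\<theta> x) * pairing m n (\<omega> x) (\<xi> x)))"

text \<open>\<open>E\<close> is countably \<open>m\<close>-rectifiable and \<open>\<xi>\<close> orients its approximate tangent spaces: up to a
  null set, \<open>E\<close> is covered by countably many embedded \<open>C\<^sup>1\<close> submanifolds, whose tangent spaces are
  the approximate tangent spaces of \<open>E\<close> at almost every common point.\<close>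

definition oriented_rectifiable ::
  "nat \<Rightarrow> nat \<Rightarrow> rseq set \<Rightarrow> (rseq \<Rightarrow> multivector) \<Rightarrow> bool" where
  "oriented_rectifiable m n E \<xi> \<longleftrightarrow>
     E \<in> sets (hausdorff m) \<and> E \<subseteq> euc n \<and>
     (\<forall>I. set_borel_measurable (hausdorff m) E (\<lambda>x. \<xi> x I)) \<and>
     (\<exists>M :: nat \<Rightarrow> rseq set.
        (\<forall>j. submanifold 1 m n (M j)) \<and>
        (AE x in hausdorff m. x \<in> E \<longrightarrow> x \<in> (\<Union>j. M j)) \<and>
        (\<forall>j. AE x in hausdorff m. x \<in> E \<inter> M j \<longrightarrow> orients m (tangent_space m (M j) x) (\<xi> x)))"

text \<open>As in Federer's definition, rectifiable currents have compact support (\<open>E\<close> is bounded) and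
  finite mass (\<open>\<theta>\<close> is integrable).\<close>

definition rectifiable_current :: "nat \<Rightarrow> nat \<Rightarrow> current \<Rightarrow> bool" where
  "rectifiable_current m n T \<longleftrightarrow>
     (\<exists>E \<theta> \<xi>. oriented_rectifiable m n E \<xi> \<and> bounded E \<and> (\<forall>x\<in>E. 0 < \<theta> x) \<and>
        set_integrable (hausdorff m) E (\<lambda>x. real (\<theta> x)) \<and>
        eq_current m n T (current_of m n E \<theta> \<xi>))"

definition integral_current :: "nat \<Rightarrow> nat \<Rightarrow> current \<Rightarrow> bool" where
  "integral_current m n T \<longleftrightarrow>
     rectifiable_current m n T \<and> (m = 0 \<or> rectifiable_current (m - 1) n (boundary n T))"

section \<open>Regular area-minimizing cones\<close>

definition cone_over :: "rseq set \<Rightarrow> rseq set" where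
  "cone_over L = {t *\<^sub>R x | t x. 0 \<le> t \<and> x \<in> L}"

text \<open>The cone is oriented by \<open>x \<and> \<tau> x\<close>, where \<open>x = y /\<^sub>R norm y\<close>: radial direction first, so
  that the boundary of the truncated cone is the link with orientation \<open>\<tau>\<close>.\<close>

definition cone_orient :: "(rseq \<Rightarrow> multivector) \<Rightarrow> rseq \<Rightarrow> multivector" where
  "cone_orient \<tau> y =
     (\<lambda>J. if y \<noteq> 0 \<and> sorted_wrt (<) J
          then \<Sum>j<length J. (- 1) ^ j * coord (y /\<^sub>R norm y) (J ! j) * \<tau> (y /\<^sub>R norm y) (drop_nth j J)
          else 0)"

definition truncated_cone :: "nat \<Rightarrow> nat \<Rightarrow> rseq set \<Rightarrow> (rseq \<Rightarrow> multivector) \<Rightarrow> current" where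
  "truncated_cone N k L \<tau> =
     current_of (k + 1) (N + 1) (cone_over L \<inter> cball 0 1) (\<lambda>_. 1) (cone_orient \<tau>)"

definition spans_link ::
  "nat \<Rightarrow> nat \<Rightarrow> rseq set \<Rightarrow> (rseq \<Rightarrow> multivector) \<Rightarrow> current \<Rightarrow> bool" where
  "spans_link N k L \<tau> T \<longleftrightarrow>
     integral_current (k + 1) (N + 1) T \<and>
     eq_current k (N + 1) (boundary (N + 1) T) (current_of k (N + 1) L (\<lambda>_. 1) \<tau>)"

definition area_minimizing_cone :: "nat \<Rightarrow> nat \<Rightarrow> rseq set \<Rightarrow> (rseq \<Rightarrow> multivector) \<Rightarrow> bool" where
  "area_minimizing_cone N k L \<tau> \<longleftrightarrow>
     spans_link N k L \<tau> (truncated_cone N k L \<tau>) \<and>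
     (\<forall>T. spans_link N k L \<tau> T \<longrightarrow>
        mass (k + 1) (N + 1) (truncated_cone N k L \<tau>) \<le> mass (k + 1) (N + 1) T)"

section \<open>The two sets\<close>

text \<open>Submanifolds and cones carry orientations.  Elements of the first set are triples of the
  dimension \<open>N\<close> of the ambient sphere, a submanifold and its orientation; elements of the second
  set are triples of the dimension of the ambient Euclidean space, a cone and its orientation.\<close>

definition minimal_submanifolds :: "(nat \<times> rseq set \<times> (rseq \<Rightarrow> multivector)) set" where
  "minimal_submanifolds =
     {(N, L, \<tau>). 1 \<le> N \<and>
        (\<exists>k\<ge>1. closed_submanifold N k L \<and> orientation k L \<tau> \<and> minimal N k L)}"

definition regular_minimizing_cones :: "(nat \<times> rseq set \<times> (rseq \<Rightarrow> multivector)) set" where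
  "regular_minimizing_cones =
     {(N + 1, cone_over L, cone_orient \<tau>) | N L \<tau>. 1 \<le> N \<and>
        (\<exists>k. k + 1 > 1 \<and> closed_submanifold N k L \<and> orientation k L \<tau> \<and>
             area_minimizing_cone N k L \<tau>)}"

end

theory Submission
  imports Defs
begin

text \<open>
  Both sets have the cardinality of the continuum.  A closed submanifold and its orientation are
  determined by a dense sequence of points and the values there, which bounds both cardinalities
  from above.  For the lower bounds, the great circles in the planes of \<open>\<real>\<^sup>3\<close> through \<open>e\<^sub>0\<close> are minimal
  in \<open>\<S>\<^sup>2\<close>, and the cones over them, the planes themselves, are area-minimizing: the parallel form
  \<open>d (x\<^sub>0 (c dx\<^sub>1 + s dx\<^sub>2))\<close> calibrates the disc, and the value of an exact form on a current depends
  only on the boundary.  That the flat disc is an integral current with the expected boundary is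
  Stokes' theorem on the disc, where the normalizations of the Hausdorff measures of
  dimension 1 and 2 have to match those of Lebesgue measure; this is the isodiametric inequality
  together with Vitali's covering theorem.
\<close>

section \<open>Hausdorff measure\<close>

text \<open>A competitor is known only through its values on test forms, which have compact support,
  and cutting off spoils one half of the calibration argument. The cut-off calibration keeps comass
  at most 1 but is in general not closed; d of the cut-off primitive is exact, but its comass is not
  controlled where the cutoff varies. Both forms are used, with a cutoff radius beyond the set
  carrying the competitor, on which they agree. The boundary condition in \<open>spans_link\<close>
  is an equality of functionals with multiplicity 1, so a wrong constant between Hausdorff measure
  and length or area would break it. Covers by arbitrary sets are allowed, and only the isodiametric
  inequality excludes that they are cheaper than balls. S^2 is the first sphere with a one-parameter
  family of great circles. Tangent spaces and mean curvature are quantified over all charts, so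
  statements about the standard chart of a circle do not suffice: derivatives of an arbitrary chart
  are shown to stay in the plane of the circle.\<close>

definition hweight :: "nat \<Rightarrow> rseq set \<Rightarrow> ennreal" where
  "hweight k C = (if C = {} then 0 else ennreal (unit_ball_vol (real k) * (diameter C / 2) ^ k))"

definition hcovers :: "real \<Rightarrow> rseq set \<Rightarrow> (nat \<Rightarrow> rseq set) set" where
  "hcovers \<delta> A = {C. A \<subseteq> (\<Union>i. C i) \<and> (\<forall>i. bounded (C i) \<and> diameter (C i) \<le> \<delta>)}"

lemma hausdorff_content_eq: "hausdorff_content k \<delta> A = (INF C\<in>hcovers \<delta> A. \<Sum>i. hweight k (C i))"
  by (simp add: hausdorff_content_def hcovers_def hweight_def)

lemma hweight_empty [simp]: "hweight k {} = 0"
  by (simp add: hweight_def)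

lemma hausdorff_content_le:
  assumes "A \<subseteq> (\<Union>i. C i)" "\<And>i. bounded (C i)" "\<And>i. diameter (C i) \<le> \<delta>"
  shows "hausdorff_content k \<delta> A \<le> (\<Sum>i. hweight k (C i))"
  unfolding hausdorff_content_eq by (rule INF_lower) (use assms in \<open>auto simp: hcovers_def\<close>)

lemma hausdorff_content_mono: "A \<subseteq> B \<Longrightarrow> hausdorff_content k \<delta> A \<le> hausdorff_content k \<delta> B"
  unfolding hausdorff_content_eq by (rule INF_superset_mono) (auto simp: hcovers_def)

lemma hausdorff_content_antimono:
  "\<delta> \<le> \<delta>' \<Longrightarrow> hausdorff_content k \<delta>' A \<le> hausdorff_content k \<delta> A"
  unfolding hausdorff_content_eq by (rule INF_superset_mono) (auto simp: hcovers_def intro: order_trans)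

lemma hausdorff_content_empty: "0 < \<delta> \<Longrightarrow> hausdorff_content k \<delta> {} = 0"
  using hausdorff_content_le[of "{}" "\<lambda>_. {}" \<delta> k] by simp

lemma hausdorff_content_UN:
  \<comment> \<open>Near-optimal covers of the sets \<open>A n\<close>, with excess
    \<open>e / 2^(n+1)\<close>, are merged into one sequence by the pairing of naturals; the
    excesses add up to \<open>e\<close>.\<close>
  fixes A :: "nat \<Rightarrow> rseq set"
  shows "hausdorff_content k \<delta> (\<Union>n. A n) \<le> (\<Sum>n. hausdorff_content k \<delta> (A n))"
proof (rule ennreal_le_epsilon)
  fix e :: real
  assume e: "0 < e" and fin: "(\<Sum>n. hausdorff_content k \<delta> (A n)) < top"
  have f: "hausdorff_content k \<delta> (A n) \<noteq> top" for n
    using ennreal_suminf_lessD[OF fin, of n] by simp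
  have "\<exists>C\<in>hcovers \<delta> (A n). (\<Sum>i. hweight k (C i))
          < hausdorff_content k \<delta> (A n) + ennreal (e * (1/2)^Suc n)" for n
    by (rule INF_approx_ennreal[OF _ hausdorff_content_eq])
       (use e f in \<open>auto simp: ennreal_zero_less_mult_iff\<close>)
  then obtain C where C: "\<And>n. C n \<in> hcovers \<delta> (A n)"
    and lt: "\<And>n. (\<Sum>i. hweight k (C n i)) < hausdorff_content k \<delta> (A n) + ennreal (e * (1/2)^Suc n)"
    by metis
  define D where "D j = (case prod_decode j of (n, i) \<Rightarrow> C n i)" for j
  have "hausdorff_content k \<delta> (\<Union>n. A n) \<le> (\<Sum>j. hweight k (D j))"
  proof (rule hausdorff_content_le)
    show "(\<Union>n. A n) \<subseteq> (\<Union>j. D j)"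
    proof
      fix x assume "x \<in> (\<Union>n. A n)"
      then obtain n i where "x \<in> C n i" using C by (fastforce simp: hcovers_def)
      then have "x \<in> D (prod_encode (n, i))" by (simp add: D_def)
      then show "x \<in> (\<Union>j. D j)" by blast
    qed
    show "bounded (D j)" "diameter (D j) \<le> \<delta>" for j
      using C by (auto simp: D_def hcovers_def split: prod.split)
  qed
  also have "\<dots> = (\<Sum>n. \<Sum>i. hweight k (C n i))"
    using suminf_ennreal_2dimen[where f="\<lambda>(n,i). hweight k (C n i)"
        and g="\<lambda>n. \<Sum>i. hweight k (C n i)"]
    by (simp add: D_def comp_def case_prod_unfold)
  also have "\<dots> \<le> (\<Sum>n. hausdorff_content k \<delta> (A n) + ennreal (e * (1/2)^Suc n))"
    using lt by (intro suminf_le less_imp_le) auto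
  also have "\<dots> = (\<Sum>n. hausdorff_content k \<delta> (A n)) + (\<Sum>n. ennreal (e * (1/2)^Suc n))"
    by (rule suminf_add[symmetric]) auto
  also have "(\<Sum>n. ennreal (e * (1/2)^Suc n)) = ennreal e"
    using e power_half_series sums_mult[OF power_half_series, of e]
    by (intro suminf_ennreal_eq) auto
  finally show "hausdorff_content k \<delta> (\<Union>n. A n) \<le> (\<Sum>n. hausdorff_content k \<delta> (A n)) + ennreal e" .
qed

lemma hausdorff_content_le_outer: "0 < \<delta> \<Longrightarrow> hausdorff_content k \<delta> A \<le> hausdorff_outer k A"
  unfolding hausdorff_outer_def by (rule SUP_upper) simp

text \<open>The contents grow as the scale shrinks, so a sequence of scales suffices. Its
  monotonicity lets the supremum commute with addition in
  \<open>hausdorff_outer_separated\<close>.\<close>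

lemma hausdorff_outer_seq: "hausdorff_outer k A = (SUP n. hausdorff_content k (inverse (real (Suc n))) A)"
proof (rule antisym)
  show "hausdorff_outer k A \<le> (SUP n. hausdorff_content k (inverse (real (Suc n))) A)"
    unfolding hausdorff_outer_def
  proof (rule SUP_least)
    fix \<delta> :: real assume "\<delta> \<in> {0<..}"
    then obtain n where "inverse (real (Suc n)) < \<delta>" using reals_Archimedean by auto
    then show "hausdorff_content k \<delta> A \<le> (SUP n. hausdorff_content k (inverse (real (Suc n))) A)"
      by (intro SUP_upper2[of n] hausdorff_content_antimono) auto
  qed
  show "(SUP n. hausdorff_content k (inverse (real (Suc n))) A) \<le> hausdorff_outer k A"
    by (rule SUP_least) (simp add: hausdorff_content_le_outer)
qed

lemma hausdorff_outer_mono: "A \<subseteq> B \<Longrightarrow> hausdorff_outer k A \<le> hausdorff_outer k B"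
  unfolding hausdorff_outer_def by (intro SUP_mono) (auto intro: hausdorff_content_mono)

lemma hausdorff_outer_empty [simp]: "hausdorff_outer k {} = 0"
  by (simp add: hausdorff_outer_def hausdorff_content_empty bot_ennreal[symmetric])

lemma hausdorff_outer_UN:
  fixes A :: "nat \<Rightarrow> rseq set"
  shows "hausdorff_outer k (\<Union>n. A n) \<le> (\<Sum>n. hausdorff_outer k (A n))"
  unfolding hausdorff_outer_def[of k "\<Union>n. A n"]
proof (rule SUP_least)
  fix \<delta> :: real assume "\<delta> \<in> {0<..}"
  then have "(\<Sum>n. hausdorff_content k \<delta> (A n)) \<le> (\<Sum>n. hausdorff_outer k (A n))"
    by (intro suminf_le hausdorff_content_le_outer) auto
  then show "hausdorff_content k \<delta> (\<Union>n. A n) \<le> (\<Sum>n. hausdorff_outer k (A n))"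
    using hausdorff_content_UN order_trans by blast
qed

lemma outer_measure_space_hausdorff: "outer_measure_space (Pow UNIV) (hausdorff_outer k)"
  by (auto simp: outer_measure_space_def positive_def increasing_def countably_subadditive_def
      intro: hausdorff_outer_mono hausdorff_outer_UN)

lemma measure_space_hausdorff:
  "measure_space UNIV (lambda_system UNIV (Pow UNIV) (hausdorff_outer k)) (hausdorff_outer k)"
proof -
  interpret sigma_algebra UNIV "Pow UNIV :: rseq set set" by (rule sigma_algebra_Pow)
  show ?thesis by (rule caratheodory_lemma[OF outer_measure_space_hausdorff])
qed

lemma hausdorff_simps:
  shows space_hausdorff [simp]: "space (hausdorff k) = UNIV"
    and sets_hausdorff: "sets (hausdorff k) = lambda_system UNIV (Pow UNIV) (hausdorff_outer k)"
    and emeasure_hausdorff: "A \<in> sets (hausdorff k) \<Longrightarrow> emeasure (hausdorff k) A = hausdorff_outer k A"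
proof -
  let ?L = "lambda_system UNIV (Pow UNIV) (hausdorff_outer k)"
  note ms = measure_space_hausdorff[of k, unfolded measure_space_def]
  interpret L: sigma_algebra UNIV ?L using ms by simp
  show "space (hausdorff k) = UNIV" by (simp add: hausdorff_def)
  show s: "sets (hausdorff k) = ?L" by (simp add: hausdorff_def L.sigma_sets_eq del: Pow_UNIV)
  show "emeasure (hausdorff k) A = hausdorff_outer k A" if "A \<in> sets (hausdorff k)"
    using ms that by (intro emeasure_measure_of[OF hausdorff_def]) (simp_all add: s)
qed

lemma hausdorff_outer_Un: "hausdorff_outer k (A \<union> B) \<le> hausdorff_outer k A + hausdorff_outer k B"
proof -
  have "hausdorff_outer k (A \<union> B) = hausdorff_outer k (\<Union>n. case n of 0 \<Rightarrow> A | Suc 0 \<Rightarrow> B | _ \<Rightarrow> {})"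
    by (rule arg_cong[where f="hausdorff_outer k"]) (auto split: nat.splits intro: exI[of _ 0] exI[of _ 1])
  also have "\<dots> \<le> (\<Sum>n. hausdorff_outer k (case n of 0 \<Rightarrow> A | Suc 0 \<Rightarrow> B | _ \<Rightarrow> {}))"
    by (rule hausdorff_outer_UN)
  also have "\<dots> = (\<Sum>n\<in>{0,1}. hausdorff_outer k (case n of 0 \<Rightarrow> A | Suc 0 \<Rightarrow> B | _ \<Rightarrow> {}))"
    by (rule suminf_finite) (auto split: nat.splits)
  finally show ?thesis by simp
qed

section \<open>Additivity on separated sets and measurability of Borel sets\<close>

text \<open>A covering set of diameter at most \<delta> cannot meet both sets, so every cover of the
  union splits into two covers without common members.\<close>

lemma hausdorff_content_separated:
  assumes sep: "\<And>a b. a \<in> A \<Longrightarrow> b \<in> B \<Longrightarrow> \<delta> < dist a b"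
  shows "hausdorff_content k \<delta> A + hausdorff_content k \<delta> B \<le> hausdorff_content k \<delta> (A \<union> B)"
  unfolding hausdorff_content_eq[of k \<delta> "A \<union> B"]
proof (rule INF_greatest)
  fix C assume C: "C \<in> hcovers \<delta> (A \<union> B)"
  let ?C = "\<lambda>A i. if C i \<inter> A = {} then {} else C i"
  have bd: "bounded (C i)" "diameter (C i) \<le> \<delta>" for i using C by (auto simp: hcovers_def)
  have cov: "A \<subseteq> (\<Union>i. ?C A i)" "B \<subseteq> (\<Union>i. ?C B i)" using C by (fastforce simp: hcovers_def)+
  have d: "diameter (?C A i) \<le> \<delta>" for A i
    using bd[of i] diameter_ge_0[OF bd(1)[of i]] by auto
  have "hausdorff_content k \<delta> A + hausdorff_content k \<delta> B
     \<le> (\<Sum>i. hweight k (?C A i)) + (\<Sum>i. hweight k (?C B i))"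
    by (intro add_mono hausdorff_content_le cov d) (auto simp: bd)
  also have "\<dots> = (\<Sum>i. hweight k (?C A i) + hweight k (?C B i))"
    by (rule suminf_add) auto
  also have "\<dots> \<le> (\<Sum>i. hweight k (C i))"
  proof (intro suminf_le)
    fix i
    have "C i \<inter> A = {} \<or> C i \<inter> B = {}"
    proof (rule ccontr)
      assume "\<not> ?thesis"
      then obtain a b where ab: "a \<in> C i" "a \<in> A" "b \<in> C i" "b \<in> B" by blast
      have "dist a b \<le> \<delta>"
        using diameter_bounded_bound[OF bd(1)[of i] ab(1,3)] bd(2)[of i] by simp
      then show False using sep[OF ab(2,4)] by simp
    qed
    then show "hweight k (?C A i) + hweight k (?C B i) \<le> hweight k (C i)" by auto
  qed auto
  finally show "hausdorff_content k \<delta> A + hausdorff_content k \<delta> B \<le> (\<Sum>i. hweight k (C i))" .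
qed

lemma hausdorff_outer_separated:
  assumes d: "0 < d" and sep: "\<And>a b. a \<in> A \<Longrightarrow> b \<in> B \<Longrightarrow> d \<le> dist a b"
  shows "hausdorff_outer k (A \<union> B) = hausdorff_outer k A + hausdorff_outer k B"
proof (rule antisym[OF hausdorff_outer_Un])
  let ?c = "\<lambda>A n. hausdorff_content k (inverse (real (Suc n))) A"
  have inc: "incseq (?c A)" for A
    by (auto simp: incseq_def intro!: hausdorff_content_antimono le_imp_inverse_le)
  obtain N where N: "inverse (real (Suc N)) < d" using reals_Archimedean[OF d] by auto
  have "hausdorff_outer k A + hausdorff_outer k B = (SUP n. ?c A n + ?c B n)"
    unfolding hausdorff_outer_seq by (rule ennreal_SUP_add[symmetric, OF inc inc])
  also have "\<dots> \<le> hausdorff_outer k (A \<union> B)"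
  proof (rule SUP_least)
    fix n
    \<comment> \<open>From index \<open>N\<close> on the scale is below \<open>d\<close>, as the
      separation of contents requires.\<close>
    let ?m = "max n N"
    have m: "inverse (real (Suc ?m)) < d"
      using N by (meson le_imp_inverse_le max.cobounded2 of_nat_0_less_iff of_nat_le_iff Suc_le_mono order_le_less_trans zero_less_Suc)
    have "?c A n + ?c B n \<le> ?c A ?m + ?c B ?m"
      using inc by (intro add_mono) (auto simp: incseq_def)
    also have "\<dots> \<le> ?c (A \<union> B) ?m"
      by (rule hausdorff_content_separated) (use m sep in \<open>force intro: less_le_trans\<close>)
    also have "\<dots> \<le> hausdorff_outer k (A \<union> B)" by (rule hausdorff_content_le_outer) simp
    finally show "?c A n + ?c B n \<le> hausdorff_outer k (A \<union> B)" .
  qed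
  finally show "hausdorff_outer k A + hausdorff_outer k B \<le> hausdorff_outer k (A \<union> B)" .
qed

text \<open>Tails of a convergent series tend to 0. In Caratheodory's criterion \<open>b n\<close>
  adds the part in the closed set and the part at distance at least 1/(n+1); the tail bounds the
  layers in between.\<close>

lemma ennreal_le_of_tail:
  fixes f :: "nat \<Rightarrow> ennreal"
  assumes fin: "(\<Sum>i. f i) \<noteq> top" and le: "\<And>n. a \<le> b n + (\<Sum>i. f (i + n))"
    and b: "\<And>n. b n \<le> c"
  shows "a \<le> c"
proof (rule ennreal_le_epsilon)
  fix e :: real assume e: "0 < e"
  define r where "r i = enn2real (f i)" for i
  have f: "f i = ennreal (r i)" for i
    using ennreal_suminf_lessD[of f top i] fin by (simp add: r_def less_top)
  have r0: "0 \<le> r i" for i by (simp add: r_def)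
  have r: "summable r" using fin r0 unfolding f by (rule summable_suminf_not_top[rotated])
  obtain n where n: "norm (\<Sum>i. r (i + n)) < e" using suminf_exist_split[OF e r] by blast
  have "(\<Sum>i. f (i + n)) = ennreal (\<Sum>i. r (i + n))"
    unfolding f using r r0 by (intro suminf_ennreal2) (auto simp: summable_iff_shift)
  also have "\<dots> \<le> ennreal e" using n by (intro ennreal_leI) simp
  finally show "a \<le> c + ennreal e"
    using le[of n] b[of n] by (meson add_mono order_trans)
qed

lemma hausdorff_outer_union_separated:
  fixes R :: "nat \<Rightarrow> rseq set"
  assumes sep: "\<And>n. \<exists>d>0. \<forall>a\<in>(\<Union>j<n. R j). \<forall>b\<in>R n. d \<le> dist a b"
  shows "(\<Sum>j<n. hausdorff_outer k (R j)) = hausdorff_outer k (\<Union>j<n. R j)"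
proof (induction n)
  case (Suc n)
  obtain d where "d > 0" "\<forall>a\<in>(\<Union>j<n. R j). \<forall>b\<in>R n. d \<le> dist a b" using sep by blast
  then have "hausdorff_outer k ((\<Union>j<n. R j) \<union> R n) = hausdorff_outer k (\<Union>j<n. R j) + hausdorff_outer k (R n)"
    by (intro hausdorff_outer_separated) auto
  then show ?case by (simp add: Suc lessThan_Suc Un_commute)
qed simp

text \<open>Caratheodory's criterion: the layers \<open>R j\<close> around a closed set alternate, those of equal
  parity being at positive distance from each other.\<close>

lemma closed_hausdorff_measurable:
  assumes F: "closed F"
  shows "F \<in> sets (hausdorff k)"
proof (cases "F = {}")
  case False
  let ?H = "hausdorff_outer k"
  have "?H (F \<inter> X) + ?H ((UNIV - F) \<inter> X) \<le> ?H X" for X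
  proof (cases "?H X = top")
    case fin: False
    define Y where "Y n = {x \<in> X. 1 / real (Suc n) \<le> infdist x F}" for n
    define R where "R n = {x \<in> X. 1 / real (n + 2) \<le> infdist x F \<and> infdist x F < 1 / real (n + 1)}" for n
    have gap: "infdist x F - infdist y F \<le> dist x y" for x y
      using infdist_triangle[of x F y] by simp
    have bound: "(\<Sum>j<n. ?H (R (2 * j + m))) \<le> ?H X" for n m
    proof -
      have "(\<Sum>j<n. ?H (R (2 * j + m))) = ?H (\<Union>j<n. R (2 * j + m))"
      proof (rule hausdorff_outer_union_separated)
        fix n
        show "\<exists>d>0. \<forall>a\<in>\<Union>j<n. R (2 * j + m). \<forall>b\<in>R (2 * n + m). d \<le> dist a b"
        \<comment> \<open>Earlier layers of the same parity lie at distance at least 1/(2n+m) from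
          \<open>F\<close>, the new one at distance below 1/(2n+m+1). For \<open>n = 0\<close> the
          union is empty, and 1/(2n+m) could be 1/0.\<close>
        proof (cases "n = 0")
          case False
          show ?thesis
          proof (intro exI conjI ballI)
            show "0 < 1 / real (2 * n + m) - 1 / real (2 * n + m + 1)"
              using False by (simp add: divide_strict_left_mono)
            fix a b assume "a \<in> (\<Union>j<n. R (2 * j + m))" and b: "b \<in> R (2 * n + m)"
            then obtain j where j: "j < n" "a \<in> R (2 * j + m)" by auto
            have "1 / real (2 * n + m) \<le> 1 / real (2 * j + m + 2)" using j by (intro frac_le) auto
            moreover have "1 / real (2 * j + m + 2) \<le> infdist a F" using j by (simp add: R_def)
            moreover have "infdist b F < 1 / real (2 * n + m + 1)" using b by (simp add: R_def)
            ultimately show "1 / real (2 * n + m) - 1 / real (2 * n + m + 1) \<le> dist a b"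
              using gap[of a b] by linarith
          qed
        qed (auto intro: exI[of _ 1])
      qed
      also have "\<dots> \<le> ?H X" by (rule hausdorff_outer_mono) (auto simp: R_def)
      finally show ?thesis .
    qed
    \<comment> \<open>Even and odd layers are each bounded by \<open>?H X\<close>, hence all partial
      sums by twice that, and the series converges.\<close>
    have "(\<Sum>j<2*n. ?H (R j)) = (\<Sum>j<n. ?H (R (2 * j + 0))) + (\<Sum>j<n. ?H (R (2 * j + 1)))" for n
      by (induction n) (auto simp: algebra_simps)
    then have "(\<Sum>j<2*n. ?H (R j)) \<le> ?H X + ?H X" for n
      using add_mono[OF bound bound] by metis
    moreover have "(\<Sum>j<n. ?H (R j)) \<le> (\<Sum>j<2*n. ?H (R j))" for n
      by (rule sum_mono2) auto
    ultimately have "(\<Sum>j<n. ?H (R j)) \<le> ?H X + ?H X" for n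
      using order_trans by blast
    then have "(\<Sum>j. ?H (R j)) \<le> ?H X + ?H X"
      unfolding suminf_eq_SUP by (rule SUP_least)
    then have 1: "(\<Sum>j. ?H (R j)) \<noteq> top"
      using fin by (auto simp: top_unique)
    have 2: "?H (F \<inter> X) + ?H (Y n) \<le> ?H X" for n
    proof -
      have "?H (F \<inter> X) + ?H (Y n) = ?H ((F \<inter> X) \<union> Y n)"
      proof (rule hausdorff_outer_separated[symmetric])
        show "1 / real (Suc n) \<le> dist a b" if "a \<in> F \<inter> X" "b \<in> Y n" for a b
          using that infdist_le[of a F b] by (auto simp: Y_def dist_commute)
      qed simp
      also have "\<dots> \<le> ?H X" by (rule hausdorff_outer_mono) (auto simp: Y_def)
      finally show ?thesis .
    qed
    have cov: "(UNIV - F) \<inter> X \<subseteq> Y n \<union> (\<Union>i. R (i + n))" for n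
    proof
      fix x assume x: "x \<in> (UNIV - F) \<inter> X"
      then have pos: "0 < infdist x F"
        using in_closed_iff_infdist_zero[OF F False, of x] infdist_nonneg[of x F] by auto
      show "x \<in> Y n \<union> (\<Union>i. R (i + n))"
      proof (cases "1 / real (Suc n) \<le> infdist x F")
        case True then show ?thesis using x by (auto simp: Y_def)
      next
        case lt: False
        \<comment> \<open>The least \<open>m\<close> with \<open>?P m\<close> singles out the layer:
          minimality gives the strict upper bound, which for \<open>m = 0\<close> comes from
          \<open>lt\<close>.\<close>
        let ?P = "\<lambda>m. 1 / real (m + 2) \<le> infdist x F"
        obtain m0 where "inverse (real (Suc m0)) < infdist x F" using reals_Archimedean[OF pos] by blast
        moreover have "1 / real (m0 + 2) \<le> inverse (real (Suc m0))" by (simp add: field_simps)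
        ultimately have ex: "?P m0" by linarith
        define m where "m = (LEAST m. ?P m)"
        have m: "?P m" unfolding m_def using ex by (rule LeastI)
        have "infdist x F < 1 / real (m + 1)"
        proof (cases m)
          case 0
          have "1 / real (Suc n) \<le> 1" by simp
          then have "infdist x F < 1" using lt by linarith
          then show ?thesis using 0 by simp
        next
          case (Suc j)
          then have "\<not> ?P j" using not_less_Least[of j ?P] by (simp add: m_def)
          then show ?thesis using Suc by (simp add: add.commute)
        qed
        with m have "x \<in> R m" using x by (simp add: R_def)
        moreover have "1 / real (m + 2) < 1 / real (Suc n)" using m lt by linarith
        then have "n \<le> m" by (simp add: field_simps)
        ultimately have "x \<in> R ((m - n) + n)" by simp
        then show ?thesis by blast
      qed
    qed
    show ?thesis
    proof (rule ennreal_le_of_tail[OF 1 _ 2])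
      fix n
      have "?H ((UNIV - F) \<inter> X) \<le> ?H (Y n) + (\<Sum>i. ?H (R (i + n)))"
        using hausdorff_outer_mono[OF cov] hausdorff_outer_Un hausdorff_outer_UN[of k "\<lambda>i. R (i + n)"]
        by (meson add_left_mono order_trans)
      then show "?H (F \<inter> X) + ?H ((UNIV - F) \<inter> X) \<le> ?H (F \<inter> X) + ?H (Y n) + (\<Sum>i. ?H (R (i + n)))"
        by (simp add: add.assoc add_left_mono)
    qed
  qed simp
  then show ?thesis
    using hausdorff_outer_Un[of k "F \<inter> X" "(UNIV - F) \<inter> X" for X]
    unfolding sets_hausdorff lambda_system_def
    by (auto intro!: antisym simp: Int_Un_distrib2[symmetric] Compl_partition)
next
  case True
  then show ?thesis by simp
qed


lemma borel_hausdorff: "sets borel \<subseteq> sets (hausdorff k)"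
proof -
  have "sets (borel :: rseq measure) = sigma_sets UNIV (Collect closed)"
    by (simp add: borel_eq_closed)
  also have "\<dots> \<subseteq> sets (hausdorff k)"
    using sets.sigma_sets_subset[of "Collect closed" "hausdorff k"] closed_hausdorff_measurable
    by auto
  finally show ?thesis .
qed

section \<open>Comparison with Lebesgue measure\<close>

text \<open>Common frame of both Vitali arguments: the sets \<open>E i\<close> cover, the disjoint
  sets \<open>D i\<close> pay for them. The factor is \<open>c = 1\<close> when the balls themselves
  cover, and 5 to the power of the dimension when their fivefold enlargements do.\<close>

lemma hausdorff_content_le_emeasure:
  assumes C: "countable C" and A: "A \<subseteq> (\<Union>i\<in>C. E i)" and disj: "disjoint_family_on D C"
    and U: "U \<in> sets M" and D: "\<And>i. i \<in> C \<Longrightarrow> D i \<in> sets M" "\<And>i. i \<in> C \<Longrightarrow> D i \<subseteq> U"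
    and E: "\<And>i. i \<in> C \<Longrightarrow> bounded (E i)" "\<And>i. i \<in> C \<Longrightarrow> diameter (E i) \<le> \<delta>"
    and w: "\<And>i. i \<in> C \<Longrightarrow> hweight k (E i) \<le> c * emeasure M (D i)" and \<delta>: "0 < \<delta>"
  shows "hausdorff_content k \<delta> A \<le> c * emeasure M U"
proof -
  define I where "I = to_nat_on C ` C"
  define f where "f = from_nat_into C"
  have fI: "f n \<in> C" if "n \<in> I" for n
    using that C by (auto simp: I_def f_def)
  have inj: "inj_on f I"
    using C by (auto simp: I_def f_def inj_on_def)
  define E' where "E' n = (if n \<in> I then E (f n) else {})" for n
  define D' where "D' n = (if n \<in> I then D (f n) else {})" for n
  have "A \<subseteq> (\<Union>n. E' n)"
  proof
    fix x assume "x \<in> A"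
    then obtain i where i: "i \<in> C" "x \<in> E i" using A by blast
    then have "x \<in> E' (to_nat_on C i)" using C by (simp add: E'_def I_def f_def)
    then show "x \<in> (\<Union>n. E' n)" by blast
  qed
  then have "hausdorff_content k \<delta> A \<le> (\<Sum>n. hweight k (E' n))"
    by (rule hausdorff_content_le) (use E fI \<delta> in \<open>auto simp: E'_def\<close>)
  also have "\<dots> \<le> (\<Sum>n. c * emeasure M (D' n))"
    by (intro suminf_le) (auto simp: E'_def D'_def w fI)
  also have "\<dots> = c * (\<Sum>n. emeasure M (D' n))"
    by (rule ennreal_suminf_cmult)
  also have "(\<Sum>n. emeasure M (D' n)) = emeasure M (\<Union>n. D' n)"
  proof (rule suminf_emeasure)
    show "range D' \<subseteq> sets M" using D fI by (auto simp: D'_def)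
    show "disjoint_family D'"
      using disj inj fI unfolding disjoint_family_on_def D'_def inj_on_def
      by (auto split: if_splits) (metis disjoint_iff)
  qed
  also have "c * emeasure M (\<Union>n. D' n) \<le> c * emeasure M U"
    using D fI U by (intro mult_left_mono emeasure_mono) (auto simp: D'_def split: if_splits)
  finally show ?thesis .
qed

text \<open>Here the normalization enters: an image of diameter at most \<open>2 * r\<close> weighs
  no more than the volume of a ball of radius \<open>r\<close>.\<close>

lemma hweight_ball_image:
  fixes \<Phi> :: "'a::euclidean_space \<Rightarrow> rseq"
  assumes lip: "\<And>x y. dist (\<Phi> x) (\<Phi> y) \<le> dist x y" and r: "0 < r"
  shows "bounded (\<Phi> ` ball x r)" "diameter (\<Phi> ` ball x r) \<le> 2 * r"
    "hweight DIM('a) (\<Phi> ` ball x r) \<le> emeasure lborel (ball x r)"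
proof -
  have d: "dist (\<Phi> y) (\<Phi> z) \<le> 2 * r" if "y \<in> ball x r" "z \<in> ball x r" for y z
    using lip[of y z] dist_triangle2[of y z x] that by (auto simp: dist_commute)
  show b: "bounded (\<Phi> ` ball x r)"
    unfolding bounded_def using d r by (intro exI[of _ "\<Phi> x"] exI[of _ "2 * r"]) auto
  show dia: "diameter (\<Phi> ` ball x r) \<le> 2 * r"
    by (rule diameter_le) (use d r in \<open>auto simp: dist_norm\<close>)
  have "(diameter (\<Phi> ` ball x r) / 2) ^ DIM('a) \<le> r ^ DIM('a)"
    using dia diameter_ge_0[OF b] by (intro power_mono) auto
  then show "hweight DIM('a) (\<Phi> ` ball x r) \<le> emeasure lborel (ball x r)"
    using r by (auto simp: hweight_def emeasure_ball intro!: ennreal_leI mult_left_mono)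
qed

text \<open>Vitali's covering lemma inside an open set of measure below \<open>e / 5^n\<close>: it
  contains disjoint balls whose fivefold enlargements cover \<open>N\<close>, and enlarging
  multiplies volumes by \<open>5^n\<close>.\<close>

lemma hausdorff_content_null_image:
  fixes \<Phi> :: "'a::euclidean_space \<Rightarrow> rseq"
  assumes lip: "\<And>x y. dist (\<Phi> x) (\<Phi> y) \<le> dist x y" and \<delta>: "0 < \<delta>"
    and N: "N \<in> sets borel" "emeasure lborel N = 0"
  shows "hausdorff_content DIM('a) \<delta> (\<Phi> ` N) = 0"
proof -
  have "hausdorff_content DIM('a) \<delta> (\<Phi> ` N) \<le> 0 + ennreal e" if e: "0 < e" for e
  proof -
    let ?n = "DIM('a)"
    obtain U where U: "open U" "N \<subseteq> U" "emeasure lborel (U - N) < ennreal (e / 5 ^ ?n)"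
      using outer_regular_lborel[OF N(1), of "e / 5 ^ ?n"] e by auto
    have mU: "emeasure lborel U \<le> ennreal (e / 5 ^ ?n)"
      using emeasure_Diff_null_set[of N lborel U] N U by (auto simp: null_sets_def)
    \<comment> \<open>Radii up to \<open>\<delta> / 10\<close> keep the diameter of the fivefold
      enlargements at most \<open>\<delta>\<close>.\<close>
    define K where "K = {(x, r). x \<in> N \<and> 0 < r \<and> r \<le> \<delta> / 10 \<and> ball x r \<subseteq> U}"
    have cov: "N \<subseteq> (\<Union>i\<in>K. ball (fst i) (snd i))"
    proof
      fix x assume x: "x \<in> N"
      then obtain r where r: "0 < r" "ball x r \<subseteq> U" using U openE by blast
      then have "(x, min r (\<delta> / 10)) \<in> K" using x \<delta> by (auto simp: K_def)
      then show "x \<in> (\<Union>i\<in>K. ball (fst i) (snd i))" using r \<delta> by force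
    qed
    have KB: "0 < snd i \<and> snd i \<le> \<delta> / 10" if "i \<in> K" for i
      using that by (auto simp: K_def)
    obtain C where C: "countable C" "C \<subseteq> K"
      "pairwise (\<lambda>i j. disjnt (ball (fst i) (snd i)) (ball (fst j) (snd j))) C"
      "N \<subseteq> (\<Union>i\<in>C. ball (fst i) (5 * snd i))"
      by (rule Vitali_covering_lemma_balls[OF cov KB]) (assumption, rule that)
    have K: "0 < snd i" "snd i \<le> \<delta> / 10" "ball (fst i) (snd i) \<subseteq> U" if "i \<in> C" for i
      using subsetD[OF C(2) that] by (simp_all add: K_def case_prod_unfold)
    have "hausdorff_content ?n \<delta> (\<Phi> ` N) \<le> ennreal (5 ^ ?n) * emeasure lborel U"
    proof (rule hausdorff_content_le_emeasure[where E="\<lambda>i. \<Phi> ` ball (fst i) (5 * snd i)"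
          and D="\<lambda>i. ball (fst i) (snd i)", OF C(1)])
      show "\<Phi> ` N \<subseteq> (\<Union>i\<in>C. \<Phi> ` ball (fst i) (5 * snd i))" using C(4) by blast
      show "disjoint_family_on (\<lambda>i. ball (fst i) (snd i)) C"
        using C(3) by (auto simp: disjoint_family_on_def pairwise_def disjnt_def)
      fix i assume i: "i \<in> C"
      show "bounded (\<Phi> ` ball (fst i) (5 * snd i))"
        by (rule hweight_ball_image[OF lip]) (use K[OF i] in simp)
      show "diameter (\<Phi> ` ball (fst i) (5 * snd i)) \<le> \<delta>"
        using hweight_ball_image(2)[OF lip, of "5 * snd i" "fst i"] K[OF i] by simp
      have "hweight ?n (\<Phi> ` ball (fst i) (5 * snd i)) \<le> emeasure lborel (ball (fst i) (5 * snd i))"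
        by (rule hweight_ball_image[OF lip]) (use K[OF i] in simp)
      also have "\<dots> = ennreal (5 ^ ?n) * emeasure lborel (ball (fst i) (snd i))"
        using K(1)[OF i] by (simp add: emeasure_ball ennreal_mult[symmetric] power_mult_distrib ac_simps)
      finally show "hweight ?n (\<Phi> ` ball (fst i) (5 * snd i)) \<le> \<dots>" .
    qed (use U \<delta> K in auto)
    also have "\<dots> \<le> ennreal (5 ^ ?n) * ennreal (e / 5 ^ ?n)"
      using mU by (rule mult_left_mono) simp
    also have "\<dots> = ennreal e" using e by (simp add: ennreal_mult[symmetric])
    finally show ?thesis by simp
  qed
  then have "hausdorff_content DIM('a) \<delta> (\<Phi> ` N) \<le> 0" by (rule ennreal_le_epsilon)
  then show ?thesis by simp
qed

text \<open>By Vitali's covering theorem disjoint small balls inside an open set barely larger than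
  \<open>S\<close> cover \<open>S\<close> up to a null set, whose image has content 0. No factor is
  lost because the balls are not enlarged.\<close>

lemma hausdorff_outer_lipschitz_image:
  fixes \<Phi> :: "'a::euclidean_space \<Rightarrow> rseq"
  assumes lip: "\<And>x y. dist (\<Phi> x) (\<Phi> y) \<le> dist x y" and S: "S \<in> sets borel"
  shows "hausdorff_outer DIM('a) (\<Phi> ` S) \<le> emeasure lborel S"
  unfolding hausdorff_outer_def
proof (rule SUP_least, rule ennreal_le_epsilon)
  fix \<delta> e :: real assume "\<delta> \<in> {0<..}" and e: "0 < e"
  then have \<delta>: "0 < \<delta>" by simp
  let ?n = "DIM('a)"
  obtain U where U: "open U" "S \<subseteq> U" "emeasure lborel (U - S) < ennreal e"
    using outer_regular_lborel[OF S e] by blast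
  have "emeasure lborel U \<le> emeasure lborel S + emeasure lborel (U - S)"
    using emeasure_subadditive[of S lborel "U - S"] S U by (simp add: Un_absorb1)
  also have "\<dots> \<le> emeasure lborel S + ennreal e"
    using U by (intro add_left_mono less_imp_le)
  finally have mU: "emeasure lborel U \<le> emeasure lborel S + ennreal e" .
  define K where "K = {(x, r). 0 < r \<and> r \<le> \<delta> / 2 \<and> ball x r \<subseteq> U}"
  obtain C where C: "countable C" "C \<subseteq> K"
    "pairwise (\<lambda>i j. disjnt (ball (fst i) (snd i)) (ball (fst j) (snd j))) C"
    "negligible (S - (\<Union>i\<in>C. ball (fst i) (snd i)))"
  proof (rule Vitali_covering_theorem_balls[of S K fst snd])
    fix x and d :: real assume x: "x \<in> S" and d: "0 < d"
    then obtain r where r: "0 < r" "ball x r \<subseteq> U" using U openE by blast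
    let ?r = "min r (min (d / 2) (\<delta> / 2))"
    have "(x, ?r) \<in> K" using r d \<delta> by (auto simp: K_def)
    then show "\<exists>i. i \<in> K \<and> x \<in> ball (fst i) (snd i) \<and> snd i < d"
      using r d \<delta> by (intro exI[of _ "(x, ?r)"]) auto
  qed blast
  have K: "0 < snd i" "snd i \<le> \<delta> / 2" "ball (fst i) (snd i) \<subseteq> U" if "i \<in> C" for i
    using subsetD[OF C(2) that] by (simp_all add: K_def case_prod_unfold)
  define B where "B = (\<Union>i\<in>C. ball (fst i) (snd i))"
  have B: "open B" by (auto simp: B_def)
  have N: "S - B \<in> sets borel" using S B by auto
  have N0: "emeasure lborel (S - B) = 0"
    using C(4) N by (simp add: B_def[symmetric] negligible_iff_null_sets null_sets_def)
  have "hausdorff_content ?n \<delta> (\<Phi> ` B) \<le> 1 * emeasure lborel U"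
  proof (rule hausdorff_content_le_emeasure[where E="\<lambda>i. \<Phi> ` ball (fst i) (snd i)"
        and D="\<lambda>i. ball (fst i) (snd i)", OF C(1)])
    show "\<Phi> ` B \<subseteq> (\<Union>i\<in>C. \<Phi> ` ball (fst i) (snd i))" by (auto simp: B_def)
    show "disjoint_family_on (\<lambda>i. ball (fst i) (snd i)) C"
      using C(3) by (auto simp: disjoint_family_on_def pairwise_def disjnt_def)
    fix i assume i: "i \<in> C"
    show "bounded (\<Phi> ` ball (fst i) (snd i))"
      "hweight ?n (\<Phi> ` ball (fst i) (snd i)) \<le> 1 * emeasure lborel (ball (fst i) (snd i))"
      using hweight_ball_image[OF lip K(1)[OF i]] by auto
    show "diameter (\<Phi> ` ball (fst i) (snd i)) \<le> \<delta>"
      using hweight_ball_image(2)[OF lip K(1)[OF i], of "fst i"] K[OF i] by simp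
  qed (use U \<delta> K in auto)
  then have 1: "hausdorff_content ?n \<delta> (\<Phi> ` B) \<le> emeasure lborel S + ennreal e"
    using mU by simp
  have 2: "hausdorff_content ?n \<delta> (\<Phi> ` (S - B)) = 0"
    by (rule hausdorff_content_null_image[OF lip \<delta> N N0])
  \<comment> \<open>Binary subadditivity is read off from the countable one: all terms but the first
    are copies of the null part.\<close>
  have "hausdorff_content ?n \<delta> (\<Phi> ` S)
      \<le> hausdorff_content ?n \<delta> (\<Union>n::nat. if n = 0 then \<Phi> ` B else \<Phi> ` (S - B))"
    by (rule hausdorff_content_mono) (auto split: if_splits intro: exI[of _ "Suc 0"])
  also have "\<dots> \<le> (\<Sum>n::nat. hausdorff_content ?n \<delta> (if n = 0 then \<Phi> ` B else \<Phi> ` (S - B)))"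
    by (rule hausdorff_content_UN)
  also have "\<dots> = (\<Sum>n\<in>{0::nat}. hausdorff_content ?n \<delta> (if n = 0 then \<Phi> ` B else \<Phi> ` (S - B)))"
    by (rule suminf_finite) (auto simp: 2)
  also have "\<dots> \<le> emeasure lborel S + ennreal e" using 1 by simp
  finally show "hausdorff_content ?n \<delta> (\<Phi> ` S) \<le> emeasure lborel S + ennreal e" .
qed

text \<open>The hypothesis \<open>iso\<close> is the isodiametric inequality.\<close>

lemma hausdorff_outer_expanding_image:
  fixes \<Phi> :: "'a::euclidean_space \<Rightarrow> rseq"
  assumes iso: "\<And>A :: 'a set. compact A \<Longrightarrow>
      emeasure lborel A \<le> ennreal (unit_ball_vol (real DIM('a)) * (diameter A / 2) ^ DIM('a))"
    and S: "S \<in> sets borel" and c: "0 < c" and \<delta>: "0 < \<delta>"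
    and exp: "\<And>x y. x \<in> S \<Longrightarrow> y \<in> S \<Longrightarrow> dist (\<Phi> x) (\<Phi> y) \<le> \<delta> \<Longrightarrow> dist x y \<le> c * dist (\<Phi> x) (\<Phi> y)"
  shows "emeasure lborel S \<le> ennreal (c ^ DIM('a)) * hausdorff_outer DIM('a) (\<Phi> ` S)"
proof -
  let ?n = "DIM('a)"
  \<comment> \<open>The factor stands on the left, so that the infimum over all covers can be taken
    on the right.\<close>
  have "inverse (ennreal (c ^ ?n)) * emeasure lborel S \<le> (\<Sum>i. hweight ?n (C i))"
    if C: "C \<in> hcovers \<delta> (\<Phi> ` S)" for C
  proof -
    \<comment> \<open>Closing the preimages makes them compact, as \<open>iso\<close> requires, and
      does not change their diameters.\<close>
    define D where "D i = closure (S \<inter> \<Phi> -` C i)" for i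
    have bC: "bounded (C i)" "diameter (C i) \<le> \<delta>" for i using C by (auto simp: hcovers_def)
    \<comment> \<open>Covering sets have diameter at most \<delta>, so the expansion bound is used
      at small distances only.\<close>
    have d: "dist x y \<le> c * diameter (C i)" if "x \<in> S \<inter> \<Phi> -` C i" "y \<in> S \<inter> \<Phi> -` C i" for x y i
    proof -
      have "dist (\<Phi> x) (\<Phi> y) \<le> diameter (C i)"
        using diameter_bounded_bound[OF bC(1)] that by blast
      moreover from this have "dist x y \<le> c * dist (\<Phi> x) (\<Phi> y)"
        using exp[of x y] that bC(2)[of i] by auto
      ultimately show ?thesis using c by (meson less_imp_le mult_left_mono order_trans)
    qed
    have bD: "bounded (S \<inter> \<Phi> -` C i)" for i
      unfolding bounded_any_center[where a=undefined] by (metis (no_types) d bounded_any_center bounded_def)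
    have cD: "compact (D i)" for i unfolding D_def using bD by simp
    have "emeasure lborel (D i) \<le> ennreal (c ^ ?n) * hweight ?n (C i)" for i
    proof (cases "S \<inter> \<Phi> -` C i = {}")
      case False
      then have ne: "C i \<noteq> {}" by blast
      have "diameter (D i) \<le> c * diameter (C i)"
        unfolding D_def diameter_closure[OF bD]
        by (rule diameter_le) (use False d[of _ i] in \<open>auto simp: dist_norm\<close>)
      moreover have "0 \<le> diameter (D i)" using cD by (intro diameter_ge_0 compact_imp_bounded)
      ultimately have "(diameter (D i) / 2) ^ ?n \<le> (c * (diameter (C i) / 2)) ^ ?n"
        by (intro power_mono) auto
      then have "unit_ball_vol (real ?n) * (diameter (D i) / 2) ^ ?n
          \<le> unit_ball_vol (real ?n) * (c ^ ?n * (diameter (C i) / 2) ^ ?n)"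
        unfolding power_mult_distrib[of c] by (rule mult_left_mono) simp
      then have "unit_ball_vol (real ?n) * (diameter (D i) / 2) ^ ?n
          \<le> c ^ ?n * (unit_ball_vol (real ?n) * (diameter (C i) / 2) ^ ?n)"
        by (simp only: mult.left_commute)
      then have "emeasure lborel (D i)
          \<le> ennreal (c ^ ?n * (unit_ball_vol (real ?n) * (diameter (C i) / 2) ^ ?n))"
        using iso[OF cD, of i] ennreal_leI order_trans by blast
      also have "\<dots> = ennreal (c ^ ?n) * hweight ?n (C i)"
        using ne c by (simp add: hweight_def ennreal_mult' del: power_divide)
      finally show ?thesis .
    qed (simp add: D_def)
    then have le: "(\<Sum>i. emeasure lborel (D i)) \<le> ennreal (c ^ ?n) * (\<Sum>i. hweight ?n (C i))"
      by (subst ennreal_suminf_cmult[symmetric]) (intro suminf_le, auto)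
    have "emeasure lborel S \<le> emeasure lborel (\<Union>i. D i)"
    proof (rule emeasure_mono)
      show "S \<subseteq> (\<Union>i. D i)"
      proof
        fix x assume x: "x \<in> S"
        then obtain i where "\<Phi> x \<in> C i" using C by (force simp: hcovers_def)
        then have "x \<in> D i" unfolding D_def using x closure_subset[of "S \<inter> \<Phi> -` C i"] by blast
        then show "x \<in> (\<Union>i. D i)" by blast
      qed
    qed (auto simp: D_def)
    also have "\<dots> \<le> (\<Sum>i. emeasure lborel (D i))"
      by (rule emeasure_subadditive_countably) (auto simp: D_def)
    also note le
    finally have "emeasure lborel S \<le> ennreal (c ^ ?n) * (\<Sum>i. hweight ?n (C i))" .
    then have "inverse (ennreal (c ^ ?n)) * emeasure lborel S
        \<le> inverse (ennreal (c ^ ?n)) * (ennreal (c ^ ?n) * (\<Sum>i. hweight ?n (C i)))"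
      by (rule mult_left_mono) simp
    also have "\<dots> = (\<Sum>i. hweight ?n (C i))"
      using c by (simp add: mult.assoc[symmetric] inverse_ennreal ennreal_mult[symmetric])
    finally show ?thesis .
  qed
  then have "inverse (ennreal (c ^ ?n)) * emeasure lborel S \<le> hausdorff_content ?n \<delta> (\<Phi> ` S)"
    unfolding hausdorff_content_eq by (rule INF_greatest)
  also have "\<dots> \<le> hausdorff_outer ?n (\<Phi> ` S)" by (rule hausdorff_content_le_outer[OF \<delta>])
  finally have "ennreal (c ^ ?n) * (inverse (ennreal (c ^ ?n)) * emeasure lborel S)
      \<le> ennreal (c ^ ?n) * hausdorff_outer ?n (\<Phi> ` S)"
    by (rule mult_left_mono) simp
  then show ?thesis
    using c by (simp add: mult.assoc[symmetric] inverse_ennreal ennreal_mult[symmetric])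
qed

section \<open>The isodiametric inequality on the line and in the plane\<close>

text \<open>The interval of length \<open>r\<close> starting at the infimum contains the set. This
  serves for subsets of the line, for vertical sections of planar sets and for the superlevel sets
  of the section length.\<close>

lemma emeasure_real_le_spread:
  fixes B :: "real set"
  assumes r: "0 \<le> r" and B: "\<And>x y. x \<in> B \<Longrightarrow> y \<in> B \<Longrightarrow> x - y \<le> r"
  shows "emeasure lborel B \<le> ennreal r"
proof (cases "B = {}")
  case False
  then obtain z where z: "z \<in> B" by blast
  have bd: "bdd_below B" using B[OF z] by (intro bdd_belowI[of _ "z - r"]) (auto simp: algebra_simps)
  have "B \<subseteq> {Inf B..Inf B + r}"
  proof
    fix x assume x: "x \<in> B"
    have "x - r \<le> Inf B" using False B[OF x] by (intro cInf_greatest) (auto simp: algebra_simps)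
    then show "x \<in> {Inf B..Inf B + r}" using cInf_lower[OF x bd] by simp
  qed
  then have "emeasure lborel B \<le> emeasure lborel {Inf B..Inf B + r}" by (intro emeasure_mono) auto
  then show ?thesis using r by simp
qed simp

lemma isodiametric_real:
  fixes A :: "real set"
  assumes A: "compact A"
  shows "emeasure lborel A \<le> ennreal (unit_ball_vol (real DIM(real)) * (diameter A / 2) ^ DIM(real))"
proof -
  have "emeasure lborel A \<le> ennreal (diameter A)"
  proof (rule emeasure_real_le_spread)
    show "x - y \<le> diameter A" if "x \<in> A" "y \<in> A" for x y
      using diameter_bounded_bound[OF compact_imp_bounded[OF A] that] by (auto simp: dist_real_def)
  qed (simp add: A compact_imp_bounded diameter_ge_0)
  then show ?thesis by (simp add: unit_ball_vol_1)
qed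

text \<open>The area of a quarter disc of radius \<open>d\<close>, which is also that of a full disc
  of diameter \<open>d\<close>, the extremal case of the isodiametric inequality.\<close>

lemma nn_integral_quarter_disc:
  fixes d :: real
  assumes d: "0 \<le> d"
  shows "(\<integral>\<^sup>+t. ennreal (indicator {0..d} t * sqrt \<bar>d\<^sup>2 - t\<^sup>2\<bar>) \<partial>lborel) = ennreal (pi * d\<^sup>2 / 4)"
proof (cases "d = 0")
  case True
  have *: "indicator {0..d} t * sqrt \<bar>d\<^sup>2 - t\<^sup>2\<bar> = 0" for t
    using True by (auto simp: indicator_def)
  show ?thesis unfolding * using True by simp
next
  case False
  with d have d: "0 < d" by simp
  \<comment> \<open>The elementary primitive of \<open>sqrt (d^2 - t^2)\<close>. Its two summands
    are not differentiable at \<open>t = d\<close>, hence the fundamental theorem in the form for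
    the open interval.\<close>
  define F where "F t = (t * sqrt (d\<^sup>2 - t\<^sup>2) + d\<^sup>2 * arcsin (t / d)) / 2" for t
  have "((\<lambda>t. sqrt \<bar>d\<^sup>2 - t\<^sup>2\<bar>) has_integral F d - F 0) {0..d}"
  proof (rule fundamental_theorem_of_calculus_interior)
    show "continuous_on {0..d} F"
      unfolding F_def using d by (intro continuous_intros) (auto simp: field_simps)
    fix t assume t: "t \<in> {0<..<d}"
    then have tt: "t\<^sup>2 < d\<^sup>2" by (intro power_strict_mono) auto
    have "\<bar>t / d\<bar> < 1" using t d by simp
    then have *: "- 1 < t / d" "t / d < 1" by linarith+
    have "1 - (t / d)\<^sup>2 = (d\<^sup>2 - t\<^sup>2) / d\<^sup>2" using d by (simp add: power_divide diff_divide_distrib)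
    then have s: "sqrt (1 - (t / d)\<^sup>2) = sqrt (d\<^sup>2 - t\<^sup>2) / d" using d by (simp add: real_sqrt_divide)
    define w where "w = sqrt (d\<^sup>2 - t\<^sup>2)"
    have w: "0 < w" "w * w = d * d - t * t" using tt by (auto simp: w_def power2_eq_square)
    have 1: "((\<lambda>t. sqrt (d\<^sup>2 - t\<^sup>2)) has_real_derivative - t / w) (at t)"
      using tt w by (auto intro!: derivative_eq_intros simp: field_simps w_def)
    have 2: "((\<lambda>t. arcsin (t / d)) has_real_derivative 1 / w) (at t)"
      using DERIV_chain2[OF DERIV_arcsin[OF *] DERIV_cdivide[OF DERIV_ident]] s d by (simp add: w_def)
    have "(F has_real_derivative w) (at t)"
      unfolding F_def
      using DERIV_cdivide[OF DERIV_add[OF DERIV_mult[OF DERIV_ident 1] DERIV_cmult[OF 2, of "d\<^sup>2"]], of 2]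
      by (rule DERIV_cong) (use w w_def in \<open>simp add: field_simps power2_eq_square\<close>)
    then show "(F has_vector_derivative sqrt \<bar>d\<^sup>2 - t\<^sup>2\<bar>) (at t)"
      using tt by (simp add: w_def has_real_derivative_iff_has_vector_derivative)
  qed (use d in simp)
  then have "(\<integral>\<^sup>+t. ennreal (indicator {0..d} t * sqrt \<bar>d\<^sup>2 - t\<^sup>2\<bar>) \<partial>lborel) = ennreal (F d - F 0)"
    by (intro nn_integral_has_integral_lebesgue) auto
  also have "F d - F 0 = pi * d\<^sup>2 / 4" using d by (simp add: F_def)
  finally show ?thesis .
qed

text \<open>Two Steiner symmetrizations: \<open>A\<close> has the area of \<open>{(x, t). 0 \<le> t < m x}\<close>, where \<open>m x\<close> is the
  length of the section at \<open>x\<close>; the sections of the latter set at height \<open>t\<close> have length at most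
  \<open>sqrt (d\<^sup>2 - t\<^sup>2)\<close>.\<close>

lemma isodiametric_plane:
  fixes A :: "(real \<times> real) set"
  assumes A: "compact A"
  shows "emeasure lborel A
     \<le> ennreal (unit_ball_vol (real DIM(real \<times> real)) * (diameter A / 2) ^ DIM(real \<times> real))"
proof -
  define d where "d = diameter A"
  have bA: "bounded A" using A by (rule compact_imp_bounded)
  have d0: "0 \<le> d" using bA by (simp add: d_def diameter_ge_0)
  have dd: "dist p q \<le> d" if "p \<in> A" "q \<in> A" for p q
    using diameter_bounded_bound[OF bA that] by (simp add: d_def)
  have dsq: "(x - x')\<^sup>2 + (y - y')\<^sup>2 \<le> d\<^sup>2" if "(x, y) \<in> A" "(x', y') \<in> A" for x y x' y'
    using dd[OF that] by (simp add: dist_Pair_Pair dist_real_def sqrt_le_D)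
  have Am: "A \<in> sets (lborel \<Otimes>\<^sub>M lborel)" unfolding lborel_prod using A by (simp add: compact_imp_closed)
  have fin: "emeasure lborel (Pair x -` A) \<le> ennreal d" for x
  proof (rule emeasure_real_le_spread[OF d0])
    fix y y' assume "y \<in> Pair x -` A" "y' \<in> Pair x -` A"
    then show "y - y' \<le> d" using dd[of "(x, y)" "(x, y')"] by (auto simp: dist_Pair_Pair dist_real_def)
  qed
  define m where "m x = measure lborel (Pair x -` A)" for x
  have em: "emeasure lborel (Pair x -` A) = ennreal (m x)" for x
    unfolding m_def using fin[of x] by (intro emeasure_eq_ennreal_measure) (auto simp: top_unique)
  have m0: "0 \<le> m x" for x by (simp add: m_def)
  have [measurable]: "m \<in> borel_measurable borel"
    using lborel.measurable_emeasure_Pair[OF Am] unfolding m_def measure_def by measurable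
  \<comment> \<open>Otherwise the spread of the section, and with it its measure, would be at most
    \<open>t\<close>.\<close>
  have long: "\<exists>a b. (x, a) \<in> A \<and> (x, b) \<in> A \<and> t < b - a" if t: "0 \<le> t" "t < m x" for x t
  proof (rule ccontr)
    assume "\<not> ?thesis"
    then have "emeasure lborel (Pair x -` A) \<le> ennreal t"
      using t by (intro emeasure_real_le_spread) (auto simp: not_less)
    then show False using t by (simp add: em)
  qed
  \<comment> \<open>The bounds on \<open>b - a\<close> and \<open>b' - a'\<close> add up to
    \<open>(b - a') + (b' - a) > 2 * t\<close>, so one of the two diagonals has vertical extent at
    least \<open>t\<close>.\<close>
  have sec: "(x - x')\<^sup>2 + t\<^sup>2 \<le> d\<^sup>2" if t: "0 \<le> t" "t < m x" "t < m x'" for x x' t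
  proof -
    obtain a b a' b' where ab: "(x, a) \<in> A" "(x, b) \<in> A" "t < b - a" "(x', a') \<in> A" "(x', b') \<in> A" "t < b' - a'"
      using long t by metis
    then consider "t \<le> b - a'" | "t \<le> b' - a" by linarith
    then show ?thesis
    proof cases
      case 1
      then have "t\<^sup>2 \<le> (b - a')\<^sup>2" using t by (intro power_mono)
      then show ?thesis using dsq[OF ab(2,4)] by linarith
    next
      case 2
      then have "t\<^sup>2 \<le> (b' - a)\<^sup>2" using t by (intro power_mono)
      then show ?thesis using dsq[OF ab(1,5)] by (simp add: power2_commute)
    qed
  qed
  have bound: "(\<integral>\<^sup>+x. indicator {0..<m x} t \<partial>lborel) \<le> ennreal (indicator {0..d} t * sqrt \<bar>d\<^sup>2 - t\<^sup>2\<bar>)"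
    for t
  proof (cases "0 \<le> t \<and> (\<exists>x. t < m x)")
    case True
    then have t: "0 \<le> t" by simp
    from True obtain x where "t < m x" by blast
    then have t2: "t\<^sup>2 \<le> d\<^sup>2" using sec[of t x x] t by simp
    then have td: "t \<le> d" using d0 by (rule power2_le_imp_le)
    have "(\<integral>\<^sup>+x. indicator {0..<m x} t \<partial>lborel) = (\<integral>\<^sup>+x. indicator {x. t < m x} x \<partial>lborel)"
      by (rule nn_integral_cong) (use t in \<open>auto simp: indicator_def\<close>)
    also have "\<dots> = emeasure lborel {x. t < m x}" by (rule nn_integral_indicator) simp
    also have "\<dots> \<le> ennreal (sqrt \<bar>d\<^sup>2 - t\<^sup>2\<bar>)"
    proof (rule emeasure_real_le_spread)
      fix x y assume "x \<in> {x. t < m x}" "y \<in> {x. t < m x}"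
      then have "(x - y)\<^sup>2 \<le> \<bar>d\<^sup>2 - t\<^sup>2\<bar>" using sec[of t x y] t by auto
      then show "x - y \<le> sqrt \<bar>d\<^sup>2 - t\<^sup>2\<bar>" by (rule real_le_rsqrt)
    qed simp
    finally show ?thesis using t td by simp
  next
    case False
    then have "(\<integral>\<^sup>+x. indicator {0..<m x} t \<partial>lborel) = (\<integral>\<^sup>+x. 0 \<partial>(lborel :: real measure))"
      by (intro nn_integral_cong) (auto simp: indicator_def)
    then show ?thesis by simp
  qed
  have "emeasure lborel A = (\<integral>\<^sup>+x. emeasure lborel (Pair x -` A) \<partial>lborel)"
    using lborel.emeasure_pair_measure_alt[OF Am] by (simp add: lborel_prod)
  \<comment> \<open>The length \<open>m x\<close> becomes an integral over heights, so that
    exchanging the integrals turns vertical sections into horizontal ones.\<close>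
  also have "\<dots> = (\<integral>\<^sup>+x. \<integral>\<^sup>+t. indicator {0..<m x} t \<partial>lborel \<partial>lborel)"
    by (rule nn_integral_cong) (simp add: em m0)
  also have "\<dots> = (\<integral>\<^sup>+t. \<integral>\<^sup>+x. indicator {0..<m x} t \<partial>lborel \<partial>lborel)"
    by (rule lborel_pair.Fubini') (simp add: indicator_def, measurable)
  also have "\<dots> \<le> (\<integral>\<^sup>+t. ennreal (indicator {0..d} t * sqrt \<bar>d\<^sup>2 - t\<^sup>2\<bar>) \<partial>lborel)"
    by (rule nn_integral_mono) (rule bound)
  also have "\<dots> = ennreal (pi * d\<^sup>2 / 4)" by (rule nn_integral_quarter_disc[OF d0])
  finally show ?thesis by (simp add: d_def unit_ball_vol_2 power_divide power2_eq_square)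
qed

section \<open>Hausdorff measure and integrals under a parametrization\<close>

text \<open>The Lipschitz bound gives one inequality, expansion at small scales the other up to a
  power of \<open>c\<close>, and \<open>c\<close> tends to 1. The local form of \<open>exp\<close>
  is made for the circle, where chords approach arcs only in the limit.\<close>

lemma hausdorff_outer_local_isometry:
  fixes \<Phi> :: "'a::euclidean_space \<Rightarrow> rseq"
  assumes iso: "\<And>A :: 'a set. compact A \<Longrightarrow>
      emeasure lborel A \<le> ennreal (unit_ball_vol (real DIM('a)) * (diameter A / 2) ^ DIM('a))"
    and lip: "\<And>x y. dist (\<Phi> x) (\<Phi> y) \<le> dist x y"
    and exp: "\<And>c. 1 < c \<Longrightarrow> \<exists>\<delta>>0. \<forall>x\<in>T. \<forall>y\<in>T.
        dist (\<Phi> x) (\<Phi> y) \<le> \<delta> \<longrightarrow> dist x y \<le> c * dist (\<Phi> x) (\<Phi> y)"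
    and S: "S \<in> sets borel" "S \<subseteq> T"
  shows "hausdorff_outer DIM('a) (\<Phi> ` S) = emeasure lborel S"
proof (rule antisym)
  let ?H = "hausdorff_outer DIM('a) (\<Phi> ` S)"
  show "?H \<le> emeasure lborel S" by (rule hausdorff_outer_lipschitz_image[OF lip S(1)])
  have le: "emeasure lborel S \<le> ennreal (c ^ DIM('a)) * ?H" if c: "1 < c" for c
  proof -
    obtain \<delta> where "0 < \<delta>" "\<And>x y. x \<in> T \<Longrightarrow> y \<in> T \<Longrightarrow> dist (\<Phi> x) (\<Phi> y) \<le> \<delta> \<Longrightarrow>
        dist x y \<le> c * dist (\<Phi> x) (\<Phi> y)"
      using exp[OF c] by blast
    then show ?thesis
      using S c by (intro hausdorff_outer_expanding_image[OF iso S(1), of c \<delta>]) auto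
  qed
  show "emeasure lborel S \<le> ?H"
  proof (cases "?H = top")
    case False
    have "((\<lambda>c. ennreal (c ^ DIM('a))) \<longlongrightarrow> ennreal (1 ^ DIM('a))) (at_right 1)"
      by (intro tendsto_intros)
    then have "((\<lambda>c. ?H * ennreal (c ^ DIM('a))) \<longlongrightarrow> ?H * ennreal (1 ^ DIM('a))) (at_right 1)"
      using False by (intro ennreal_tendsto_cmult) (auto simp: less_top)
    moreover have "eventually (\<lambda>c. emeasure lborel S \<le> ?H * ennreal (c ^ DIM('a))) (at_right 1)"
      using eventually_at_right_less[of "1::real"] by eventually_elim (use le in \<open>simp add: mult.commute\<close>)
    ultimately have "emeasure lborel S \<le> ?H * ennreal (1 ^ DIM('a))"
      by (intro tendsto_lowerbound) auto
    then show ?thesis by simp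
  qed simp
qed

text \<open>By \<open>eq\<close>, \<Phi> carries Lebesgue measure on \<open>T\<close> to Hausdorff
  measure on \<open>E\<close>, as far as Borel sets are concerned; equality of these measures
  transfers all integrals.\<close>

lemma hausdorff_integral_param:
  fixes \<Phi> :: "'a::euclidean_space \<Rightarrow> rseq" and f :: "rseq \<Rightarrow> real"
  assumes E: "E \<in> sets borel" and T: "T \<in> sets borel" and \<Phi>: "continuous_on UNIV \<Phi>"
    and img: "\<And>x. x \<in> T \<Longrightarrow> \<Phi> x \<in> E"
    and eq: "\<And>B. B \<in> sets borel \<Longrightarrow> hausdorff_outer n (E \<inter> B) = emeasure lborel (T \<inter> \<Phi> -` B)"
    and f: "set_borel_measurable borel E f"
  shows "set_lebesgue_integral (hausdorff n) E f = set_lebesgue_integral lborel T (\<lambda>x. f (\<Phi> x))"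
    and "set_integrable (hausdorff n) E f \<longleftrightarrow> set_integrable lborel T (\<lambda>x. f (\<Phi> x))"
proof -
  define g where "g x = indicator E x *\<^sub>R f x" for x
  have g[measurable]: "g \<in> borel_measurable borel" using f by (simp add: g_def[abs_def] set_borel_measurable_def)
  have id[measurable]: "(\<lambda>x. x) \<in> measurable (hausdorff n) borel"
    using borel_hausdorff[of n] by (auto simp: measurable_def)
  have \<Phi>m[measurable]: "\<Phi> \<in> borel_measurable borel" using \<Phi> by (rule borel_measurable_continuous_onI)
  \<comment> \<open>\<open>hausdorff n\<close> lives on the Caratheodory measurable sets. Its image
    under the identity is the restriction to Borel sets, which can be compared with
    \<open>?N\<close>.\<close>
  let ?M = "density (distr (hausdorff n) borel (\<lambda>x. x)) (\<lambda>x. ennreal (indicator E x))"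
  let ?N = "distr (density lborel (\<lambda>x. ennreal (indicator T x))) borel \<Phi>"
  note [measurable] = E T
  have MN: "?M = ?N"
  proof (rule measure_eqI)
    fix B assume "B \<in> sets ?M"
    then have B[measurable]: "B \<in> sets borel" by simp
    have "emeasure ?M B = emeasure (distr (hausdorff n) borel (\<lambda>x. x)) (E \<inter> B)"
      by (subst emeasure_density) (auto simp: ennreal_indicator nn_integral_cmult_indicator[symmetric]
          simp flip: nn_integral_indicator intro!: nn_integral_cong split: split_indicator)
    also have "\<dots> = emeasure (hausdorff n) (E \<inter> B)"
      by (subst emeasure_distr) auto
    also have "\<dots> = hausdorff_outer n (E \<inter> B)"
      using borel_hausdorff[of n] by (intro emeasure_hausdorff) auto
    also have "\<dots> = emeasure lborel (T \<inter> \<Phi> -` B)" by (rule eq[OF B])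
    also have "\<dots> = emeasure (density lborel (\<lambda>x. ennreal (indicator T x))) (\<Phi> -` B)"
      using measurable_sets[OF \<Phi>m B]
      by (subst emeasure_density) (auto simp: ennreal_indicator
          simp flip: nn_integral_indicator intro!: nn_integral_cong split: split_indicator)
    also have "\<dots> = emeasure ?N B"
      by (subst emeasure_distr) auto
    finally show "emeasure ?M B = emeasure ?N B" .
  qed simp
  have eqI: "integral\<^sup>L (hausdorff n) g = integral\<^sup>L ?M g"
  proof -
    have "integral\<^sup>L ?M g = (\<integral>x. indicator E x *\<^sub>R g x \<partial>distr (hausdorff n) borel (\<lambda>x. x))"
      by (subst integral_density) auto
    also have "\<dots> = (\<integral>x. indicator E x *\<^sub>R g x \<partial>hausdorff n)"
      by (subst integral_distr) auto
    finally show ?thesis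
      by (auto simp: g_def intro!: Bochner_Integration.integral_cong split: split_indicator)
  qed
  have [measurable]: "(\<lambda>x. g (\<Phi> x)) \<in> borel_measurable borel" by measurable
  have eqN: "integral\<^sup>L ?N g = (\<integral>x. indicator T x *\<^sub>R f (\<Phi> x) \<partial>lborel)"
    by (subst integral_distr, simp, simp, subst integral_density, simp_all)
       (auto simp: g_def img intro!: Bochner_Integration.integral_cong split: split_indicator)
  show "set_lebesgue_integral (hausdorff n) E f = set_lebesgue_integral lborel T (\<lambda>x. f (\<Phi> x))"
    unfolding set_lebesgue_integral_def g_def[symmetric] using eqI eqN MN by simp
  have "set_integrable (hausdorff n) E f \<longleftrightarrow> integrable (distr (hausdorff n) borel (\<lambda>x. x)) g"
    using integrable_distr_eq[OF id g] by (simp add: set_integrable_def g_def[abs_def])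
  also have "\<dots> \<longleftrightarrow> integrable ?M g"
    by (subst integrable_density, simp_all)
       (auto simp: g_def intro!: Bochner_Integration.integrable_cong split: split_indicator)
  also have "\<dots> \<longleftrightarrow> integrable ?N g" by (simp add: MN)
  also have "\<dots> \<longleftrightarrow> set_integrable lborel T (\<lambda>x. f (\<Phi> x))"
    unfolding set_integrable_def
    by (subst integrable_distr_eq, simp, simp, subst integrable_density, simp_all)
       (auto simp: g_def img intro!: Bochner_Integration.integrable_cong split: split_indicator)
  finally show "set_integrable (hausdorff n) E f \<longleftrightarrow> set_integrable lborel T (\<lambda>x. f (\<Phi> x))" .
qed

section \<open>Coordinates and charts\<close>

lemma coord_simps [simp]:
  "coord 0 i = 0" "coord (x + y) i = coord x i + coord y i" "coord (x - y) i = coord x i - coord y i"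
  "coord (- x) i = - coord x i" "coord (a *\<^sub>R x) i = a * coord x i"
  "coord (ebasis i) j = (if i = j then 1 else 0)"
  by (simp_all add: zero_rseq.rep_eq plus_rseq.rep_eq minus_rseq.rep_eq uminus_rseq.rep_eq
      scaleR_rseq.rep_eq ebasis.rep_eq)

lemma inner_ebasis: "inner (ebasis i) x = coord x i" "inner x (ebasis i) = coord x i"
proof -
  show "inner (ebasis i) x = coord x i"
    by (subst inner_rseq_superset[of "{i}"]) auto
  then show "inner x (ebasis i) = coord x i" by (simp add: inner_commute)
qed

lemma continuous_on_coord [continuous_intros]:
  "continuous_on S f \<Longrightarrow> continuous_on S (\<lambda>x. coord (f x) i)"
  unfolding inner_ebasis(2)[symmetric] by (intro continuous_intros)

lemma inner_euc:
  assumes "x \<in> euc n"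
  shows "inner x y = (\<Sum>i<n. coord x i * coord y i)"
  using assms by (intro inner_rseq_superset) (auto simp: euc_def not_less[symmetric])

lemma subspace_euc: "subspace (euc n)"
  by (auto simp: subspace_def euc_def)

lemma add_ebasis_euc: "x \<in> euc n \<Longrightarrow> i < n \<Longrightarrow> x + t *\<^sub>R ebasis i \<in> euc n"
  by (auto simp: euc_def)

lemma partial_eqI: "((\<lambda>t. f (x + t *\<^sub>R ebasis i)) has_vector_derivative D) (at 0) \<Longrightarrow> partial i f x = D"
  unfolding partial_def by (rule vector_derivative_at)

text \<open>\<open>F\<close> is an invariant: a class closed under partial derivatives contains all
  iterated ones, so only its members need checking. The smoothness of the charts and of the forms
  below is obtained this way.\<close>

lemma C_on_class:
  assumes U: "openin (top_of_set (euc k)) U" and f: "f \<in> F"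
    and cont: "\<And>g. g \<in> F \<Longrightarrow> continuous_on U g"
    and diff: "\<And>g i x. g \<in> F \<Longrightarrow> i < k \<Longrightarrow> x \<in> U \<Longrightarrow> (\<lambda>t. g (x + t *\<^sub>R ebasis i)) differentiable (at (0::real))"
    and closed: "\<And>g i. g \<in> F \<Longrightarrow> i < k \<Longrightarrow> partial i g \<in> F"
  shows "C_on r k U f"
proof -
  have F: "partials is f \<in> F" if "set is \<subseteq> {..<k}" for "is"
    using that by (induction "is") (auto intro: f closed)
  show ?thesis
    unfolding C_on_def using U cont[OF F] diff[OF F] by auto
qed

lemma C_on_mono: "C_on r k U f \<Longrightarrow> r' \<le> r \<Longrightarrow> C_on r' k U f"
  unfolding C_on_def by (meson order_trans)

lemma local_param_mono: "local_param r k M U \<phi> \<Longrightarrow> r' \<le> r \<Longrightarrow> local_param r' k M U \<phi>"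
  unfolding local_param_def using C_on_mono by blast

lemma submanifold_mono: "submanifold r k n M \<Longrightarrow> r' \<le> r \<Longrightarrow> submanifold r' k n M"
  unfolding submanifold_def using local_param_mono by blast

lemma C_on_openin: "C_on r k U f \<Longrightarrow> openin (top_of_set (euc k)) U"
  by (simp add: C_on_def)

lemma eventually_in_chart:
  assumes U: "openin (top_of_set (euc k)) U" and x: "x \<in> U" and i: "i < k"
  shows "eventually (\<lambda>t. x + t *\<^sub>R ebasis i \<in> U) (at (0::real))"
proof -
  obtain T where T: "open T" "U = euc k \<inter> T" using U by (auto simp: openin_open)
  have "((\<lambda>t::real. x + t *\<^sub>R ebasis i) \<longlongrightarrow> x + 0 *\<^sub>R ebasis i) (at 0)" by (intro tendsto_intros)
  then have "eventually (\<lambda>t::real. x + t *\<^sub>R ebasis i \<in> T) (at 0)"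
    using T x by (intro topological_tendstoD) auto
  then show ?thesis
    by eventually_elim (use T x i add_ebasis_euc in auto)
qed

lemma partial_has_vector_derivative:
  assumes "C_on r k U f" "1 \<le> r" "x \<in> U" "i < k"
  shows "((\<lambda>t. f (x + t *\<^sub>R ebasis i)) has_vector_derivative partial i f x) (at 0)"
proof -
  have "(\<lambda>t. partials [] f (x + t *\<^sub>R ebasis i)) differentiable (at (0::real))"
    using assms(1)[unfolded C_on_def, THEN conjunct2, THEN conjunct2, THEN spec[of _ "[]"], THEN spec[of _ i]] assms(2-)
    by (simp add: one_enat_def)
  then show ?thesis unfolding partial_def by (simp add: vector_derivative_works)
qed

lemma partial2_has_vector_derivative:
  assumes "C_on \<infinity> k U f" "x \<in> U" "i < k" "j < k"
  shows "((\<lambda>t. partial j f (x + t *\<^sub>R ebasis i)) has_vector_derivative partial i (partial j f) x) (at 0)"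
proof -
  have "(\<lambda>t. partials [j] f (x + t *\<^sub>R ebasis i)) differentiable (at (0::real))"
    using assms(1)[unfolded C_on_def, THEN conjunct2, THEN conjunct2, THEN spec[of _ "[j]"], THEN spec[of _ i]] assms(2-)
    by simp
  then show ?thesis by (simp add: vector_derivative_works partial_def[of i "partial j f"])
qed

text \<open>The difference quotients stay in \<open>V\<close>, and closedness catches their limit.
  This keeps first and second derivatives of any chart of the circle inside its plane.\<close>

lemma vector_derivative_in_closed_subspace:
  fixes f :: "real \<Rightarrow> 'a::real_normed_vector"
  assumes D: "(f has_vector_derivative D) (at 0)" and V: "closed V" "subspace V"
    and f0: "f 0 \<in> V" and ev: "eventually (\<lambda>t. f t \<in> V) (at 0)"
  shows "D \<in> V"
proof -
  have "((\<lambda>t. norm (f t - f 0 - t *\<^sub>R D) / norm t) \<longlongrightarrow> 0) (at 0)"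
    using D by (simp add: has_vector_derivative_def has_derivative_at)
  moreover have "eventually (\<lambda>t. norm (f t - f 0 - t *\<^sub>R D) / norm t = norm ((f t - f 0) /\<^sub>R (t - 0) - D)) (at 0)"
    unfolding eventually_at_filter
  proof (intro always_eventually allI impI)
    fix t :: real assume t: "t \<noteq> 0"
    have "(f t - f 0) /\<^sub>R (t - 0) - D = inverse t *\<^sub>R (f t - f 0 - t *\<^sub>R D)"
      using t by (simp add: scaleR_diff_right)
    then show "norm (f t - f 0 - t *\<^sub>R D) / norm t = norm ((f t - f 0) /\<^sub>R (t - 0) - D)"
      by (simp add: divide_inverse mult.commute)
  qed
  ultimately have "((\<lambda>t. (f t - f 0) /\<^sub>R (t - 0) - D) \<longlongrightarrow> 0) (at 0)"
    using tendsto_cong tendsto_norm_zero_iff by fastforce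
  then have "((\<lambda>t. (f t - f 0) /\<^sub>R (t - 0)) \<longlongrightarrow> D) (at 0)"
    by (rule LIM_zero_cancel)
  moreover have "eventually (\<lambda>t. (f t - f 0) /\<^sub>R (t - 0) \<in> V) (at 0)"
    using ev by eventually_elim (use V f0 in \<open>auto intro: subspace_scale subspace_diff\<close>)
  ultimately show ?thesis using V(1) by (intro Lim_in_closed_set) auto
qed

text \<open>The vector 0 meets the description, and any \<open>w\<close> that does is orthogonal to
  itself.\<close>

lemma orth_proj_eq_0:
  assumes "0 \<in> V" "\<And>v. v \<in> V \<Longrightarrow> inner x v = 0"
  shows "orth_proj V x = 0"
  unfolding orth_proj_def
proof (rule the_equality)
  show "w = 0" if w: "w \<in> V \<and> (\<forall>v\<in>V. inner (x - w) v = 0)" for w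
    using w assms(2)[of w] by (force simp: inner_diff_left)
qed (use assms in auto)

lemma wedge_1: "wedge 1 v I = (if length I = 1 then coord (v 0) (I ! 0) else 0)"
proof -
  have "{\<pi>. \<pi> permutes {..<1::nat}} = {id}" by (auto simp: lessThan_Suc)
  moreover have "sorted_wrt (<) I" if "length I = 1" using that by (cases I) auto
  ultimately show ?thesis by (simp add: wedge_def sign_id)
qed

lemma wedge_2:
  "wedge 2 v I = (if length I = 2 \<and> I ! 0 < I ! 1
     then coord (v 0) (I ! 0) * coord (v 1) (I ! 1) - coord (v 0) (I ! 1) * coord (v 1) (I ! 0) else 0)"
proof -
  have "{..<2::nat} = {0, 1}" by auto
  then have "{\<pi>. \<pi> permutes {..<2::nat}} = {id, Transposition.transpose 0 1}"
    using permutes_doubleton_iff[of _ 0 "1::nat"] by auto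
  moreover have "id \<noteq> Transposition.transpose 0 (1::nat)" by (metis id_apply transpose_apply_first zero_neq_one)
  moreover have "sorted_wrt (<) I \<longleftrightarrow> I ! 0 < I ! 1" if "length I = 2" 
    using that by (auto simp: sorted_wrt_iff_nth_less less_Suc_eq numeral_2_eq_2)
  ultimately show ?thesis 
    by (auto simp: wedge_def sign_id sign_swap_id numeral_2_eq_2 lessThan_Suc)
qed

text \<open>A vector outside \<open>span {a, b}\<close> would make three independent vectors in the
  span of two.\<close>

lemma independent_pair_span:
  fixes a b u v :: "'a::real_vector"
  assumes ind: "a \<noteq> b" "independent {a, b}" and sub: "a \<in> span {u, v}" "b \<in> span {u, v}"
  shows "span {a, b} = span {u, v}"
proof
  show "span {a, b} \<subseteq> span {u, v}" using sub by (intro span_minimal) auto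
  have "x \<in> span {a, b}" if x: "x \<in> span {u, v}" for x
  proof (rule ccontr)
    assume n: "x \<notin> span {a, b}"
    then have "independent {x, a, b}" using ind by (simp add: independent_insert)
    then have "card {x, a, b} \<le> card {u, v}"
      using independent_span_bound[of "{u, v}" "{x, a, b}"] x sub by auto
    moreover have "x \<noteq> a" "x \<noteq> b" using n span_superset[of "{a, b}"] by auto
    then have "card {x, a, b} = 3" using ind(1) by simp
    moreover have "card {u, v} \<le> 2" by (simp add: card_insert_if)
    ultimately show False by simp
  qed
  then show "span {u, v} \<subseteq> span {a, b}" by blast
qed

section \<open>Great circles in the two-sphere\<close>

locale great_circle =
  fixes c s :: real
  assumes cs: "c\<^sup>2 + s\<^sup>2 = 1"
begin

definition u :: rseq where "u = ebasis 0"
definition v :: rseq where "v = c *\<^sub>R ebasis 1 + s *\<^sub>R ebasis 2"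
definition \<Phi> :: "real \<times> real \<Rightarrow> rseq" where "\<Phi> z = fst z *\<^sub>R u + snd z *\<^sub>R v"
definition \<gamma> :: "real \<Rightarrow> rseq" where "\<gamma> t = \<Phi> (cos t, sin t)"
definition P :: "rseq set" where "P = range \<Phi>"
definition L :: "rseq set" where "L = range \<gamma>"
text \<open>Orthogonal projection to the plane followed by the quarter turn;
  \<open>J (\<gamma> t)\<close> is the velocity of the circle.\<close>

definition J :: "rseq \<Rightarrow> rseq" where "J p = \<Phi> (- inner p v, inner p u)"
definition \<tau> :: "rseq \<Rightarrow> multivector" where "\<tau> p = (if p \<in> L then wedge 1 (\<lambda>_. J p) else (\<lambda>_. 0))"
definition uv :: "nat \<Rightarrow> rseq" where "uv i = (if i = 0 then u else v)"

lemma inner_uv [simp]: "inner u u = 1" "inner u v = 0" "inner v u = 0" "inner v v = 1"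
  using cs by (simp_all add: u_def v_def inner_add_left inner_add_right inner_ebasis power2_eq_square)

lemma uv_euc: "u \<in> euc 3" "v \<in> euc 3"
  by (auto simp: u_def v_def euc_def)

lemma coord_\<Phi>: "coord (\<Phi> z) i = (if i = 0 then fst z else if i = 1 then snd z * c else if i = 2 then snd z * s else 0)"
  by (auto simp: \<Phi>_def u_def v_def)

lemma inner_\<Phi>: "inner (\<Phi> z) u = fst z" "inner (\<Phi> z) v = snd z" "inner u (\<Phi> z) = fst z" "inner v (\<Phi> z) = snd z"
  by (simp_all add: \<Phi>_def inner_add_left inner_add_right)

lemma inner_\<Phi>_\<Phi>: "inner (\<Phi> z) (\<Phi> w) = inner z w"
  by (simp add: \<Phi>_def inner_add_left inner_add_right inner_prod_def)

lemma linear_\<Phi>: "linear \<Phi>"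
  by (rule linearI) (auto simp: \<Phi>_def algebra_simps)

lemma norm_\<Phi>: "norm (\<Phi> z) = norm z"
  by (simp add: norm_eq_sqrt_inner inner_\<Phi>_\<Phi>)

lemma dist_\<Phi>: "dist (\<Phi> z) (\<Phi> w) = dist z w"
  by (simp add: dist_norm norm_\<Phi> flip: linear_diff[OF linear_\<Phi>])

lemma continuous_\<Phi> [continuous_intros]:
  "continuous_on S f \<Longrightarrow> continuous_on S (\<lambda>x. \<Phi> (f x))"
  unfolding \<Phi>_def by (intro continuous_intros)

lemma P_iff: "p \<in> P \<longleftrightarrow> p = \<Phi> (inner p u, inner p v)"
  unfolding P_def by (auto simp: inner_\<Phi>)

lemma subspace_P: "subspace P"
  unfolding P_def by (rule linear_subspace_image[OF linear_\<Phi> subspace_UNIV])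

lemma P_span: "P = span {u, v}"
proof
  have "\<Phi> z \<in> span {u, v}" for z
    unfolding \<Phi>_def by (intro span_add span_scale) (auto intro: span_base)
  then show "P \<subseteq> span {u, v}" by (auto simp: P_def)
  have "u = \<Phi> (1, 0)" "v = \<Phi> (0, 1)" by (simp_all add: \<Phi>_def)
  then have "{u, v} \<subseteq> P" unfolding P_def by blast
  then show "span {u, v} \<subseteq> P" by (rule span_minimal[OF _ subspace_P])
qed

text \<open>The plane is the fixed set of the orthogonal projection onto it, which is
  continuous.\<close>

lemma closed_P: "closed P"
proof -
  have "P = {p. p = \<Phi> (inner p u, inner p v)}" using P_iff by blast
  also have "closed \<dots>" by (intro closed_Collect_eq continuous_intros)
  finally show ?thesis .
qed

lemma P_euc: "P \<subseteq> euc 3"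
  by (auto simp: P_def euc_def coord_\<Phi>)

lemma \<gamma>_P: "\<gamma> t \<in> P" by (simp add: \<gamma>_def P_def)

lemma inner_\<gamma>: "inner (\<gamma> t) (\<gamma> r) = cos (t - r)"
  by (simp add: \<gamma>_def inner_\<Phi>_\<Phi> inner_prod_def cos_diff)

lemma norm_\<gamma> [simp]: "norm (\<gamma> t) = 1"
  by (simp add: norm_eq_sqrt_inner inner_\<gamma>)

lemma L_iff: "p \<in> L \<longleftrightarrow> p \<in> P \<and> norm p = 1"
proof
  assume p: "p \<in> P \<and> norm p = 1"
  then obtain a b where ab: "p = \<Phi> (a, b)" by (auto simp: P_def)
  then have "a\<^sup>2 + b\<^sup>2 = 1" using p by (simp add: norm_\<Phi> norm_Pair)
  then obtain t where "a = cos t" "b = sin t" using sincos_total_2pi by metis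
  then show "p \<in> L" using ab by (auto simp: L_def \<gamma>_def)
qed (auto simp: L_def \<gamma>_P)

lemma LE: "p \<in> L \<Longrightarrow> (\<And>t. p = \<gamma> t \<Longrightarrow> thesis) \<Longrightarrow> thesis"
  by (auto simp: L_def)

lemma \<gamma>_L [simp]: "\<gamma> t \<in> L" by (simp add: L_def)

lemma continuous_\<gamma> [continuous_intros]:
  fixes f :: "'a::t2_space \<Rightarrow> real"
  shows "continuous_on S f \<Longrightarrow> continuous_on S (\<lambda>x. \<gamma> (f x))"
  unfolding \<gamma>_def by (intro continuous_\<Phi> continuous_on_Pair continuous_on_cos continuous_on_sin)

lemma \<gamma>_deriv: "(\<gamma> has_vector_derivative \<gamma> (t + pi / 2)) (at t)"
  unfolding \<gamma>_def \<Phi>_def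
  by (auto intro!: derivative_eq_intros simp: cos_add sin_add)

lemma \<gamma>_periodic: "\<gamma> (t + 2 * pi) = \<gamma> t" by (simp add: \<gamma>_def)

lemma L_eq: "L = \<gamma> ` {0..2 * pi}"
proof
  show "L \<subseteq> \<gamma> ` {0..2 * pi}"
  proof
    fix p assume "p \<in> L"
    then obtain t where t: "p = \<Phi> (cos t, sin t)" by (auto simp: L_def \<gamma>_def)
    obtain r where "0 \<le> r" "r < 2 * pi" "cos t = cos r" "sin t = sin r"
      using sincos_total_2pi[of "cos t" "sin t"] by auto
    then show "p \<in> \<gamma> ` {0..2 * pi}" using t by (auto simp: \<gamma>_def intro!: image_eqI[of _ _ r])
  qed
qed (auto simp: L_def)

lemma compact_L: "compact L"
  unfolding L_eq by (intro compact_continuous_image continuous_intros) auto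

lemma J_\<gamma>: "J (\<gamma> t) = \<gamma> (t + pi / 2)"
  by (simp add: J_def \<gamma>_def inner_\<Phi> cos_add sin_add)

text \<open>Angles within \<open>pi / 2\<close> of \<open>r\<close>: half the circle, and just the
  range in which \<open>arcsin\<close> recovers the angle.\<close>

definition arc :: "real \<Rightarrow> rseq set" where
  "arc r = {x \<in> euc 1. - (pi / 2) < coord x 0 - r \<and> coord x 0 - r < pi / 2}"

lemma circle_local_param: "local_param \<infinity> 1 L (arc r) (\<lambda>x. \<gamma> (coord x 0))"
proof -
  let ?\<phi> = "\<lambda>x. \<gamma> (coord x 0)"
  have part: "((\<lambda>t. \<gamma> (coord (x + t *\<^sub>R ebasis 0) 0 + a)) has_vector_derivative \<gamma> (coord x 0 + (a + pi / 2))) (at 0)"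
    for x a
  proof -
    have "((\<lambda>t. coord x 0 + t + a) has_vector_derivative 1) (at 0)"
      by (auto intro!: derivative_eq_intros simp flip: has_real_derivative_iff_has_vector_derivative)
    then show ?thesis
      using vector_diff_chain_at[of "\<lambda>t. coord x 0 + t + a" 1 0 \<gamma> "\<gamma> (coord x 0 + a + pi / 2)"]
        \<gamma>_deriv[of "coord x 0 + a"]
      by (simp add: o_def add.assoc)
  qed
  have op: "openin (top_of_set (euc 1)) (arc r)"
  proof -
    have "arc r = euc 1 \<inter> {x. - (pi / 2) < coord x 0 - r \<and> coord x 0 - r < pi / 2}" by (auto simp: arc_def)
    moreover have "open {x. - (pi / 2) < coord x 0 - r \<and> coord x 0 - r < pi / 2}"
      by (intro open_Collect_conj open_Collect_less continuous_intros)
    ultimately show ?thesis by auto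
  qed
  have C: "C_on \<infinity> 1 (arc r) ?\<phi>"
  proof (rule C_on_class[OF op])
    \<comment> \<open>Differentiation shifts the angle by \<open>pi / 2\<close>, so the angle shifts
      form a class closed under it.\<close>
    let ?F = "range (\<lambda>a x. \<gamma> (coord x 0 + a))"
    show "?\<phi> \<in> ?F" by (rule range_eqI[of _ _ 0]) simp
    show "continuous_on (arc r) g" if "g \<in> ?F" for g
      using that by (auto intro!: continuous_intros)
    show "(\<lambda>t. g (x + t *\<^sub>R ebasis i)) differentiable at 0" if "g \<in> ?F" "i < 1" for g i and x
    proof -
      obtain a where "g = (\<lambda>x. \<gamma> (coord x 0 + a))" using \<open>g \<in> ?F\<close> by blast
      then show ?thesis using differentiableI_vector[OF part[of x a]] \<open>i < 1\<close> by simp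
    qed
    show "partial i g \<in> ?F" if g: "g \<in> ?F" and i: "i < 1" for g i
    proof -
      obtain a where a: "g = (\<lambda>x. \<gamma> (coord x 0 + a))" using g by blast
      have "partial i g = (\<lambda>x. \<gamma> (coord x 0 + (a + pi / 2)))"
        unfolding a using i part by (intro ext partial_eqI) auto
      then show ?thesis by blast
    qed
  qed
  have img: "?\<phi> ` arc r = L \<inter> {p. 0 < inner p (\<gamma> r)}"
  proof
    show "?\<phi> ` arc r \<subseteq> L \<inter> {p. 0 < inner p (\<gamma> r)}"
      using cos_gt_zero_pi[of "coord x 0 - r" for x] by (auto simp: inner_\<gamma> arc_def)
    show "L \<inter> {p. 0 < inner p (\<gamma> r)} \<subseteq> ?\<phi> ` arc r"
    proof
      fix p assume "p \<in> L \<inter> {p. 0 < inner p (\<gamma> r)}"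
      then obtain t where t: "p = \<gamma> t" "0 < cos (t - r)" by (auto simp: L_def inner_\<gamma>)
      \<comment> \<open>The representative of the angle \<open>t - r\<close> between
        \<open>- pi / 2\<close> and \<open>pi / 2\<close>: it has the same sine, and the same cosine
        because neither cosine is negative.\<close>
      let ?a = "arcsin (sin (t - r))"
      have "\<bar>sin (t - r)\<bar> < 1"
        unfolding abs_square_less_1[symmetric] sin_squared_eq using t(2) by simp
      then have a: "- (pi / 2) < ?a" "?a < pi / 2" using arcsin_lt_bounded[of "sin (t - r)"] by (simp_all add: abs_less_iff)
      have sa: "sin ?a = sin (t - r)" by simp
      have "cos ?a = sqrt (1 - (sin (t - r))\<^sup>2)" by (rule cos_arcsin) auto
      also have "\<dots> = cos (t - r)" using t(2) by (simp add: cos_squared_eq[symmetric])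
      finally have ca: "cos ?a = cos (t - r)" .
      have "\<gamma> (?a + r) = \<gamma> (t - r + r)"
        unfolding \<gamma>_def cos_add sin_add sa ca ..
      then have "p = ?\<phi> ((?a + r) *\<^sub>R ebasis 0)" using t by simp
      moreover have "(?a + r) *\<^sub>R ebasis 0 \<in> arc r" using a by (simp add: arc_def euc_def)
      ultimately show "p \<in> ?\<phi> ` arc r" by blast
    qed
  qed
  have opL: "openin (top_of_set L) (?\<phi> ` arc r)"
  proof -
    have "open {p. 0 < inner p (\<gamma> r)}" by (intro open_Collect_less continuous_intros)
    then show ?thesis unfolding img by auto
  qed
  \<comment> \<open>The component along the quarter turn of \<open>\<gamma> r\<close> is the sine of
    the angle measured from \<open>r\<close>, which \<open>arcsin\<close> inverts.\<close>
  have hom: "homeomorphism (arc r) (?\<phi> ` arc r) ?\<phi> (\<lambda>p. (r + arcsin (inner p (J (\<gamma> r)))) *\<^sub>R ebasis 0)"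
  proof -
    have J: "inner (\<gamma> t) (J (\<gamma> r)) = sin (t - r)" for t
      by (simp add: J_\<gamma> inner_\<gamma> cos_diff cos_add sin_add sin_diff)
    have inv: "(r + arcsin (inner (?\<phi> x) (J (\<gamma> r)))) *\<^sub>R ebasis 0 = x" if x: "x \<in> arc r" for x
    proof -
      have "arcsin (sin (coord x 0 - r)) = coord x 0 - r"
        using x by (intro arcsin_sin) (auto simp: arc_def)
      then have "(r + arcsin (inner (?\<phi> x) (J (\<gamma> r)))) *\<^sub>R ebasis 0 = coord x 0 *\<^sub>R ebasis 0" by (simp add: J)
      also have "\<dots> = x" using x by (intro rseq_eqI) (auto simp: arc_def euc_def)
      finally show ?thesis .
    qed
    have inv': "r + arcsin (inner (?\<phi> x) (J (\<gamma> r))) = coord x 0" if "x \<in> arc r" for x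
      using arg_cong[OF inv[OF that], of "\<lambda>x. coord x 0"] by simp
    show ?thesis
    proof (rule homeomorphismI)
      show "continuous_on (arc r) ?\<phi>" by (intro continuous_intros)
      have "inner p (J (\<gamma> r)) \<in> {-1..1}" if "p \<in> L" for p
        using that by (auto simp: L_def J)
      then show "continuous_on (?\<phi> ` arc r) (\<lambda>p. (r + arcsin (inner p (J (\<gamma> r)))) *\<^sub>R ebasis 0)"
        by (intro continuous_intros ballI) (auto simp: img)
      show "(\<lambda>p. (r + arcsin (inner p (J (\<gamma> r)))) *\<^sub>R ebasis 0) ` (?\<phi> ` arc r) \<subseteq> arc r"
        using inv by auto
    qed (use inv inv' in auto)
  qed
  have "partial 0 ?\<phi> x = \<gamma> (coord x 0 + pi / 2)" for x
    using part[of x 0] by (intro partial_eqI) auto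
  moreover have "\<gamma> t \<noteq> 0" for t using norm_\<gamma>[of t] by (metis norm_zero zero_neq_one)
  ultimately have "inj_on (\<lambda>i. partial i ?\<phi> x) {..<1} \<and> independent ((\<lambda>i. partial i ?\<phi> x) ` {..<1})" for x
    by (simp add: lessThan_Suc dependent_single)
  then show ?thesis unfolding local_param_def using C opL hom by blast
qed

lemma submanifold_L: "submanifold \<infinity> 1 3 L"
  unfolding submanifold_def
proof (intro conjI ballI)
  show "L \<subseteq> euc 3" using P_euc L_iff by blast
  fix p assume "p \<in> L"
  then obtain t where "p = \<gamma> t" by (rule LE)
  moreover have "t *\<^sub>R ebasis 0 \<in> arc t" by (simp add: arc_def euc_def)
  ultimately show "\<exists>U \<phi>. local_param \<infinity> 1 L U \<phi> \<and> p \<in> \<phi> ` U"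
    using circle_local_param[of t] by (intro exI conjI) (auto intro!: image_eqI[of _ _ "t *\<^sub>R ebasis 0"])
qed

lemma closed_submanifold_L: "closed_submanifold 2 1 L"
proof -
  have "L \<subseteq> usphere 2"
    using P_euc L_iff by (auto simp: usphere_def)
  moreover have "L \<noteq> {}" by (simp add: L_def)
  ultimately show ?thesis
    using compact_L submanifold_L by (simp add: closed_submanifold_def numeral_3_eq_3 numeral_2_eq_2)
qed

section \<open>Tangent line, minimality and orientation of the circle\<close>

lemma local_param_image: "local_param r k M U \<phi> \<Longrightarrow> \<phi> ` U \<subseteq> M"
  unfolding local_param_def by (elim conjE) (rule openin_imp_subset)

lemma local_param_partial_P:
  assumes \<phi>: "local_param r k M U \<phi>" and r: "1 \<le> r" and M: "M \<subseteq> P" and x: "x \<in> U" and i: "i < k"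
  shows "partial i \<phi> x \<in> P"
proof (rule vector_derivative_in_closed_subspace[OF _ closed_P subspace_P])
  have C: "C_on r k U \<phi>" using \<phi> by (simp add: local_param_def)
  have im: "\<phi> ` U \<subseteq> M" by (rule local_param_image[OF \<phi>])
  show "((\<lambda>t. \<phi> (x + t *\<^sub>R ebasis i)) has_vector_derivative partial i \<phi> x) (at 0)"
    by (rule partial_has_vector_derivative[OF C r x i])
  show "\<phi> (x + 0 *\<^sub>R ebasis i) \<in> P" using im M x by auto
  show "\<forall>\<^sub>F t in at 0. \<phi> (x + t *\<^sub>R ebasis i) \<in> P"
    using eventually_in_chart[OF C_on_openin[OF C] x i] by eventually_elim (use im M in auto)
qed

lemma L_sub_P: "L \<subseteq> P" using L_iff by blast

text \<open>\<open>\<gamma> t\<close> and \<open>J (\<gamma> t)\<close> form an orthonormal basis of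
  the plane.\<close>

lemma perp_in_P:
  assumes "w \<in> P" "inner w (\<gamma> t) = 0"
  shows "w = inner w (J (\<gamma> t)) *\<^sub>R J (\<gamma> t)"
proof -
  obtain a b where w: "w = \<Phi> (a, b)" using assms(1) by (auto simp: P_def)
  define l where "l = b * cos t - a * sin t"
  have 0: "a * cos t + b * sin t = 0" using assms(2) by (simp add: w \<gamma>_def inner_\<Phi>_\<Phi> inner_prod_def)
  have "a = (a * cos t + b * sin t) * cos t - l * sin t" "b = (a * cos t + b * sin t) * sin t + l * cos t"
    using sin_cos_squared_add3[of t] unfolding l_def by algebra+
  then have "a = - (l * sin t)" "b = l * cos t" unfolding 0 by auto
  then have "\<Phi> (a, b) = l *\<^sub>R \<Phi> (- sin t, cos t)"
    by (simp add: \<Phi>_def scaleR_diff_right)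
  moreover have "J (\<gamma> t) = \<Phi> (- sin t, cos t)" unfolding J_\<gamma> by (simp add: \<gamma>_def cos_add sin_add)
  moreover have "inner w (\<Phi> (- sin t, cos t)) = l" by (simp add: w inner_\<Phi>_\<Phi> inner_prod_def l_def)
  ultimately show ?thesis using w by simp
qed

text \<open>Differentiating the constant inner product of the chart with itself makes the derivative
  orthogonal to the position; inside the plane only the direction \<open>J (\<gamma> t)\<close>
  remains.\<close>

lemma local_param_partial_L:
  assumes \<phi>: "local_param r 1 L U \<phi>" and r: "1 \<le> r" and x: "x \<in> U" and t: "\<phi> x = \<gamma> t"
  shows "\<exists>a. partial 0 \<phi> x = a *\<^sub>R J (\<gamma> t)"
proof -
  let ?D = "partial 0 \<phi> x"
  have C: "C_on r 1 U \<phi>" using \<phi> by (simp add: local_param_def)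
  have im: "\<phi> ` U \<subseteq> L" by (rule local_param_image[OF \<phi>])
  let ?f = "\<lambda>t. \<phi> (x + t *\<^sub>R ebasis 0)"
  have D: "(?f has_vector_derivative ?D) (at 0)"
    by (rule partial_has_vector_derivative[OF C r x]) simp
  have "((\<lambda>t. inner (?f t) (?f t)) has_vector_derivative inner (\<phi> x) ?D + inner ?D (\<phi> x)) (at 0)"
    using bounded_bilinear.has_vector_derivative[OF bounded_bilinear_inner D D] by simp
  moreover have "((\<lambda>t. inner (?f t) (?f t)) has_vector_derivative 0) (at 0)"
  proof -
    have 1: "inner y y = 1" if "y \<in> L" for y using that by (auto simp: L_def inner_\<gamma>)
    obtain d where d: "d > 0" "\<And>t. t \<noteq> 0 \<Longrightarrow> dist t 0 < d \<Longrightarrow> x + t *\<^sub>R ebasis 0 \<in> U"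
      using eventually_in_chart[OF C_on_openin[OF C] x, of 0] by (auto simp: eventually_at)
    have 2: "inner (?f t) (?f t) = 1" if "dist t 0 < d" for t
      using d(2)[OF _ that] im x by (cases "t = 0") (auto intro!: 1)
    show ?thesis
      by (rule has_vector_derivative_transform_within[OF has_vector_derivative_const[of 1], of d])
         (use d(1) 2 in auto)
  qed
  ultimately have "inner (\<phi> x) ?D + inner ?D (\<phi> x) = 0"
    by (rule vector_derivative_unique_at)
  then have "inner ?D (\<gamma> t) = 0" by (simp add: inner_commute t)
  moreover have "?D \<in> P" by (rule local_param_partial_P[OF \<phi> r L_sub_P x]) simp
  ultimately show ?thesis using perp_in_P by blast
qed

lemma tangent_space_L: "tangent_space 1 L (\<gamma> t) = span {J (\<gamma> t)}"
proof -
  have sub: "span ((\<lambda>i. partial i \<phi> x) ` {..<1}) = span {J (\<gamma> t)}"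
    if \<phi>: "local_param 1 1 L U \<phi>" "x \<in> U" "\<phi> x = \<gamma> t" for U \<phi> x
  proof -
    obtain a where a: "partial 0 \<phi> x = a *\<^sub>R J (\<gamma> t)" using local_param_partial_L[OF \<phi>(1)] \<phi> by auto
    have "independent {partial 0 \<phi> x}" using \<phi> by (auto simp: local_param_def lessThan_Suc)
    then have "a \<noteq> 0" using a by auto
    have "J (\<gamma> t) = inverse a *\<^sub>R (a *\<^sub>R J (\<gamma> t))" using \<open>a \<noteq> 0\<close> by simp
    then have "J (\<gamma> t) \<in> span {a *\<^sub>R J (\<gamma> t)}" by (metis insertI1 span_base span_scale)
    moreover have "a *\<^sub>R J (\<gamma> t) \<in> span {J (\<gamma> t)}" by (simp add: span_base span_scale)
    ultimately have "span {a *\<^sub>R J (\<gamma> t)} = span {J (\<gamma> t)}" by (simp add: span_eq)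
    then show ?thesis by (simp add: a lessThan_Suc)
  qed
  have "local_param 1 1 L (arc t) (\<lambda>x. \<gamma> (coord x 0))"
    by (rule local_param_mono[OF circle_local_param]) simp
  moreover have "t *\<^sub>R ebasis 0 \<in> arc t" by (simp add: arc_def euc_def)
  moreover have "\<gamma> (coord (t *\<^sub>R ebasis 0) 0) = \<gamma> t" by simp
  ultimately show ?thesis unfolding tangent_space_def using sub by blast
qed

text \<open>The circle is totally geodesic: second derivatives of a chart lie in the plane spanned
  by position and tangent, while the normal space in the sphere is orthogonal to both, so the
  projection is 0.\<close>

lemma minimal_L: "minimal 2 1 L"
  unfolding minimal_def
proof (intro ballI allI impI)
  fix p H assume p: "p \<in> L" and H: "mean_curvature 2 1 L p H"
  obtain t where t: "p = \<gamma> t" using p by (rule LE)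
  obtain U and \<phi> :: "rseq \<Rightarrow> rseq" and x and A :: "nat \<Rightarrow> nat \<Rightarrow> real"
    where \<phi>: "local_param \<infinity> 1 L U \<phi>" "x \<in> U" "\<phi> x = p"
    and H: "H = (\<Sum>l<(1::nat). second_ff 2 1 L \<phi> x (A l) (A l))"
    using H unfolding mean_curvature_def by (elim exE conjE) (rule that)
  have C: "C_on \<infinity> 1 U \<phi>" using \<phi> by (simp add: local_param_def)
  have P1: "partial 0 \<phi> y \<in> P" if "y \<in> U" for y
    by (rule local_param_partial_P[OF \<phi>(1) _ L_sub_P that]) auto
  have P2: "partial 0 (partial 0 \<phi>) x \<in> P"
  proof (rule vector_derivative_in_closed_subspace[OF _ closed_P subspace_P])
    show "((\<lambda>t. partial 0 \<phi> (x + t *\<^sub>R ebasis 0)) has_vector_derivative partial 0 (partial 0 \<phi>) x) (at 0)"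
      by (rule partial2_has_vector_derivative[OF C \<phi>(2)]) auto
    show "\<forall>\<^sub>F t in at 0. partial 0 \<phi> (x + t *\<^sub>R ebasis 0) \<in> P"
      using eventually_in_chart[OF C_on_openin[OF C] \<phi>(2), of 0] by (auto elim!: eventually_mono intro: P1)
  qed (use P1 \<phi> in auto)
  have "inner (\<Sum>i<1. \<Sum>j<1. (A 0 i * A 0 j) *\<^sub>R partial i (partial j \<phi>) x) w = 0"
    if w: "w \<in> normal_space 2 1 L (\<phi> x)" for w
  proof -
    define D where "D = partial 0 (partial 0 \<phi>) x"
    have w0: "inner w (\<gamma> t) = 0" "inner w (J (\<gamma> t)) = 0"
      using w[unfolded normal_space_def \<phi>(3) t tangent_space_L] span_base[of "J (\<gamma> t)" "{J (\<gamma> t)}"] by simp_all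
    let ?a = "inner D (\<gamma> t)"
    have "D - ?a *\<^sub>R \<gamma> t \<in> P" using P2 \<gamma>_P subspace_P unfolding D_def by (intro subspace_diff subspace_scale)
    moreover have "inner (D - ?a *\<^sub>R \<gamma> t) (\<gamma> t) = 0" by (simp add: inner_diff_left inner_\<gamma>)
    ultimately obtain b where "D - ?a *\<^sub>R \<gamma> t = b *\<^sub>R J (\<gamma> t)" using perp_in_P by blast
    then have "D = ?a *\<^sub>R \<gamma> t + b *\<^sub>R J (\<gamma> t)" by (simp add: algebra_simps)
    then have "inner D w = 0" using w0 by (metis add.right_neutral inner_add_right inner_commute inner_scaleR_right mult_zero_right)
    then show ?thesis by (simp add: D_def)
  qed
  moreover have "0 \<in> normal_space 2 1 L (\<phi> x)" by (auto simp: normal_space_def euc_def)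
  ultimately show "H = 0" unfolding H second_ff_def by (simp add: orth_proj_eq_0)
qed

lemma orientation_L: "orientation 1 L \<tau>"
  unfolding orientation_def
proof (intro conjI ballI allI impI)
  have "continuous_on L (\<lambda>p. wedge 1 (\<lambda>_. J p))"
  proof (rule continuous_on_coordinatewise_then_product)
    show "continuous_on L (\<lambda>p. wedge 1 (\<lambda>_. J p) I)" for I
      by (cases "length I = 1") (auto simp: J_def wedge_1[unfolded One_nat_def] intro!: continuous_intros)
  qed
  then show "continuous_on L \<tau>" by (rule continuous_on_cong[THEN iffD1, rotated -1]) (auto simp: \<tau>_def)
  fix p assume p: "p \<in> L"
  then obtain t where t: "p = \<gamma> t" by (rule LE)
  have "orthonormal 1 (\<lambda>_. J p)" by (simp add: orthonormal_def t J_\<gamma> inner_\<gamma>)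
  then show "orients 1 (tangent_space 1 L p) (\<tau> p)"
    unfolding orients_def using p by (intro exI[of _ "\<lambda>_. J p"]) (auto simp: t tangent_space_L[unfolded One_nat_def] \<tau>_def lessThan_Suc)
qed (simp add: \<tau>_def)

lemma minimal_submanifolds_L: "(2, L, \<tau>) \<in> minimal_submanifolds"
  unfolding minimal_submanifolds_def mem_Collect_eq prod.case
  by (intro conjI exI[of _ 1] closed_submanifold_L orientation_L minimal_L) simp_all


section \<open>The cone over a great circle\<close>

lemma plane_local_param: "local_param \<infinity> 2 P (euc 2) (\<lambda>x. \<Phi> (coord x 0, coord x 1))"
proof -
  let ?\<phi> = "\<lambda>x. \<Phi> (coord x 0, coord x 1)"
  have d: "((\<lambda>t. ?\<phi> (x + t *\<^sub>R ebasis i)) has_vector_derivative uv i) (at 0)" if "i < 2" for x i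
  proof -
    have "?\<phi> (x + t *\<^sub>R ebasis i) = ?\<phi> x + t *\<^sub>R uv i" for t
      using that by (auto simp: less_2_cases_iff \<Phi>_def uv_def algebra_simps)
    then show ?thesis by (auto intro!: derivative_eq_intros)
  qed
  have p: "partial i ?\<phi> = (\<lambda>_. uv i)" if "i < 2" for i
    using partial_eqI[OF d[OF that]] by auto
  have pc: "partial i (\<lambda>_. w) = (\<lambda>_. 0)" for i and w :: rseq
    by (intro ext partial_eqI) (auto intro!: derivative_eq_intros)
  have C: "C_on \<infinity> 2 (euc 2) ?\<phi>"
  proof (rule C_on_class)
    let ?F = "insert ?\<phi> (range (\<lambda>w _. w))"
    show "?\<phi> \<in> ?F" by simp
    show "continuous_on (euc 2) g" if "g \<in> ?F" for g
      using that by (auto intro!: continuous_intros)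
    show "(\<lambda>t. g (x + t *\<^sub>R ebasis i)) differentiable at 0" if "g \<in> ?F" "i < 2" for g i and x
      using that(1) differentiableI_vector[OF d[OF that(2)]] by auto
    show "partial i g \<in> ?F" if "g \<in> ?F" "i < 2" for g i
      using that(1) p[OF that(2)] pc by auto
  qed simp
  have img: "?\<phi> ` euc 2 = P"
  proof
    show "P \<subseteq> ?\<phi> ` euc 2"
    proof
      fix p assume "p \<in> P"
      then obtain a b where "p = \<Phi> (a, b)" by (auto simp: P_def)
      then have "p = ?\<phi> (a *\<^sub>R ebasis 0 + b *\<^sub>R ebasis 1)" by simp
      moreover have "a *\<^sub>R ebasis 0 + b *\<^sub>R ebasis 1 \<in> euc 2" by (auto simp: euc_def)
      ultimately show "p \<in> ?\<phi> ` euc 2" by blast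
    qed
  qed (auto simp: P_def)
  have inv: "inner (?\<phi> x) u *\<^sub>R ebasis 0 + inner (?\<phi> x) v *\<^sub>R ebasis 1 = x" if "x \<in> euc 2" for x
    using that by (intro rseq_eqI) (auto simp: inner_\<Phi> euc_def)
  have hom: "homeomorphism (euc 2) P ?\<phi> (\<lambda>p. inner p u *\<^sub>R ebasis 0 + inner p v *\<^sub>R ebasis 1)"
  proof (rule homeomorphismI)
    show "(\<lambda>p. inner p u *\<^sub>R ebasis 0 + inner p v *\<^sub>R ebasis 1) ` P \<subseteq> euc 2"
      by (auto simp: euc_def)
    show "?\<phi> (inner p u *\<^sub>R ebasis 0 + inner p v *\<^sub>R ebasis 1) = p" if "p \<in> P" for p
      using that P_iff by auto
  qed (use img inv in \<open>auto intro!: continuous_intros\<close>)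
  have "u \<noteq> v" using inner_uv by (metis zero_neq_one)
  have "v \<noteq> 0" using inner_uv(4) by (metis inner_zero_left zero_neq_one)
  moreover have "u \<notin> span {v}"
  proof
    assume "u \<in> span {v}"
    then obtain k where "u = k *\<^sub>R v" by (auto simp: span_singleton)
    then have "inner u u = k * inner v u" by (metis inner_scaleR_left)
    then show False by simp
  qed
  ultimately have "independent {u, v}" using \<open>u \<noteq> v\<close> by (simp add: independent_insert dependent_single)
  moreover have "(\<lambda>i. partial i ?\<phi> x) ` {..<2} = {u, v}" for x
  proof -
    have "{..<2::nat} = {0, 1}" by auto
    moreover have "partial 0 ?\<phi> x = u" "partial 1 ?\<phi> x = v" using p by (simp_all add: uv_def)
    ultimately show ?thesis by (simp only: image_insert image_empty)
  qed
  moreover have "inj_on (\<lambda>i. partial i ?\<phi> x) {..<2}" for x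
  proof -
    have "inj_on (\<lambda>i. partial i ?\<phi> x) {..<2} \<longleftrightarrow> inj_on uv {..<2}"
      by (rule inj_on_cong) (metis p lessThan_iff)
    moreover have "inj_on uv {..<2}" using \<open>u \<noteq> v\<close> by (auto simp: inj_on_def uv_def less_2_cases_iff)
    ultimately show ?thesis by blast
  qed
  ultimately show ?thesis
    unfolding local_param_def using C hom img by auto
qed

lemma submanifold_P: "submanifold 1 2 3 P"
  unfolding submanifold_def
proof (intro conjI ballI P_euc)
  fix p assume p: "p \<in> P"
  then have "p = \<Phi> (coord (inner p u *\<^sub>R ebasis 0 + inner p v *\<^sub>R ebasis 1) 0,
      coord (inner p u *\<^sub>R ebasis 0 + inner p v *\<^sub>R ebasis 1) 1)"
    using P_iff by auto
  then have "p \<in> (\<lambda>x. \<Phi> (coord x 0, coord x 1)) ` euc 2"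
    by (rule image_eqI) (auto simp: euc_def)
  then show "\<exists>U \<phi>. local_param 1 2 P U \<phi> \<and> p \<in> \<phi> ` U"
    using local_param_mono[OF plane_local_param, of 1] by auto
qed

text \<open>Two independent vectors of a plane span it, so every chart yields the same
  space.\<close>

lemma tangent_space_P:
  assumes "p \<in> P"
  shows "tangent_space 2 P p = P"
proof -
  have sub: "span ((\<lambda>i. partial i \<phi> x) ` {..<2}) = P" if \<phi>: "local_param 1 2 P U \<phi>" "x \<in> U" for U \<phi> x
  proof -
    have im: "(\<lambda>i. partial i \<phi> x) ` {..<2} = {partial 0 \<phi> x, partial 1 \<phi> x}"
      by (auto simp: numeral_2_eq_2 lessThan_Suc)
    have "partial i \<phi> x \<in> span {u, v}" if "i < 2" for i
      using local_param_partial_P[OF \<phi>(1) _ _ \<phi>(2) that] P_span by auto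
    moreover have "inj_on (\<lambda>i. partial i \<phi> x) {..<2}" "independent {partial 0 \<phi> x, partial 1 \<phi> x}"
      using \<phi> im unfolding local_param_def by metis+
    then have "partial 0 \<phi> x \<noteq> partial 1 \<phi> x" "independent {partial 0 \<phi> x, partial 1 \<phi> x}"
      using inj_onD[of "\<lambda>i. partial i \<phi> x" "{..<2}" 0 1] by auto
    ultimately show ?thesis unfolding im P_span by (intro independent_pair_span) auto
  qed
  obtain U \<phi> where \<phi>: "local_param 1 2 P U \<phi>" "p \<in> \<phi> ` U"
    using submanifold_P assms unfolding submanifold_def by blast
  then obtain x where "x \<in> U" "\<phi> x = p" by blast
  then show ?thesis unfolding tangent_space_def using \<phi>(1) sub by blast
qed

lemma orients_P: "orients 2 P (wedge 2 uv)"
  unfolding orients_def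
proof (intro exI conjI)
  show "orthonormal 2 uv" by (auto simp: orthonormal_def uv_def less_2_cases_iff)
  have "uv ` {..<2} = {u, v}" by (auto simp: numeral_2_eq_2 lessThan_Suc uv_def)
  then show "span (uv ` {..<2}) = P" by (simp add: P_span)
qed simp

lemma cone_over_L: "cone_over L = P"
proof
  show "cone_over L \<subseteq> P"
    using L_sub_P subspace_P by (auto simp: cone_over_def intro: subspace_scale)
  show "P \<subseteq> cone_over L"
  proof
    fix p assume p: "p \<in> P"
    show "p \<in> cone_over L"
    proof (cases "p = 0")
      case True
      then have "p = 0 *\<^sub>R \<gamma> 0" by simp
      then show ?thesis unfolding cone_over_def using \<gamma>_L by blast
    next
      case False
      then have "p = norm p *\<^sub>R (p /\<^sub>R norm p)" "p /\<^sub>R norm p \<in> L"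
        using p subspace_P by (auto simp: L_iff intro: subspace_scale)
      then show ?thesis unfolding cone_over_def by (metis (mono_tags, lifting) mem_Collect_eq norm_ge_zero)
    qed
  qed
qed

text \<open>Position and velocity arise from \<open>u\<close> and \<open>v\<close> by a rotation,
  which has determinant 1, so their wedge is the same everywhere. At the vertex
  \<open>cone_orient\<close> is 0 instead.\<close>

lemma cone_orient_\<tau>:
  assumes y: "y \<in> P" "y \<noteq> 0"
  shows "cone_orient \<tau> y = wedge 2 uv"
proof
  fix I
  have "y /\<^sub>R norm y \<in> L" using y subspace_P by (auto simp: L_iff intro: subspace_scale)
  then obtain t where t: "y /\<^sub>R norm y = \<gamma> t" by (rule LE)
  have e: "cone_orient \<tau> y I = (if sorted_wrt (<) I then
      \<Sum>j<length I. (- 1) ^ j * coord (\<gamma> t) (I ! j) * wedge 1 (\<lambda>_. J (\<gamma> t)) (drop_nth j I) else 0)"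
    using y by (simp add: cone_orient_def t \<tau>_def)
  show "cone_orient \<tau> y I = wedge 2 uv I"
  proof (cases "length I = 2")
    case True
    then obtain a b where I: "I = [a, b]" by (auto simp: numeral_2_eq_2 length_Suc_conv)
    have g: "coord (\<gamma> t) i = cos t * coord u i + sin t * coord v i" for i
      by (simp add: \<gamma>_def \<Phi>_def)
    have h: "coord (J (\<gamma> t)) i = - sin t * coord u i + cos t * coord v i" for i
      unfolding J_\<gamma> by (simp add: \<gamma>_def \<Phi>_def cos_add sin_add)
    have "coord (\<gamma> t) a * coord (J (\<gamma> t)) b - coord (\<gamma> t) b * coord (J (\<gamma> t)) a
        = coord u a * coord v b - coord u b * coord v a"
      unfolding g h using sin_cos_squared_add3[of t] by algebra
    then show ?thesis
      unfolding e by (simp add: I wedge_2 wedge_1[unfolded One_nat_def] uv_def drop_nth_def lessThan_Suc)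
  next
    case False
    have "wedge 1 (\<lambda>_. J (\<gamma> t)) (drop_nth j I) = 0" if "j < length I" for j
      by (subst wedge_1) (use that False in \<open>auto simp: drop_nth_def\<close>)
    then show ?thesis using False by (simp add: e wedge_2)
  qed
qed

section \<open>Area on the disc\<close>

definition D :: "rseq set" where "D = \<Phi> ` cball 0 1"

lemma D_eq: "D = P \<inter> cball 0 1"
  by (auto simp: D_def P_def norm_\<Phi>)

lemma compact_D: "compact D"
  unfolding D_def by (rule compact_continuous_image[OF continuous_\<Phi>[OF continuous_on_id]]) simp

lemma \<Phi>_measurable [measurable]: "\<Phi> \<in> borel_measurable borel"
  by (rule borel_measurable_continuous_onI) (rule continuous_\<Phi>[OF continuous_on_id])

lemma hausdorff_outer_\<Phi>: "S \<in> sets borel \<Longrightarrow> hausdorff_outer 2 (\<Phi> ` S) = emeasure lborel S"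
proof -
  assume S: "S \<in> sets borel"
  have "dist x y \<le> C * dist (\<Phi> x) (\<Phi> y)" if "1 < C" for C and x y :: "real \<times> real"
    using mult_right_mono[of 1 C "dist x y"] that by (simp add: dist_\<Phi>)
  then have "\<exists>\<delta>>0. \<forall>x\<in>UNIV. \<forall>y\<in>UNIV. dist (\<Phi> x) (\<Phi> y) \<le> \<delta> \<longrightarrow> dist x y \<le> C * dist (\<Phi> x) (\<Phi> y)"
    if "1 < C" for C
    using that by (intro exI[of _ 1]) auto
  then show ?thesis
    using hausdorff_outer_local_isometry[where \<Phi>=\<Phi> and T=UNIV and S=S, OF isodiametric_plane] S
    by (simp add: dist_\<Phi> numeral_2_eq_2)
qed

lemma hausdorff_outer_D:
  assumes "B \<in> sets borel"
  shows "hausdorff_outer 2 (D \<inter> B) = emeasure lborel (cball 0 1 \<inter> \<Phi> -` B)"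
proof -
  have "D \<inter> B = \<Phi> ` (cball 0 1 \<inter> \<Phi> -` B)" by (auto simp: D_def)
  then show ?thesis using assms measurable_sets[OF \<Phi>_measurable assms] by (simp add: hausdorff_outer_\<Phi>)
qed

lemma disc_integral:
  fixes f :: "rseq \<Rightarrow> real"
  assumes f: "set_borel_measurable borel D f"
  shows "set_lebesgue_integral (hausdorff 2) D f = set_lebesgue_integral lborel (cball 0 1) (\<lambda>x. f (\<Phi> x))"
    and "set_integrable (hausdorff 2) D f \<longleftrightarrow> set_integrable lborel (cball 0 1) (\<lambda>x. f (\<Phi> x))"
proof -
  have D: "D \<in> sets borel" using compact_D by (simp add: borel_compact)
  have "continuous_on UNIV \<Phi>" by (rule continuous_\<Phi>[OF continuous_on_id])
  note * = hausdorff_integral_param[OF D _ this _ hausdorff_outer_D f]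
  show "set_lebesgue_integral (hausdorff 2) D f = set_lebesgue_integral lborel (cball 0 1) (\<lambda>x. f (\<Phi> x))"
    by (rule *(1)) (auto simp: D_def)
  show "set_integrable (hausdorff 2) D f \<longleftrightarrow> set_integrable lborel (cball 0 1) (\<lambda>x. f (\<Phi> x))"
    by (rule *(2)) (auto simp: D_def)
qed

section \<open>Length on the circle\<close>

lemma dist_\<gamma>: "dist (\<gamma> a) (\<gamma> b) = 2 * \<bar>sin ((a - b) / 2)\<bar>"
proof -
  have "(dist (\<gamma> a) (\<gamma> b))\<^sup>2 = 2 - 2 * cos (a - b)"
    by (simp add: dist_norm power2_norm_eq_inner inner_diff_left inner_diff_right inner_\<gamma> cos_diff mult.commute)
  also have "cos (a - b) = 1 - 2 * (sin ((a - b) / 2))\<^sup>2"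
  proof -
    define h where "h = (a - b) / 2"
    have "a - b = 2 * h" by (simp add: h_def)
    then show ?thesis unfolding h_def[symmetric] by (simp only: cos_double_sin)
  qed
  finally have "(dist (\<gamma> a) (\<gamma> b))\<^sup>2 = (2 * \<bar>sin ((a - b) / 2)\<bar>)\<^sup>2" by (simp add: power_mult_distrib)
  then show ?thesis by (rule power2_eq_imp_eq) auto
qed

lemma dist_\<gamma>_le: "dist (\<gamma> a) (\<gamma> b) \<le> dist a b"
proof -
  have "2 * \<bar>sin ((a - b) / 2)\<bar> \<le> 2 * \<bar>(a - b) / 2\<bar>"
    by (intro mult_left_mono abs_sin_x_le_abs_x) simp
  also have "\<dots> = \<bar>a - b\<bar>" by (simp add: abs_divide)
  finally show ?thesis by (simp only: dist_\<gamma> dist_real_def)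
qed

text \<open>The ratio of chord to arc tends to 1. The bound on \<open>\<bar>a - b\<bar>\<close>
  excludes angles that are far apart but close on the circle.\<close>

lemma dist_\<gamma>_ge:
  assumes c: "1 < C"
  shows "\<exists>\<delta>>0. \<forall>a b. \<bar>a - b\<bar> \<le> pi \<longrightarrow> dist (\<gamma> a) (\<gamma> b) \<le> \<delta> \<longrightarrow> dist a b \<le> C * dist (\<gamma> a) (\<gamma> b)"
proof -
  have "((\<lambda>h. (sin (0 + h) - sin 0) / h) \<longlongrightarrow> cos 0) (at (0::real))"
    using DERIV_sin[of "0::real"] unfolding DERIV_def .
  then have "eventually (\<lambda>h. 1 / C < sin h / h) (at (0::real))"
    using c by (intro order_tendstoD(1)) auto
  then obtain d where d: "d > 0" "\<And>h. h \<noteq> 0 \<Longrightarrow> \<bar>h\<bar> < d \<Longrightarrow> 1 / C < sin h / h"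
    by (auto simp: eventually_at)
  \<comment> \<open>The witness for \<delta> is \<open>sin \<eta>\<close>: a chord
    \<open>2 * sin z\<close> of at most this length forces the half angle \<open>z\<close> below
    \<open>\<eta>\<close>, since the sine increases up to \<open>pi / 2\<close>.\<close>
  define \<eta> where "\<eta> = min d (pi / 2)"
  have \<eta>: "0 < \<eta>" "\<eta> \<le> pi / 2" "\<eta> \<le> d" using d by (auto simp: \<eta>_def)
  have sp: "0 < sin \<eta>" using \<eta> pi_gt_zero by (intro sin_gt_zero) linarith+
  show ?thesis
  proof (intro exI conjI allI impI)
    fix a b :: real
    assume ab: "\<bar>a - b\<bar> \<le> pi" and le: "dist (\<gamma> a) (\<gamma> b) \<le> sin \<eta>"
    define z where "z = \<bar>a - b\<bar> / 2"
    have z: "0 \<le> z" "z \<le> pi / 2" using ab by (auto simp: z_def)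
    have sz: "0 \<le> sin z" using z pi_gt_zero by (intro sin_ge_zero) linarith+
    have "(a - b) / 2 = z \<or> (a - b) / 2 = - z" unfolding z_def by linarith
    then have "\<bar>sin ((a - b) / 2)\<bar> = \<bar>sin z\<bar>" by auto
    then have ds: "dist (\<gamma> a) (\<gamma> b) = 2 * sin z" using sz by (simp add: dist_\<gamma>)
    have "z < \<eta>"
    proof (rule ccontr)
      assume "\<not> z < \<eta>"
      then have "sin \<eta> \<le> sin z" using z \<eta> by (intro sin_monotone_2pi_le) auto
      then show False using le ds sp by linarith
    qed
    then have "z \<le> C * sin z"
      using d(2)[of z] z \<eta> c by (cases "z = 0") (auto simp: field_simps)
    then show "dist a b \<le> C * dist (\<gamma> a) (\<gamma> b)" by (simp add: ds) (simp add: z_def dist_real_def)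
  qed (use sp in auto)
qed

lemma hausdorff_outer_\<gamma>:
  assumes "S \<in> sets borel" "\<And>a b. a \<in> S \<Longrightarrow> b \<in> S \<Longrightarrow> \<bar>a - b\<bar> \<le> pi"
  shows "hausdorff_outer 1 (\<gamma> ` S) = emeasure lborel S"
proof -
  have "\<exists>\<delta>>0. \<forall>x\<in>S. \<forall>y\<in>S. dist (\<gamma> x) (\<gamma> y) \<le> \<delta> \<longrightarrow> dist x y \<le> C * dist (\<gamma> x) (\<gamma> y)" if "1 < C" for C
    using dist_\<gamma>_ge[OF that] assms(2) by meson
  then show ?thesis
    using hausdorff_outer_local_isometry[where \<Phi>=\<gamma> and T=S and S=S, OF isodiametric_real dist_\<gamma>_le] assms(1)
    by simp
qed

lemma \<gamma>_measurable [measurable]: "\<gamma> \<in> borel_measurable borel"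
  by (rule borel_measurable_continuous_onI) (rule continuous_\<gamma>[OF continuous_on_id])

text \<open>The circle is cut into two arcs of length \<open>pi\<close>, on which \<open>\<gamma>\<close> is injective with a quantitative bound.\<close>

lemma hausdorff_outer_L:
  assumes B: "B \<in> sets borel"
  shows "hausdorff_outer 1 (L \<inter> B) = emeasure lborel ({0..<2 * pi} \<inter> \<gamma> -` B)"
proof -
  have gB: "\<gamma> -` B \<in> sets borel" using measurable_sets[OF \<gamma>_measurable B] by simp
  let ?S1 = "{0..pi} \<inter> \<gamma> -` B" and ?S2 = "{pi<..<2 * pi} \<inter> \<gamma> -` B"
  \<comment> \<open>This half-space cuts the circle into the two arcs, both common end points going
    to \<open>?S1\<close>. Being closed it is measurable and splits the outer measure of any
    set.\<close>
  define F where "F = {p. 0 \<le> inner p v}"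
  have F: "closed F" unfolding F_def by (intro closed_Collect_le continuous_intros)
  have gv: "inner (\<gamma> t) v = sin t" for t by (simp add: \<gamma>_def inner_\<Phi>)
  have s1: "0 \<le> sin t" if "t \<in> {0..pi}" for t using that by (intro sin_ge_zero) auto
  have s2: "sin t < 0" if "t \<in> {pi<..<2 * pi}" for t using that by (intro sin_lt_zero) auto
  have Lt: "\<exists>t\<in>{0..<2 * pi}. p = \<gamma> t" if p: "p \<in> L" for p
  proof -
    obtain t where t: "t \<in> {0..2 * pi}" "p = \<gamma> t" using p unfolding L_eq by blast
    show ?thesis
    proof (cases "t = 2 * pi")
      case True
      then have "p = \<gamma> 0" using t \<gamma>_periodic[of 0] by simp
      then show ?thesis by (intro bexI[of _ 0]) auto
    qed (use t in auto)
  qed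
  have "x < 2 * pi" if "x \<le> pi" for x using that pi_gt_zero by linarith
  then have split: "{0..<2 * pi} = {0..pi} \<union> {pi<..<2 * pi}" by auto
  have 1: "F \<inter> (L \<inter> B) = \<gamma> ` ?S1"
  proof
    show "F \<inter> (L \<inter> B) \<subseteq> \<gamma> ` ?S1"
    proof
      fix p assume p: "p \<in> F \<inter> (L \<inter> B)"
      then obtain t where t: "t \<in> {0..<2 * pi}" "p = \<gamma> t" using Lt by blast
      then have "t \<in> {0..pi}" using p s2[of t] split by (auto simp: F_def gv)
      then show "p \<in> \<gamma> ` ?S1" using p t by auto
    qed
  qed (use s1 in \<open>auto simp: F_def gv\<close>)
  have 2: "(UNIV - F) \<inter> (L \<inter> B) = \<gamma> ` ?S2"
  proof
    show "(UNIV - F) \<inter> (L \<inter> B) \<subseteq> \<gamma> ` ?S2"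
    proof
      fix p assume p: "p \<in> (UNIV - F) \<inter> (L \<inter> B)"
      then obtain t where t: "t \<in> {0..<2 * pi}" "p = \<gamma> t" using Lt by blast
      then have "t \<in> {pi<..<2 * pi}" using p s1[of t] split by (auto simp: F_def gv)
      then show "p \<in> \<gamma> ` ?S2" using p t by auto
    qed
    show "\<gamma> ` ?S2 \<subseteq> (UNIV - F) \<inter> (L \<inter> B)"
    proof
      fix p assume "p \<in> \<gamma> ` ?S2"
      then obtain t where "t \<in> {pi<..<2 * pi}" "\<gamma> t \<in> B" "p = \<gamma> t" by blast
      then show "p \<in> (UNIV - F) \<inter> (L \<inter> B)" using s2[of t] by (simp add: F_def gv)
    qed
  qed
  have "hausdorff_outer 1 (L \<inter> B) = hausdorff_outer 1 (\<gamma> ` ?S1) + hausdorff_outer 1 (\<gamma> ` ?S2)"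
    using closed_hausdorff_measurable[OF F, of 1] unfolding sets_hausdorff lambda_system_def 1[symmetric] 2[symmetric]
    by auto
  also have "\<dots> = emeasure lborel ?S1 + emeasure lborel ?S2"
    by (intro arg_cong2[of _ _ _ _ "(+)"] hausdorff_outer_\<gamma>) (use gB in auto)
  also have "\<dots> = emeasure lborel (?S1 \<union> ?S2)"
    using gB by (intro plus_emeasure) auto
  also have "?S1 \<union> ?S2 = {0..<2 * pi} \<inter> \<gamma> -` B" unfolding split by blast
  finally show ?thesis .
qed

lemma circle_integral:
  fixes f :: "rseq \<Rightarrow> real"
  assumes f: "set_borel_measurable borel L f"
  shows "set_lebesgue_integral (hausdorff 1) L f = set_lebesgue_integral lborel {0..<2 * pi} (\<lambda>x. f (\<gamma> x))"
    and "set_integrable (hausdorff 1) L f \<longleftrightarrow> set_integrable lborel {0..<2 * pi} (\<lambda>x. f (\<gamma> x))"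
proof -
  have L: "L \<in> sets borel" using compact_L by (simp add: borel_compact)
  have "continuous_on UNIV \<gamma>" by (rule continuous_\<gamma>[OF continuous_on_id])
  note * = hausdorff_integral_param[OF L _ this _ hausdorff_outer_L f]
  show "set_lebesgue_integral (hausdorff 1) L f = set_lebesgue_integral lborel {0..<2 * pi} (\<lambda>x. f (\<gamma> x))"
    by (rule *(1)) auto
  show "set_integrable (hausdorff 1) L f \<longleftrightarrow> set_integrable lborel {0..<2 * pi} (\<lambda>x. f (\<gamma> x))"
    by (rule *(2)) auto
qed

section \<open>Rectifiability of the disc and of the circle\<close>

text \<open>The plane itself is the one covering submanifold. The vertex is discarded as a null set,
  because \<open>cone_orient\<close> is 0 there and orients nothing.\<close>

lemma oriented_rectifiable_D: "oriented_rectifiable 2 3 D (cone_orient \<tau>)"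
  unfolding oriented_rectifiable_def
proof (intro conjI allI exI[of _ "\<lambda>_. P"])
  show sD: "D \<in> sets (hausdorff 2)"
    using borel_hausdorff borel_compact[OF compact_D] by blast
  show "D \<subseteq> euc 3" using P_euc by (auto simp: D_eq)
  have s0: "{0} \<in> sets (hausdorff 2)"
    using borel_hausdorff[of 2] by auto
  have c0: "cone_orient \<tau> 0 = (\<lambda>_. 0)" by (simp add: cone_orient_def fun_eq_iff)
  show "set_borel_measurable (hausdorff 2) D (\<lambda>x. cone_orient \<tau> x I)" for I
  proof -
    have "(\<lambda>x. indicator D x *\<^sub>R cone_orient \<tau> x I) = (\<lambda>x. indicator (D - {0}) x *\<^sub>R wedge 2 uv I)"
      using cone_orient_\<tau> by (auto simp: fun_eq_iff indicator_def D_eq c0)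
    then show ?thesis unfolding set_borel_measurable_def using sD s0 by simp
  qed
  have "emeasure (hausdorff 2) {0} = 0"
    using hausdorff_outer_\<Phi>[of "{0}"] emeasure_hausdorff[OF s0] linear_0[OF linear_\<Phi>] by simp
  then have "AE x in hausdorff 2. x \<noteq> 0"
    using s0 by (intro AE_I'[of "{0}"]) (auto simp: null_sets_def)
  then show "AE x in hausdorff 2. x \<in> D \<inter> P \<longrightarrow> orients 2 (tangent_space 2 P x) (cone_orient \<tau> x)"
    by eventually_elim (auto simp: tangent_space_P cone_orient_\<tau> orients_P)
  show "submanifold 1 2 3 P" by (rule submanifold_P)
  show "AE x in hausdorff 2. x \<in> D \<longrightarrow> x \<in> (\<Union>j::nat. P)" by (rule AE_I2) (simp add: D_eq)
qed


lemma oriented_rectifiable_L: "oriented_rectifiable 1 3 L \<tau>"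
  unfolding oriented_rectifiable_def
proof (intro conjI allI exI[of _ "\<lambda>_. L"])
  have bL: "L \<in> sets borel" by (rule borel_compact[OF compact_L])
  show sL: "L \<in> sets (hausdorff 1)" using borel_hausdorff bL by blast
  show "L \<subseteq> euc 3" using P_euc L_sub_P by auto
  show "set_borel_measurable (hausdorff 1) L (\<lambda>x. \<tau> x I)" for I
  proof -
    have "continuous_on L (\<lambda>x. \<tau> x I)"
      using orientation_L continuous_on_product_then_coordinatewise[of L \<tau> I] by (simp add: orientation_def)
    then have "set_borel_measurable borel L (\<lambda>x. \<tau> x I)"
      unfolding set_borel_measurable_def using bL by (intro borel_measurable_continuous_on_indicator)
    then show ?thesis
      using borel_hausdorff[of 1] unfolding set_borel_measurable_def measurable_def by auto
  qed
  show "submanifold 1 1 3 L" by (rule submanifold_mono[OF submanifold_L]) simp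
  show "AE x in hausdorff 1. x \<in> L \<inter> L \<longrightarrow> orients 1 (tangent_space 1 L x) (\<tau> x)"
    using orientation_L by (intro AE_I2) (simp add: orientation_def)
  show "AE x in hausdorff 1. x \<in> L \<longrightarrow> x \<in> (\<Union>j::nat. L)" by (rule AE_I2) simp
qed

lemma rectifiable_current_D: "rectifiable_current 2 3 (current_of 2 3 D (\<lambda>_. 1) (cone_orient \<tau>))"
  unfolding rectifiable_current_def
proof (intro exI conjI)
  have "set_borel_measurable borel D (\<lambda>_. 1 :: real)"
    using borel_compact[OF compact_D] by (simp add: set_borel_measurable_def)
  moreover have "set_integrable lborel (cball 0 1 :: (real \<times> real) set) (\<lambda>_. 1 :: real)"
    by (intro borel_integrable_compact[unfolded set_integrable_def[symmetric]] continuous_intros) auto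
  ultimately show "set_integrable (hausdorff 2) D (\<lambda>x. real 1)"
    unfolding of_nat_1 using disc_integral(2) by blast
  show "oriented_rectifiable 2 3 D (cone_orient \<tau>)" by (rule oriented_rectifiable_D)
  show "bounded D" using compact_D by (rule compact_imp_bounded)
qed (auto simp: eq_current_def)

lemma rectifiable_current_L: "rectifiable_current 1 3 (current_of 1 3 L (\<lambda>_. 1) \<tau>)"
  unfolding rectifiable_current_def
proof (intro exI conjI)
  have "set_borel_measurable borel L (\<lambda>_. 1 :: real)"
    using borel_compact[OF compact_L] by (simp add: set_borel_measurable_def)
  moreover have "set_integrable lborel {0..<2 * pi} (\<lambda>_. 1 :: real)"
    by (simp add: set_integrable_def)
  ultimately show "set_integrable (hausdorff 1) L (\<lambda>x. real 1)"
    unfolding of_nat_1 using circle_integral(2) by blast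
  show "oriented_rectifiable 1 3 L \<tau>" by (rule oriented_rectifiable_L)
  show "bounded L" using compact_L by (rule compact_imp_bounded)
qed (auto simp: eq_current_def)

end

section \<open>Stokes' theorem on the disc\<close>

lemma lborel_set_integral_Icc:
  fixes f :: "real \<Rightarrow> real"
  assumes "continuous_on {a..b} f"
  shows "set_lebesgue_integral lborel {a..b} f = integral {a..b} f"
  by (intro set_borel_integral_eq_integral borel_integrable_atLeastAtMost' assms)

text \<open>Fubini over the horizontal chords and the fundamental theorem on each; the chord at
  height \<open>b\<close> has half-length \<open>sqrt (1 - b^2)\<close>.\<close>

lemma disc_integral_fst:
  fixes B B' :: "real \<times> real \<Rightarrow> real"
  assumes cont: "continuous_on UNIV B'"
    and der: "\<And>a b. ((\<lambda>a. B (a, b)) has_real_derivative B' (a, b)) (at a)"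
  shows "set_lebesgue_integral lborel (cball 0 1) B' =
    set_lebesgue_integral lborel {-1..1} (\<lambda>b. B (sqrt (1 - b\<^sup>2), b) - B (- sqrt (1 - b\<^sup>2), b))"
proof -
  let ?f = "\<lambda>z. indicator (cball 0 1) z *\<^sub>R B' z"
  have "set_integrable lborel (cball 0 1) B'"
    unfolding set_integrable_def by (intro borel_integrable_compact continuous_on_subset[OF cont]) auto
  then have int: "integrable (lborel \<Otimes>\<^sub>M lborel) (case_prod (\<lambda>a b. ?f (a, b)))"
    by (simp add: set_integrable_def lborel_prod case_prod_unfold)
  have inner: "(\<integral>a. ?f (a, b) \<partial>lborel)
      = indicator {-1..1} b *\<^sub>R (B (sqrt (1 - b\<^sup>2), b) - B (- sqrt (1 - b\<^sup>2), b))" for b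
  proof (cases "b \<in> {-1..1}")
    case True
    define w where "w = sqrt (1 - b\<^sup>2)"
    have b2: "b\<^sup>2 \<le> 1" using True by (simp add: abs_square_le_1 abs_le_iff)
    then have w: "0 \<le> w" "w\<^sup>2 = 1 - b\<^sup>2" by (simp_all add: w_def)
    have "(a, b) \<in> cball 0 1 \<longleftrightarrow> a \<in> {-w..w}" for a
    proof -
      have "(a, b) \<in> cball 0 1 \<longleftrightarrow> a\<^sup>2 + b\<^sup>2 \<le> 1" by (simp add: norm_Pair)
      also have "\<dots> \<longleftrightarrow> a\<^sup>2 \<le> w\<^sup>2" using w by auto
      also have "\<dots> \<longleftrightarrow> a \<in> {-w..w}" using w(1) by (auto simp: abs_le_square_iff[symmetric])
      finally show ?thesis .
    qed
    then have "(\<integral>a. ?f (a, b) \<partial>lborel) = set_lebesgue_integral lborel {-w..w} (\<lambda>a. B' (a, b))"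
      unfolding set_lebesgue_integral_def
      by (intro Bochner_Integration.integral_cong refl arg_cong2[of _ _ _ _ scaleR]) (simp add: indicator_def)
    also have "\<dots> = integral {-w..w} (\<lambda>a. B' (a, b))"
      by (intro lborel_set_integral_Icc continuous_on_compose2[OF cont]) (auto intro!: continuous_intros)
    also have "\<dots> = B (w, b) - B (- w, b)"
      using w(1) has_field_derivative_at_within[OF der]
      by (intro integral_unique fundamental_theorem_of_calculus)
         (auto simp flip: has_real_derivative_iff_has_vector_derivative)
    finally show ?thesis using True by (simp add: w_def)
  next
    case False
    then have "(a, b) \<notin> cball 0 1" for a :: real
      using norm_snd_le[of b a] by (auto simp: abs_le_iff)
    then show ?thesis using False by simp
  qed
  have "set_lebesgue_integral lborel (cball 0 1) B' = (\<integral>z. (case z of (a, b) \<Rightarrow> ?f (a, b)) \<partial>(lborel \<Otimes>\<^sub>M lborel))"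
    by (simp add: set_lebesgue_integral_def lborel_prod case_prod_unfold)
  also have "\<dots> = (\<integral>b. \<integral>a. ?f (a, b) \<partial>lborel \<partial>lborel)"
    by (rule lborel_pair.integral_snd[OF int, symmetric])
  finally show ?thesis by (simp only: inner set_lebesgue_integral_def)
qed

lemma disc_integral_swap:
  fixes A' :: "real \<times> real \<Rightarrow> real"
  assumes cont: "continuous_on UNIV A'"
  shows "set_lebesgue_integral lborel (cball 0 1) A' = set_lebesgue_integral lborel (cball 0 1) (\<lambda>(a, b). A' (b, a))"
proof -
  let ?f = "\<lambda>z. indicator (cball 0 1) z *\<^sub>R A' z"
  have "?f \<in> borel_measurable borel"
    using cont by (intro borel_measurable_continuous_on_indicator continuous_on_subset[OF cont]) auto
  then have "?f \<in> borel_measurable (lborel \<Otimes>\<^sub>M lborel)" by (simp add: lborel_prod)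
  note lborel_pair.integral_product_swap[OF this]
  moreover have "indicator (cball 0 1) (b, a) = (indicator (cball 0 1) (a, b) :: real)" for a b :: real
    by (simp add: indicator_def norm_Pair add.commute)
  ultimately show ?thesis
    by (simp add: set_lebesgue_integral_def lborel_prod case_prod_unfold)
qed

text \<open>One half of Green's theorem, for the form \<open>B db\<close>. The substitution
  \<open>b = sin t\<close> covers the right half circle, the reflection of \<open>t\<close> to
  \<open>pi - t\<close> the left one, and periodicity joins the pieces to one full turn.\<close>

lemma green_disc_fst:
  fixes B B' :: "real \<times> real \<Rightarrow> real"
  assumes cont: "continuous_on UNIV B'" and contB: "continuous_on UNIV B"
    and der: "\<And>a b. ((\<lambda>a. B (a, b)) has_real_derivative B' (a, b)) (at a)"
  shows "set_lebesgue_integral lborel (cball 0 1) B' = integral {0..2 * pi} (\<lambda>t. B (cos t, sin t) * cos t)"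
proof -
  define h where "h t = B (cos t, sin t) * cos t" for t
  have ch: "continuous_on S h" for S
    unfolding h_def by (intro continuous_intros continuous_on_compose2[OF contB]) auto
  have ih: "h integrable_on {a..b}" for a b using ch by (rule integrable_continuous_real)
  define g where "g b = B (sqrt (1 - b\<^sup>2), b) - B (- sqrt (1 - b\<^sup>2), b)" for b
  have cg: "continuous_on {-1..1} g"
    unfolding g_def by (intro continuous_intros continuous_on_compose2[OF contB]) auto
  have per: "h (t + 2 * pi) = h t" for t by (simp add: h_def)
  have "((\<lambda>x. cos x *\<^sub>R g (sin x)) has_integral integral {sin (- (pi / 2))..sin (pi / 2)} g) {- (pi / 2)..pi / 2}"
    by (rule has_integral_substitution[OF _ _ _ cg]) (auto intro: DERIV_subset[OF DERIV_sin])
  then have 1: "integral {-1..1} g = integral {- (pi / 2)..pi / 2} (\<lambda>x. cos x * g (sin x))"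
    by (simp add: integral_unique)
  also have "\<dots> = integral {- (pi / 2)..pi / 2} (\<lambda>t. h t + h (pi - t))"
  proof (rule integral_cong)
    fix x assume "x \<in> {- (pi / 2)..pi / 2}"
    then have "0 \<le> cos x" by (intro cos_ge_zero) auto
    then have "sqrt (1 - (sin x)\<^sup>2) = cos x" by (simp add: cos_squared_eq[symmetric])
    then show "cos x * g (sin x) = h x + h (pi - x)" by (simp add: g_def h_def algebra_simps)
  qed
  also have "\<dots> = integral {- (pi / 2)..pi / 2} h + integral {- (pi / 2)..pi / 2} (\<lambda>t. h (pi - t))"
    by (intro integral_add ih integrable_continuous_real continuous_on_compose2[OF ch[of UNIV]]) (auto intro!: continuous_intros)
  \<comment> \<open>On an interval symmetric about 0 the sign of \<open>t\<close> may be
    changed.\<close>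
  also have "integral {- (pi / 2)..pi / 2} (\<lambda>t. h (pi - t)) = integral {- (pi / 2)..pi / 2} (\<lambda>t. h (t + pi))"
    using Henstock_Kurzweil_Integration.integral_reflect_real[of "pi / 2" "- (pi / 2)" "\<lambda>t. h (t + pi)"] by simp
  also have "\<dots> = integral {pi / 2..3 * pi / 2} h"
    using integral_shift_real_ivl[of "pi / 2" pi "3 * pi / 2" h] by simp
  also have "integral {- (pi / 2)..pi / 2} h = integral {- (pi / 2)..0} h + integral {0..pi / 2} h"
    by (intro Henstock_Kurzweil_Integration.integral_combine[symmetric] ih) auto
  \<comment> \<open>The quarter before angle 0 is moved by a full period to the end of
    \<open>{0..2 * pi}\<close>.\<close>
  also have "integral {- (pi / 2)..0} h = integral {- (pi / 2)..0} (\<lambda>t. h (t + 2 * pi))"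
    by (simp add: per)
  also have "\<dots> = integral {3 * pi / 2..2 * pi} h"
    using integral_shift_real_ivl[of "3 * pi / 2" "2 * pi" "2 * pi" h] by simp
  also have "integral {3 * pi / 2..2 * pi} h + integral {0..pi / 2} h + integral {pi / 2..3 * pi / 2} h
      = (integral {0..pi / 2} h + integral {pi / 2..3 * pi / 2} h) + integral {3 * pi / 2..2 * pi} h" by simp
  also have "integral {0..pi / 2} h + integral {pi / 2..3 * pi / 2} h = integral {0..3 * pi / 2} h"
    by (intro Henstock_Kurzweil_Integration.integral_combine ih) auto
  also have "integral {0..3 * pi / 2} h + integral {3 * pi / 2..2 * pi} h = integral {0..2 * pi} h"
    by (intro Henstock_Kurzweil_Integration.integral_combine ih) auto
  finally have "integral {-1..1} g = integral {0..2 * pi} h" .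
  moreover have "set_lebesgue_integral lborel (cball 0 1) B' = integral {-1..1} g"
    unfolding disc_integral_fst[OF cont der] g_def[symmetric] by (rule lborel_set_integral_Icc[OF cg])
  ultimately show ?thesis by (simp add: h_def[abs_def])
qed

text \<open>The other half, for \<open>A da\<close>; the right side is minus its line integral,
  since the derivative of \<open>cos t\<close> is \<open>- sin t\<close>. The substitution
  \<open>a = - cos x\<close> is increasing on \<open>{0..pi}\<close> and meets the upper half circle
  at angle \<open>pi - x\<close>, the lower one at \<open>pi + x\<close>.\<close>

lemma green_disc_snd:
  fixes A A' :: "real \<times> real \<Rightarrow> real"
  assumes cont: "continuous_on UNIV A'" and contA: "continuous_on UNIV A"
    and der: "\<And>a b. ((\<lambda>b. A (a, b)) has_real_derivative A' (a, b)) (at b)"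
  shows "set_lebesgue_integral lborel (cball 0 1) A' = integral {0..2 * pi} (\<lambda>t. A (cos t, sin t) * sin t)"
proof -
  define h where "h t = A (cos t, sin t) * sin t" for t
  have ch: "continuous_on S h" for S
    unfolding h_def by (intro continuous_intros continuous_on_compose2[OF contA]) auto
  have ih: "h integrable_on {a..b}" for a b using ch by (rule integrable_continuous_real)
  define g where "g a = A (a, sqrt (1 - a\<^sup>2)) - A (a, - sqrt (1 - a\<^sup>2))" for a
  have cg: "continuous_on {-1..1} g"
    unfolding g_def by (intro continuous_intros continuous_on_compose2[OF contA]) auto
  have "((\<lambda>x. sin x *\<^sub>R g (- cos x)) has_integral integral {- cos 0..- cos pi} g) {0..pi}"
    by (rule has_integral_substitution[OF _ _ _ cg]) (auto intro!: derivative_eq_intros)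
  then have 1: "integral {-1..1} g = integral {0..pi} (\<lambda>x. sin x * g (- cos x))"
    by (simp add: integral_unique)
  also have "\<dots> = integral {0..pi} (\<lambda>t. h (pi - t) + h (t + pi))"
  proof (rule integral_cong)
    fix x :: real assume "x \<in> {0..pi}"
    then have "0 \<le> sin x" by (intro sin_ge_zero) auto
    then have "sqrt (1 - (cos x)\<^sup>2) = sin x" by (simp add: sin_squared_eq[symmetric])
    then show "sin x * g (- cos x) = h (pi - x) + h (x + pi)" by (simp add: g_def h_def algebra_simps)
  qed
  also have "\<dots> = integral {0..pi} (\<lambda>t. h (pi - t)) + integral {0..pi} (\<lambda>t. h (t + pi))"
    by (intro integral_add integrable_continuous_real continuous_on_compose2[OF ch[of UNIV]]) (auto intro!: continuous_intros)
  also have "integral {0..pi} (\<lambda>t. h (pi - t)) = integral {- pi..0} (\<lambda>t. h (t + pi))"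
    using Henstock_Kurzweil_Integration.integral_reflect_real[of pi 0 "\<lambda>t. h (pi - t)"] by (simp add: add.commute)
  also have "\<dots> = integral {0..pi} h"
    using integral_shift_real_ivl[of 0 pi pi h] by simp
  also have "integral {0..pi} (\<lambda>t. h (t + pi)) = integral {pi..2 * pi} h"
    using integral_shift_real_ivl[of pi pi "2 * pi" h] by simp
  also have "integral {0..pi} h + integral {pi..2 * pi} h = integral {0..2 * pi} h"
    by (intro Henstock_Kurzweil_Integration.integral_combine ih) auto
  finally have "integral {-1..1} g = integral {0..2 * pi} h" .
  moreover have "set_lebesgue_integral lborel (cball 0 1) A' = integral {-1..1} g"
  proof -
    have c: "continuous_on UNIV (\<lambda>(a, b). A' (b, a))"
      unfolding case_prod_unfold by (intro continuous_on_compose2[OF cont] continuous_intros) auto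
    have "set_lebesgue_integral lborel (cball 0 1) (\<lambda>(a, b). A' (b, a)) = set_lebesgue_integral lborel {-1..1} g"
      using disc_integral_fst[OF c, where B="\<lambda>(a, b). A (b, a)"] der by (simp add: g_def[abs_def])
    then show ?thesis
      unfolding disc_integral_swap[OF cont] using lborel_set_integral_Icc[OF cg] by simp
  qed
  ultimately show ?thesis by (simp add: h_def[abs_def])
qed

section \<open>The boundary of the truncated cone\<close>

lemma C_on_continuous:
  assumes "C_on \<infinity> k U f"
  shows "continuous_on U f" "i < k \<Longrightarrow> continuous_on U (partial i f)"
  using assms[unfolded C_on_def, THEN conjunct2, THEN conjunct1, THEN spec[of _ "[]"]]
    assms[unfolded C_on_def, THEN conjunct2, THEN conjunct1, THEN spec[of _ "[i]"]] by auto

lemma partial_line: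
  fixes f :: "rseq \<Rightarrow> real"
  assumes C: "C_on \<infinity> n (euc n) f" and x: "x \<in> euc n" and i: "i < n"
  shows "((\<lambda>t. f (x + t *\<^sub>R ebasis i)) has_real_derivative partial i f (x + t *\<^sub>R ebasis i)) (at t)"
proof -
  have "((\<lambda>h. f ((x + t *\<^sub>R ebasis i) + h *\<^sub>R ebasis i)) has_real_derivative partial i f (x + t *\<^sub>R ebasis i)) (at 0)"
    using partial_has_vector_derivative[OF C _ add_ebasis_euc[OF x i] i]
    by (simp add: has_real_derivative_iff_has_vector_derivative)
  then have "((\<lambda>h. (\<lambda>t. f (x + t *\<^sub>R ebasis i)) (h + t)) has_real_derivative partial i f (x + t *\<^sub>R ebasis i)) (at 0)"
    by (simp add: algebra_simps)
  then show ?thesis using DERIV_shift[of "\<lambda>t. f (x + t *\<^sub>R ebasis i)" _ 0 t] by simp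
qed

lemma partial_plane_line:
  fixes f :: "rseq \<Rightarrow> real"
  \<comment> \<open>Smoothness of forms speaks of basis directions only, while the plane contains
    the oblique direction \<open>v\<close>. Continuity of one partial derivative yields a derivative
    in two variables, and with it the chain rule.\<close>
  assumes C: "C_on \<infinity> n (euc n) f" and x: "x \<in> euc n" and i: "i < n" and j: "j < n"
  shows "((\<lambda>t. f (x + (t * a) *\<^sub>R ebasis i + (t * b) *\<^sub>R ebasis j)) has_real_derivative
      a * partial i f x + b * partial j f x) (at 0)"
proof -
  let ?F = "\<lambda>(p, q). f (x + p *\<^sub>R ebasis i + q *\<^sub>R ebasis j)"
  let ?g = "\<lambda>p q. partial j f (x + p *\<^sub>R ebasis i + q *\<^sub>R ebasis j)"
  have "(?F has_derivative (\<lambda>(tp, tq). (\<lambda>h. h * partial i f x) tp + blinfun_apply (blinfun_scaleR_left (?g 0 0)) tq))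
      (at (0, 0) within UNIV \<times> UNIV)"
  proof (rule has_derivative_partialsI[where f="\<lambda>p q. f (x + p *\<^sub>R ebasis i + q *\<^sub>R ebasis j)"
        and fx="\<lambda>h. h * partial i f x" and fy="\<lambda>p q. blinfun_scaleR_left (?g p q)"])
    show "((\<lambda>p. f (x + p *\<^sub>R ebasis i + 0 *\<^sub>R ebasis j)) has_derivative (\<lambda>h. h * partial i f x)) (at 0 within UNIV)"
      using partial_line[OF C x i, of 0] by (simp add: has_field_derivative_def mult_commute_abs)
    show "((\<lambda>q. f (x + p *\<^sub>R ebasis i + q *\<^sub>R ebasis j)) has_derivative blinfun_apply (blinfun_scaleR_left (?g p q))) (at q within UNIV)"
      for p q
      using partial_line[OF C add_ebasis_euc[OF x i] j, of p q]
      by (simp add: has_field_derivative_def mult_commute_abs)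
    have "continuous_on UNIV (\<lambda>z. ?g (fst z) (snd z))"
      using x i j add_ebasis_euc
      by (intro continuous_on_compose2[OF C_on_continuous(2)[OF C j]] continuous_intros) auto
    then have "continuous_on UNIV (\<lambda>z. blinfun_scaleR_left (?g (fst z) (snd z)))"
      by (intro continuous_intros)
    then show "continuous (at (0, 0) within UNIV \<times> UNIV) (\<lambda>(p, q). blinfun_scaleR_left (?g p q))"
      by (simp add: continuous_on_eq_continuous_within case_prod_unfold)
  qed auto
  then have F: "(?F has_derivative (\<lambda>(tp, tq). tp * partial i f x + tq * partial j f x)) (at (0, 0))"
    by simp
  have "((\<lambda>t. (t * a, t * b)) has_derivative (\<lambda>h. (h * a, h * b))) (at 0)"
    by (auto intro!: derivative_eq_intros)
  from has_derivative_compose[OF this] F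
  have "((\<lambda>t. ?F (t * a, t * b)) has_derivative (\<lambda>h. h * a * partial i f x + h * b * partial j f x)) (at 0)"
    by fastforce
  then have "((\<lambda>t. f (x + (t * a) *\<^sub>R ebasis i + (t * b) *\<^sub>R ebasis j)) has_derivative
      (\<lambda>h. h * a * partial i f x + h * b * partial j f x)) (at 0)" by simp
  then show ?thesis
    unfolding has_field_derivative_def
    by (rule has_derivative_eq_rhs) (simp add: fun_eq_iff algebra_simps)
qed

lemma multi_idx_1: "multi_idx 1 3 = {[0], [1], [2]}"
proof -
  have "I \<in> multi_idx 1 3 \<longleftrightarrow> I \<in> {[0], [1], [2]}" for I
    by (cases I) (auto simp: multi_idx_def less_Suc_eq numeral_3_eq_3 numeral_2_eq_2)
  then show ?thesis by blast
qed

lemma multi_idx_2: "multi_idx 2 3 = {[0, 1], [0, 2], [1, 2]}"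
proof -
  have "I \<in> multi_idx 2 3 \<longleftrightarrow> I \<in> {[0, 1], [0, 2], [1, 2]}" for I
  proof
    assume "I \<in> multi_idx 2 3"
    then obtain a b where "I = [a, b]" "a < b" "a < 3" "b < 3"
      by (auto simp: multi_idx_def numeral_2_eq_2 length_Suc_conv)
    then show "I \<in> {[0, 1], [0, 2], [1, 2]}" by (auto simp: less_Suc_eq numeral_3_eq_3 numeral_2_eq_2)
  qed (auto simp: multi_idx_def)
  then show ?thesis by blast
qed

lemma ext_deriv_pair:
  assumes "x \<in> euc n" "a < b" "b < n"
  shows "ext_deriv n \<omega> x [a, b] = partial a (\<lambda>y. \<omega> y [b]) x - partial b (\<lambda>y. \<omega> y [a]) x"
  using assms by (simp add: ext_deriv_def drop_nth_def lessThan_Suc)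

context great_circle
begin

lemma pairing_uv: "pairing 2 3 \<alpha> (wedge 2 uv) = c * \<alpha> [0, 1] + s * \<alpha> [0, 2]"
  unfolding pairing_def multi_idx_2 by (simp add: wedge_2 uv_def u_def v_def)

lemma deriv_along_u:
  assumes C: "C_on \<infinity> 3 (euc 3) f"
  shows "((\<lambda>a. f (\<Phi> (a, b))) has_real_derivative partial 0 f (\<Phi> (a, b))) (at a)"
proof -
  have "b *\<^sub>R v \<in> euc 3" using uv_euc subspace_euc by (simp add: subspace_scale)
  from partial_line[OF C this, of 0 a] show ?thesis by (simp add: \<Phi>_def u_def add.commute)
qed

lemma deriv_along_v:
  assumes C: "C_on \<infinity> 3 (euc 3) f"
  shows "((\<lambda>b. f (\<Phi> (a, b))) has_real_derivative
      c * partial 1 f (\<Phi> (a, b)) + s * partial 2 f (\<Phi> (a, b))) (at b)"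
proof -
  have "\<Phi> (a, b) \<in> euc 3" using P_euc by (auto simp: P_def)
  from partial_plane_line[OF C this, of 1 2 c s]
  have "((\<lambda>t. f (\<Phi> (a, b) + (t * c) *\<^sub>R ebasis 1 + (t * s) *\<^sub>R ebasis 2)) has_real_derivative
      c * partial 1 f (\<Phi> (a, b)) + s * partial 2 f (\<Phi> (a, b))) (at 0)" by simp
  moreover have "\<Phi> (a, b) + (t * c) *\<^sub>R ebasis 1 + (t * s) *\<^sub>R ebasis 2 = \<Phi> (a, t + b)" for t
    by (simp add: \<Phi>_def v_def algebra_simps)
  ultimately have "((\<lambda>t. (\<lambda>b. f (\<Phi> (a, b))) (t + b)) has_real_derivative
      c * partial 1 f (\<Phi> (a, b)) + s * partial 2 f (\<Phi> (a, b))) (at 0)" by simp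
  then show ?thesis using DERIV_shift[of "\<lambda>b. f (\<Phi> (a, b))" _ 0 b] by simp
qed

lemma continuous_on_\<Phi>_compose:
  assumes "continuous_on (euc 3) f"
  shows "continuous_on S (\<lambda>z. f (\<Phi> z))"
proof (rule continuous_on_compose2[OF assms continuous_\<Phi>[OF continuous_on_id]])
  show "\<Phi> ` S \<subseteq> euc 3" using P_euc by (auto simp: P_def)
qed

text \<open>The cone orientation and the constant \<open>wedge 2 uv\<close> differ on the disc at
  most at the vertex, a point of measure 0.\<close>

lemma disc_current:
  assumes g: "continuous_on (euc 3) (\<lambda>x. pairing 2 3 (\<omega> x) (wedge 2 uv))"
  shows "current_of 2 3 D (\<lambda>_. 1) (cone_orient \<tau>) \<omega>
    = set_lebesgue_integral lborel (cball 0 1) (\<lambda>z. pairing 2 3 (\<omega> (\<Phi> z)) (wedge 2 uv))"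
proof -
  let ?g = "\<lambda>x. pairing 2 3 (\<omega> x) (wedge 2 uv)"
  let ?f = "\<lambda>x. real 1 * pairing 2 3 (\<omega> x) (cone_orient \<tau> x)"
  have bD: "D \<in> sets borel" by (rule borel_compact[OF compact_D])
  have f0: "?f 0 = 0" by (simp add: cone_orient_def pairing_def)
  have fg: "?f x = ?g x" if "x \<in> D" "x \<noteq> 0" for x
    using that cone_orient_\<tau>[of x] by (simp add: D_eq)
  have "D \<subseteq> euc 3" using P_euc by (auto simp: D_eq)
  then have "(\<lambda>x. indicator D x *\<^sub>R ?g x) \<in> borel_measurable borel"
    using bD by (intro borel_measurable_continuous_on_indicator continuous_on_subset[OF g])
  \<comment> \<open>\<open>?f\<close> vanishes at the vertex while \<open>?g\<close> need not, so
    the integrand is \<open>?g\<close> with the vertex removed.\<close>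
  then have "(\<lambda>x. indicator (- {0}) x * (indicator D x *\<^sub>R ?g x)) \<in> borel_measurable borel"
    by (intro borel_measurable_times borel_measurable_indicator) auto
  moreover have "(\<lambda>x. indicator (- {0}) x * (indicator D x *\<^sub>R ?g x)) = (\<lambda>x. indicator D x *\<^sub>R ?f x)"
    using f0 fg by (auto simp: fun_eq_iff indicator_def)
  ultimately have m: "set_borel_measurable borel D ?f" by (simp add: set_borel_measurable_def)
  have "(\<lambda>z. indicator (cball 0 1) z *\<^sub>R ?g (\<Phi> z)) \<in> borel_measurable borel"
    by (intro borel_measurable_continuous_on_indicator continuous_on_\<Phi>_compose[OF g]) auto
  then have mg: "(\<lambda>z. indicator (cball 0 1) z *\<^sub>R ?g (\<Phi> z)) \<in> borel_measurable lborel" by simp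
  have e: "indicator (cball 0 1) z *\<^sub>R ?f (\<Phi> z) = indicator (- {0}) z * (indicator (cball 0 1) z *\<^sub>R ?g (\<Phi> z))" for z
  proof (cases "z = 0")
    case True
    then show ?thesis using f0 linear_0[OF linear_\<Phi>] by simp
  next
    case False
    then have "\<Phi> z \<noteq> 0" using norm_\<Phi>[of z] by auto
    then show ?thesis using False fg[of "\<Phi> z"] by (auto simp: indicator_def D_def)
  qed
  have "set_lebesgue_integral (hausdorff 2) D ?f = set_lebesgue_integral lborel (cball 0 1) (\<lambda>z. ?f (\<Phi> z))"
    by (rule disc_integral(1)[OF m])
  also have "\<dots> = set_lebesgue_integral lborel (cball 0 1) (\<lambda>z. ?g (\<Phi> z))"
    unfolding set_lebesgue_integral_def e
  proof (rule integral_cong_AE)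
    show "AE z in lborel. indicator (- {0}) z * (indicator (cball 0 1) z *\<^sub>R ?g (\<Phi> z)) = indicator (cball 0 1) z *\<^sub>R ?g (\<Phi> z)"
      using AE_lborel_singleton[of "0 :: real \<times> real"] by eventually_elim auto
  qed (use mg in \<open>auto intro!: borel_measurable_times\<close>)
  finally show ?thesis by (simp add: current_of_def)
qed

lemma circle_current:
  assumes g: "\<And>i. continuous_on (euc 3) (\<lambda>x. \<omega> x [i])"
  shows "current_of 1 3 L (\<lambda>_. 1) \<tau> \<omega> = integral {0..2 * pi} (\<lambda>t.
    (c * \<omega> (\<gamma> t) [1] + s * \<omega> (\<gamma> t) [2]) * cos t - \<omega> (\<gamma> t) [0] * sin t)"
proof -
  let ?f = "\<lambda>x. real 1 * pairing 1 3 (\<omega> x) (\<tau> x)"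
  let ?h = "\<lambda>t. (c * \<omega> (\<gamma> t) [1] + s * \<omega> (\<gamma> t) [2]) * cos t - \<omega> (\<gamma> t) [0] * sin t"
  have Le: "L \<subseteq> euc 3" using P_euc L_sub_P by auto
  have "continuous_on L (\<lambda>x. \<tau> x I)" for I
    using orientation_L continuous_on_product_then_coordinatewise[of L \<tau> I] by (simp add: orientation_def)
  moreover have "continuous_on L (\<lambda>x. \<omega> x I)" if "I \<in> {[0], [1], [2]}" for I
    using that continuous_on_subset[OF g Le] by auto
  ultimately have "continuous_on L ?f"
    unfolding pairing_def multi_idx_1 by (intro continuous_intros)
  then have m: "set_borel_measurable borel L ?f"
    unfolding set_borel_measurable_def
    by (intro borel_measurable_continuous_on_indicator borel_compact compact_L)
  have J: "J (\<gamma> t) = \<Phi> (- sin t, cos t)" for t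
    unfolding J_\<gamma> by (simp add: \<gamma>_def cos_add sin_add)
  have fh: "?f (\<gamma> t) = ?h t" for t
    unfolding pairing_def multi_idx_1
    by (simp add: \<tau>_def wedge_1[unfolded One_nat_def] J coord_\<Phi> algebra_simps)
  have ch: "continuous_on S ?h" for S
    using Le by (intro continuous_intros continuous_on_compose2[OF g] continuous_\<gamma>) auto
  have mh: "(\<lambda>t. indicator S t *\<^sub>R ?h t) \<in> borel_measurable lborel" if "S \<in> sets borel" for S
    using borel_measurable_continuous_on_indicator[OF that ch] by simp
  have "set_lebesgue_integral (hausdorff 1) L ?f = set_lebesgue_integral lborel {0..<2 * pi} (\<lambda>t. ?f (\<gamma> t))"
    by (rule circle_integral(1)[OF m])
  also have "\<dots> = set_lebesgue_integral lborel {0..<2 * pi} ?h"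
    by (simp only: fh)
  also have "\<dots> = set_lebesgue_integral lborel {0..2 * pi} ?h"
    unfolding set_lebesgue_integral_def
  proof (rule integral_cong_AE)
    show "AE t in lborel. indicator {0..<2 * pi} t *\<^sub>R ?h t = indicator {0..2 * pi} t *\<^sub>R ?h t"
      using AE_lborel_singleton[of "2 * pi"] by eventually_elim (auto simp: indicator_def)
  qed (rule mh; simp)+
  also have "\<dots> = integral {0..2 * pi} ?h"
    by (rule lborel_set_integral_Icc[OF ch])
  finally show ?thesis by (simp only: current_of_def)
qed

text \<open>Pulled back to the plane, \<omega> becomes \<open>A da + B db\<close>, where
  \<open>B\<close> is its coefficient along \<open>v\<close>. The derivative is
  \<open>(B' - A')\<close> times the area form, and the two halves of Green's theorem are
  combined.\<close>

lemma stokes: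
  assumes \<omega>: "\<omega> \<in> test_forms 1 3"
  shows "current_of 2 3 D (\<lambda>_. 1) (cone_orient \<tau>) (ext_deriv 3 \<omega>) = current_of 1 3 L (\<lambda>_. 1) \<tau> \<omega>"
proof -
  define o' where "o' i = (\<lambda>x. \<omega> x [i])" for i
  have C: "C_on \<infinity> 3 (euc 3) (o' i)" for i using \<omega> by (auto simp: test_forms_def o'_def)
  note co = C_on_continuous[OF C]
  define A where "A z = o' 0 (\<Phi> z)" for z
  define B where "B z = c * o' 1 (\<Phi> z) + s * o' 2 (\<Phi> z)" for z
  define A' where "A' z = c * partial 1 (o' 0) (\<Phi> z) + s * partial 2 (o' 0) (\<Phi> z)" for z
  define B' where "B' z = c * partial 0 (o' 1) (\<Phi> z) + s * partial 0 (o' 2) (\<Phi> z)" for z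
  have cA: "continuous_on S A" and cB: "continuous_on S B" and cA': "continuous_on S A'" and cB': "continuous_on S B'" for S
    unfolding A_def B_def A'_def B'_def by (intro continuous_intros continuous_on_\<Phi>_compose co; simp)+
  have dA: "((\<lambda>b. A (a, b)) has_real_derivative A' (a, b)) (at b)" for a b
    unfolding A_def A'_def by (rule deriv_along_v[OF C])
  have dB: "((\<lambda>a. B (a, b)) has_real_derivative B' (a, b)) (at a)" for a b
    unfolding B_def B'_def by (intro DERIV_add DERIV_cmult deriv_along_u[OF C])
  have e: "pairing 2 3 (ext_deriv 3 \<omega> x) (wedge 2 uv)
      = c * (partial 0 (o' 1) x - partial 1 (o' 0) x) + s * (partial 0 (o' 2) x - partial 2 (o' 0) x)"
    if "x \<in> euc 3" for x
    using that by (simp add: pairing_uv ext_deriv_pair o'_def)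
  have "continuous_on (euc 3) (\<lambda>x. pairing 2 3 (ext_deriv 3 \<omega> x) (wedge 2 uv))"
    by (subst continuous_on_cong[OF refl e], assumption) (intro continuous_intros co; simp)
  then have "current_of 2 3 D (\<lambda>_. 1) (cone_orient \<tau>) (ext_deriv 3 \<omega>)
      = set_lebesgue_integral lborel (cball 0 1) (\<lambda>z. pairing 2 3 (ext_deriv 3 \<omega> (\<Phi> z)) (wedge 2 uv))"
    by (rule disc_current)
  also have "\<dots> = set_lebesgue_integral lborel (cball 0 1) (\<lambda>z. B' z - A' z)"
  proof -
    have "\<Phi> z \<in> euc 3" for z using P_euc by (auto simp: P_def)
    then show ?thesis by (simp add: e A'_def B'_def algebra_simps)
  qed
  also have "\<dots> = set_lebesgue_integral lborel (cball 0 1) B' - set_lebesgue_integral lborel (cball 0 1) A'"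
  proof (rule set_integral_diff)
    show "set_integrable lborel (cball 0 1) A'" "set_integrable lborel (cball 0 1) B'"
      unfolding set_integrable_def
      by (rule borel_integrable_compact[OF _ cA'], simp) (rule borel_integrable_compact[OF _ cB'], simp)
  qed
  also have "\<dots> = integral {0..2 * pi} (\<lambda>t. B (cos t, sin t) * cos t) - integral {0..2 * pi} (\<lambda>t. A (cos t, sin t) * sin t)"
    unfolding green_disc_fst[OF cB' cB dB] green_disc_snd[OF cA' cA dA] ..
  also have "\<dots> = integral {0..2 * pi} (\<lambda>t. B (cos t, sin t) * cos t - A (cos t, sin t) * sin t)"
    by (intro integral_diff[symmetric] integrable_continuous_real continuous_intros
        continuous_on_compose2[OF cA[of UNIV]] continuous_on_compose2[OF cB[of UNIV]]) auto
  also have "\<dots> = current_of 1 3 L (\<lambda>_. 1) \<tau> \<omega>"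
    by (subst circle_current) (use co(1) in \<open>simp_all add: o'_def A_def B_def \<gamma>_def\<close>)
  finally show ?thesis .
qed

lemma truncated_cone_L: "truncated_cone 2 1 L \<tau> = current_of 2 3 D (\<lambda>_. 1) (cone_orient \<tau>)"
  by (simp add: truncated_cone_def cone_over_L D_eq numeral_2_eq_2 numeral_3_eq_3)

lemma spans_link_L: "spans_link 2 1 L \<tau> (truncated_cone 2 1 L \<tau>)"
proof -
  let ?T = "current_of 2 3 D (\<lambda>_. 1) (cone_orient \<tau>)"
  have b: "eq_current 1 3 (boundary 3 ?T) (current_of 1 3 L (\<lambda>_. 1) \<tau>)"
    unfolding eq_current_def boundary_def using stokes by blast
  have "rectifiable_current 1 3 (boundary 3 ?T)"
    using rectifiable_current_L b unfolding rectifiable_current_def eq_current_def by metis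
  then have "integral_current 2 3 ?T"
    using rectifiable_current_D by (simp add: integral_current_def)
  then show ?thesis
    using b unfolding spans_link_def truncated_cone_L one_add_one by simp
qed

end

section \<open>Smooth cutoff functions\<close>

text \<open>The derivatives of \<open>exp (- 1 / t)\<close>, extended by zero to \<open>t \<le> 0\<close>, are all of this form.\<close>

definition flat :: "real poly \<Rightarrow> real \<Rightarrow> real" where
  "flat p t = (if 0 < t then poly p (1 / t) * exp (- (1 / t)) else 0)"

text \<open>With \<open>y = 1 / t\<close> this is the decay of a polynomial against
  \<open>exp y\<close> as \<open>y\<close> grows.\<close>

lemma flat_tendsto_0: "(flat p \<longlongrightarrow> 0) (at 0)"
proof -
  have "((\<lambda>y. \<Sum>i\<le>degree p. coeff p i * (y ^ i / exp y)) \<longlongrightarrow> (\<Sum>i\<le>degree p. coeff p i * 0)) at_top"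
    by (intro tendsto_intros tendsto_power_div_exp_0)
  moreover have "(\<Sum>i\<le>degree p. coeff p i * (y ^ i / exp y)) = poly p y * exp (- y)" for y :: real
    by (simp add: poly_altdef sum_distrib_right exp_minus divide_inverse mult.assoc)
  ultimately have "((\<lambda>y. poly p y * exp (- y)) \<longlongrightarrow> 0) at_top" by simp
  from filterlim_compose[OF this filterlim_inverse_at_top_right]
  have "((\<lambda>t. poly p (1 / t) * exp (- (1 / t))) \<longlongrightarrow> 0) (at_right 0)" by (simp add: inverse_eq_divide)
  moreover have "eventually (\<lambda>t. poly p (1 / t) * exp (- (1 / t)) = flat p t) (at_right 0)"
    using eventually_at_right_less[of "0::real"] by eventually_elim (simp add: flat_def)
  ultimately have r: "(flat p \<longlongrightarrow> 0) (at_right 0)" by (rule Lim_transform_eventually)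
  have "eventually (\<lambda>t. 0 = flat p t) (at_left 0)"
    by (auto simp: eventually_at_filter flat_def intro!: always_eventually)
  then have "(flat p \<longlongrightarrow> 0) (at_left 0)" by (rule Lim_transform_eventually[OF tendsto_const])
  then show ?thesis using r by (rule filterlim_split_at)
qed

text \<open>With \<open>y = 1 / t\<close> the derivative of \<open>p(y) exp (- y)\<close> in
  \<open>t\<close> is \<open>y^2 (p - p')(y) exp (- y)\<close>, and \<open>monom 1 2\<close> is
  \<open>y^2\<close>.\<close>

lemma flat_deriv: "(flat p has_real_derivative flat (monom 1 2 * (p - pderiv p)) t) (at t)"
proof -
  consider "t < 0" | "t = 0" | "t > 0" by linarith
  then show ?thesis
  proof cases
    case 1
    have "((\<lambda>_. 0) has_real_derivative 0) (at t)" by simp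
    then have "(flat p has_real_derivative 0) (at t)"
      by (rule has_field_derivative_transform_within_open[of _ _ _ "{..<0}"]) (use 1 in \<open>auto simp: flat_def\<close>)
    then show ?thesis using 1 by (simp add: flat_def)
  next
    case 2
    \<comment> \<open>Dividing by \<open>h\<close> multiplies the polynomial by its variable, so the
      difference quotient at 0 is again of flat form and tends to 0.\<close>
    have "flat p h / h = flat (pCons 0 p) h" for h by (simp add: flat_def)
    then have "((\<lambda>h. (flat p (0 + h) - flat p 0) / h) \<longlongrightarrow> 0) (at 0)"
      using flat_tendsto_0[of "pCons 0 p"] by (simp add: flat_def[of p 0])
    then show ?thesis using 2 by (simp add: DERIV_def flat_def[of _ 0])
  next
    case 3
    have "((\<lambda>t. poly p (1 / t) * exp (- (1 / t))) has_real_derivative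
        (poly (pderiv p) (1 / t) * (- (1 / t\<^sup>2))) * exp (- (1 / t)) + (exp (- (1 / t)) * (1 / t\<^sup>2)) * poly p (1 / t)) (at t)"
    proof -
      have d: "((\<lambda>t. 1 / t) has_real_derivative - (1 / t\<^sup>2)) (at t)"
        using 3 by (auto intro!: derivative_eq_intros simp: power2_eq_square)
      show ?thesis
        using DERIV_mult[OF DERIV_chain2[OF poly_DERIV d] DERIV_chain2[OF DERIV_exp DERIV_minus[OF d]]] by simp
    qed
    also have "(poly (pderiv p) (1 / t) * (- (1 / t\<^sup>2))) * exp (- (1 / t)) + (exp (- (1 / t)) * (1 / t\<^sup>2)) * poly p (1 / t)
        = flat (monom 1 2 * (p - pderiv p)) t"
      using 3 by (simp add: flat_def poly_monom algebra_simps power_one_over)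
    finally show ?thesis
      by (rule has_field_derivative_transform_within_open[of _ _ _ "{0<..}"]) (use 3 in \<open>auto simp: flat_def\<close>)
  qed
qed

text \<open>An explicit class, closed under partial derivatives and large enough for the cutoff, to
  which \<open>C_on_class\<close> can be applied.\<close>

inductive_set smooth_funs :: "(rseq \<Rightarrow> real) set" where
  const: "(\<lambda>_. r) \<in> smooth_funs"
| coord: "(\<lambda>x. coord x i) \<in> smooth_funs"
| add: "f \<in> smooth_funs \<Longrightarrow> g \<in> smooth_funs \<Longrightarrow> (\<lambda>x. f x + g x) \<in> smooth_funs"
| mult: "f \<in> smooth_funs \<Longrightarrow> g \<in> smooth_funs \<Longrightarrow> (\<lambda>x. f x * g x) \<in> smooth_funs"
| flat: "f \<in> smooth_funs \<Longrightarrow> (\<lambda>x. flat p (f x)) \<in> smooth_funs"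
| inverse: "f \<in> smooth_funs \<Longrightarrow> (\<And>x. f x \<noteq> 0) \<Longrightarrow> (\<lambda>x. inverse (f x)) \<in> smooth_funs"

lemma smooth_funs_minus: "f \<in> smooth_funs \<Longrightarrow> (\<lambda>x. - f x) \<in> smooth_funs"
  using smooth_funs.mult[OF smooth_funs.const[of "-1"]] by simp

lemma smooth_funs_diff: "f \<in> smooth_funs \<Longrightarrow> g \<in> smooth_funs \<Longrightarrow> (\<lambda>x. f x - g x) \<in> smooth_funs"
  using smooth_funs.add[OF _ smooth_funs_minus] by simp

lemma smooth_funs_sum: "(\<And>a. a \<in> A \<Longrightarrow> f a \<in> smooth_funs) \<Longrightarrow> (\<lambda>x. \<Sum>a\<in>A. f a x) \<in> smooth_funs"
  by (induction A rule: infinite_finite_induct) (auto intro: smooth_funs.intros)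

lemma smooth_funs_continuous: "f \<in> smooth_funs \<Longrightarrow> continuous_on UNIV f"
proof (induction rule: smooth_funs.induct)
  case (flat f p)
  have "continuous_on UNIV (flat p)"
    using flat_deriv DERIV_isCont continuous_at_imp_continuous_on by blast
  then show ?case by (rule continuous_on_compose2[OF _ flat.IH]) simp
qed (auto intro!: continuous_intros)

lemma smooth_funs_deriv:
  "f \<in> smooth_funs \<Longrightarrow> \<exists>g\<in>smooth_funs. \<forall>x. ((\<lambda>t. f (x + t *\<^sub>R ebasis i)) has_real_derivative g x) (at 0)"
proof (induction rule: smooth_funs.induct)
  case (const r)
  then show ?case by (intro bexI[of _ "\<lambda>_. 0"]) (auto intro: smooth_funs.const)
next
  case (coord j)
  then show ?case
    by (intro bexI[of _ "\<lambda>_. if i = j then 1 else 0"]) (auto intro: smooth_funs.const intro!: derivative_eq_intros)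
next
  case (add f g)
  then obtain f' g' where "f' \<in> smooth_funs" "g' \<in> smooth_funs"
    "\<And>x. ((\<lambda>t. f (x + t *\<^sub>R ebasis i)) has_real_derivative f' x) (at 0)"
    "\<And>x. ((\<lambda>t. g (x + t *\<^sub>R ebasis i)) has_real_derivative g' x) (at 0)" by blast
  then show ?case
    by (intro bexI[of _ "\<lambda>x. f' x + g' x"] allI DERIV_add smooth_funs.add)
next
  case (mult f g)
  then obtain f' g' where *: "f' \<in> smooth_funs" "g' \<in> smooth_funs"
    and d: "\<And>x. ((\<lambda>t. f (x + t *\<^sub>R ebasis i)) has_real_derivative f' x) (at 0)"
    "\<And>x. ((\<lambda>t. g (x + t *\<^sub>R ebasis i)) has_real_derivative g' x) (at 0)" by blast
  have "((\<lambda>t. f (x + t *\<^sub>R ebasis i) * g (x + t *\<^sub>R ebasis i)) has_real_derivative f' x * g x + g' x * f x) (at 0)" for x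
    using DERIV_mult[OF d] by simp
  then show ?case
    using * mult.hyps by (intro bexI[of _ "\<lambda>x. f' x * g x + g' x * f x"]) (auto intro: smooth_funs.intros)
next
  case (flat f p)
  then obtain f' where *: "f' \<in> smooth_funs"
    and d: "\<And>x. ((\<lambda>t. f (x + t *\<^sub>R ebasis i)) has_real_derivative f' x) (at 0)" by blast
  let ?q = "monom 1 2 * (p - pderiv p)"
  have "((\<lambda>t. flat p (f (x + t *\<^sub>R ebasis i))) has_real_derivative flat ?q (f x) * f' x) (at 0)" for x
    using DERIV_chain2[OF flat_deriv d] by simp
  then show ?case
    using * flat.hyps by (intro bexI[of _ "\<lambda>x. flat ?q (f x) * f' x"]) (auto intro: smooth_funs.intros)
next
  case (inverse f)
  then obtain f' where *: "f' \<in> smooth_funs"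
    and d: "\<And>x. ((\<lambda>t. f (x + t *\<^sub>R ebasis i)) has_real_derivative f' x) (at 0)" by blast
  have "((\<lambda>t. inverse (f (x + t *\<^sub>R ebasis i))) has_real_derivative - (inverse (f x) * f' x * inverse (f x))) (at 0)" for x
    using DERIV_inverse'[OF d] inverse.hyps by simp
  then show ?case
    using * inverse.hyps
    by (intro bexI[of _ "\<lambda>x. - (inverse (f x) * f' x * inverse (f x))"])
       (auto intro!: smooth_funs_minus smooth_funs.mult smooth_funs.inverse)
qed

text \<open>Forms are extended by 0 off \<open>euc n\<close>, so agreement with a smooth function
  can be asked for on \<open>euc n\<close> only; the partial derivatives involved do not leave
  it.\<close>

definition smooth_on_euc :: "nat \<Rightarrow> (rseq \<Rightarrow> real) \<Rightarrow> bool" where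
  "smooth_on_euc n f \<longleftrightarrow> (\<exists>g\<in>smooth_funs. \<forall>x\<in>euc n. f x = g x)"

lemma smooth_on_euc_partial:
  assumes f: "smooth_on_euc n f" and i: "i < n"
  shows "smooth_on_euc n (partial i f)"
    and "x \<in> euc n \<Longrightarrow> (\<lambda>t. f (x + t *\<^sub>R ebasis i)) differentiable (at (0::real))"
proof -
  obtain g where g: "g \<in> smooth_funs" "\<And>x. x \<in> euc n \<Longrightarrow> f x = g x"
    using f by (auto simp: smooth_on_euc_def)
  obtain g' where g': "g' \<in> smooth_funs" "\<And>x. ((\<lambda>t. g (x + t *\<^sub>R ebasis i)) has_real_derivative g' x) (at 0)"
    using smooth_funs_deriv[OF g(1)] by blast
  have d: "((\<lambda>t. f (x + t *\<^sub>R ebasis i)) has_vector_derivative g' x) (at 0)" if "x \<in> euc n" for x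
    using g'(2)[of x] g(2) add_ebasis_euc[OF that i] by (simp add: has_real_derivative_iff_has_vector_derivative)
  then show "smooth_on_euc n (partial i f)"
    unfolding smooth_on_euc_def using g'(1) partial_eqI[OF d] by blast
  show "(\<lambda>t. f (x + t *\<^sub>R ebasis i)) differentiable (at (0::real))" if "x \<in> euc n"
    using d[OF that] by (rule differentiableI_vector)
qed

lemma smooth_on_euc_C_on: "smooth_on_euc n f \<Longrightarrow> C_on r n (euc n) f"
proof (rule C_on_class[where F="{f. smooth_on_euc n f}"])
  show "continuous_on (euc n) g" if "g \<in> {f. smooth_on_euc n f}" for g
  proof -
    have "smooth_on_euc n g" using that by simp
    then obtain h where "h \<in> smooth_funs" "\<And>x. x \<in> euc n \<Longrightarrow> g x = h x"
      unfolding smooth_on_euc_def by blast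
    then show ?thesis
      using continuous_on_subset[OF smooth_funs_continuous, of h "euc n"] continuous_on_cong[of "euc n" "euc n" g h] by simp
  qed
qed (auto intro: smooth_on_euc_partial)

lemma smooth_on_euc_ext_deriv:
  assumes "\<And>I. smooth_on_euc n (\<lambda>x. \<omega> x I)"
  shows "smooth_on_euc n (\<lambda>x. ext_deriv n \<omega> x J)"
proof (cases "sorted_wrt (<) J \<and> set J \<subseteq> {..<n}")
  case True
  have "\<exists>g\<in>smooth_funs. \<forall>x\<in>euc n. partial (J ! j) (\<lambda>y. \<omega> y (drop_nth j J)) x = g x" if "j < length J" for j
  proof -
    have "J ! j < n" using True that nth_mem by blast
    then show ?thesis using smooth_on_euc_partial(1)[OF assms] by (auto simp: smooth_on_euc_def)
  qed
  then obtain g where g: "\<And>j. j < length J \<Longrightarrow> g j \<in> smooth_funs"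
    "\<And>j x. j < length J \<Longrightarrow> x \<in> euc n \<Longrightarrow> partial (J ! j) (\<lambda>y. \<omega> y (drop_nth j J)) x = g j x"
    by metis
  have "(\<lambda>x. \<Sum>j<length J. (- 1) ^ j * g j x) \<in> smooth_funs"
    by (rule smooth_funs_sum) (use g in \<open>auto intro!: smooth_funs.mult smooth_funs.const\<close>)
  then show ?thesis
    unfolding smooth_on_euc_def by (rule bexI[rotated]) (use True g in \<open>auto simp: ext_deriv_def\<close>)
next
  case False
  then show ?thesis
    unfolding smooth_on_euc_def by (intro bexI[of _ "\<lambda>_. 0"]) (auto simp: ext_deriv_def intro: smooth_funs.const)
qed

lemma partial_local:
  assumes d: "((\<lambda>t. g (x + t *\<^sub>R ebasis i)) has_vector_derivative D) (at 0)"
    and r: "norm x < r" and eq: "\<And>y. norm y < r \<Longrightarrow> x \<in> euc n \<Longrightarrow> y \<in> euc n \<Longrightarrow> f y = g y"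
    and x: "x \<in> euc n" "i < n"
  shows "partial i f x = D"
proof (rule partial_eqI, rule has_vector_derivative_transform_within[OF d, of "r - norm x"])
  show "g (x + t *\<^sub>R ebasis i) = f (x + t *\<^sub>R ebasis i)" if "dist t 0 < r - norm x" for t
  proof (rule eq[symmetric])
    have "norm (ebasis i) = 1" by (simp add: norm_eq_sqrt_inner inner_ebasis)
    then show "norm (x + t *\<^sub>R ebasis i) < r"
      using norm_triangle_ineq[of x "t *\<^sub>R ebasis i"] that by simp
  qed (use x add_ebasis_euc in auto)
qed (use r in auto)

lemma partial_vanishing:
  fixes f :: "rseq \<Rightarrow> real"
  assumes r: "r < norm x" and eq: "\<And>y. r < norm y \<Longrightarrow> f y = 0"
  shows "partial i f x = 0"
proof (rule partial_eqI, rule has_vector_derivative_transform_within[OF has_vector_derivative_const, of "norm x - r"])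
  show "0 = f (x + t *\<^sub>R ebasis i)" if "dist t 0 < norm x - r" for t
  proof (rule eq[symmetric])
    have "norm (ebasis i) = 1" by (simp add: norm_eq_sqrt_inner inner_ebasis)
    then show "r < norm (x + t *\<^sub>R ebasis i)"
      using norm_triangle_ineq4[of "x + t *\<^sub>R ebasis i" "t *\<^sub>R ebasis i"] that by simp
  qed
qed (use r in auto)

lemma partial_zero: "partial i (\<lambda>_. 0 :: real) x = 0"
  by (rule partial_eqI) simp

text \<open>The usual quotient, 1 for \<open>a \<ge> 1\<close>, that is
  \<open>norm x \<le> R\<close>, and 0 for \<open>a \<le> 0\<close>. On \<open>euc 3\<close> the sum
  is the squared norm; written out, it is visibly a member of \<open>smooth_funs\<close>.\<close>

definition cutoff :: "real \<Rightarrow> rseq \<Rightarrow> real" where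
  "cutoff R x = (let a = R\<^sup>2 + 1 - (\<Sum>i<3. coord x i * coord x i) in flat 1 a * inverse (flat 1 a + flat 1 (1 - a)))"

lemma flat_pos: "0 < t \<Longrightarrow> 0 < flat 1 t" and flat_nonneg: "0 \<le> flat 1 t"
  by (simp_all add: flat_def)

lemma cutoff_denom: "0 < flat 1 a + flat 1 (1 - a)"
  using flat_pos[of a] flat_pos[of "1 - a"] flat_nonneg[of a] flat_nonneg[of "1 - a"] by (cases "0 < a") auto

lemma cutoff_smooth: "cutoff R \<in> smooth_funs"
proof -
  have a: "(\<lambda>x. R\<^sup>2 + 1 - (\<Sum>i<3. coord x i * coord x i)) \<in> smooth_funs"
    by (intro smooth_funs_diff smooth_funs_sum smooth_funs.intros)
  have "flat 1 t + flat 1 (1 - t) \<noteq> 0" for t using cutoff_denom[of t] by simp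
  then show ?thesis
    unfolding cutoff_def Let_def
    by (intro smooth_funs.mult smooth_funs.inverse smooth_funs.add smooth_funs.flat a
        smooth_funs_diff[OF smooth_funs.const a])
qed

lemma cutoff_bounds: "0 \<le> cutoff R x" "cutoff R x \<le> 1"
  using cutoff_denom[of "R\<^sup>2 + 1 - (\<Sum>i<3. coord x i * coord x i)"] flat_nonneg
  by (auto simp: cutoff_def Let_def divide_inverse[symmetric] divide_le_eq_1)

lemma sum_coord_norm: "x \<in> euc 3 \<Longrightarrow> (\<Sum>i<3. coord x i * coord x i) = (norm x)\<^sup>2"
  by (simp add: inner_euc[symmetric] power2_norm_eq_inner)

lemma cutoff_eq_1:
  assumes "x \<in> euc 3" "norm x \<le> R"
  shows "cutoff R x = 1"
proof -
  have "(norm x)\<^sup>2 \<le> R\<^sup>2" using assms by (intro power_mono) auto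
  then have "flat 1 (1 - (R\<^sup>2 + 1 - (norm x)\<^sup>2)) = 0" "0 < flat 1 (R\<^sup>2 + 1 - (norm x)\<^sup>2)"
    by (auto simp: flat_def)
  then show ?thesis by (simp add: cutoff_def sum_coord_norm[OF assms(1)])
qed

text \<open>The cutoff vanishes from radius \<open>sqrt (R^2 + 1)\<close> on; \<open>R + 1\<close>
  is a simpler bound above it.\<close>

lemma cutoff_eq_0:
  assumes "x \<in> euc 3" "0 \<le> R" "R + 1 < norm x"
  shows "cutoff R x = 0"
proof -
  have "(R + 1)\<^sup>2 \<le> (norm x)\<^sup>2" using assms by (intro power_mono) auto
  then have "R\<^sup>2 + 1 \<le> (norm x)\<^sup>2" using assms(2) by (simp add: power2_sum)
  then have "flat 1 (R\<^sup>2 + 1 - (norm x)\<^sup>2) = 0" by (simp add: flat_def)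
  then show ?thesis by (simp add: cutoff_def sum_coord_norm[OF assms(1)])
qed

section \<open>The calibration\<close>

lemma test_formsI:
  assumes "\<And>x I. x \<notin> euc n \<or> I \<notin> multi_idx k n \<Longrightarrow> \<omega> x I = 0"
    and "\<And>I. C_on \<infinity> n (euc n) (\<lambda>x. \<omega> x I)" and "\<And>x I. \<omega> x I \<noteq> 0 \<Longrightarrow> norm x \<le> R"
  shows "\<omega> \<in> test_forms k n"
  unfolding test_forms_def using assms by blast

lemma test_forms_C_on: "\<omega> \<in> test_forms k n \<Longrightarrow> C_on \<infinity> n (euc n) (\<lambda>x. \<omega> x I)"
  by (simp add: test_forms_def)

context great_circle
begin

text \<open>The plane is calibrated by the constant form \<open>dx\<^sub>0 \<and> (c dx\<^sub>1 + s dx\<^sub>2) = d (x\<^sub>0 (c dx\<^sub>1 + s dx\<^sub>2))\<close>;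
  both forms are cut off, since test forms have compact support.\<close>

definition calib :: "real \<Rightarrow> form" where
  "calib R x I = (if x \<in> euc 3 then cutoff R x * (if I = [0, 1] then c else if I = [0, 2] then s else 0) else 0)"

definition primitive :: "real \<Rightarrow> form" where
  "primitive R x I = (if x \<in> euc 3 then cutoff R x * (coord x 0 * (if I = [1] then c else if I = [2] then s else 0)) else 0)"

lemma calib_test: "0 \<le> R \<Longrightarrow> calib R \<in> test_forms 2 3"
proof -
  assume R: "0 \<le> R"
  have "C_on \<infinity> 3 (euc 3) (\<lambda>x. calib R x I)" for I
  proof (rule smooth_on_euc_C_on)
    show "smooth_on_euc 3 (\<lambda>x. calib R x I)"
      unfolding smooth_on_euc_def
      by (intro bexI[of _ "\<lambda>x. cutoff R x * (if I = [0, 1] then c else if I = [0, 2] then s else 0)"])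
         (auto simp: calib_def intro!: smooth_funs.mult cutoff_smooth smooth_funs.const)
  qed
  moreover have "norm x \<le> R + 1" if "calib R x I \<noteq> 0" for x I
    using that cutoff_eq_0[of x R] R by (auto simp: calib_def not_le[symmetric] split: if_splits)
  moreover have "calib R x I = 0" if "x \<notin> euc 3 \<or> I \<notin> multi_idx 2 3" for x I
    using that by (auto simp: calib_def multi_idx_2)
  ultimately show ?thesis by (intro test_formsI)
qed

lemma primitive_smooth: "smooth_on_euc 3 (\<lambda>x. primitive R x I)"
  unfolding smooth_on_euc_def
  by (intro bexI[of _ "\<lambda>x. cutoff R x * (coord x 0 * (if I = [1] then c else if I = [2] then s else 0))"])
     (auto simp: primitive_def intro!: smooth_funs.mult cutoff_smooth smooth_funs.const smooth_funs.coord)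

lemma primitive_support: "0 \<le> R \<Longrightarrow> R + 1 < norm x \<Longrightarrow> primitive R x I = 0"
  using cutoff_eq_0[of x R] by (auto simp: primitive_def)

lemma primitive_test: "0 \<le> R \<Longrightarrow> primitive R \<in> test_forms 1 3"
proof -
  assume R: "0 \<le> R"
  have "norm x \<le> R + 1" if "primitive R x I \<noteq> 0" for x I
    using that primitive_support[OF R, of x I] not_le by blast
  moreover have "primitive R x I = 0" if "x \<notin> euc 3 \<or> I \<notin> multi_idx 1 3" for x I
    using that unfolding multi_idx_1 by (auto simp: primitive_def)
  ultimately show ?thesis
    using smooth_on_euc_C_on[OF primitive_smooth] by (intro test_formsI)
qed

text \<open>At lists of length other than 2 only identically vanishing coefficients enter, and
  beyond radius \<open>R + 1\<close> the form is locally 0. Being a test form is what makes the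
  values of equal currents at it comparable.\<close>

lemma ext_deriv_primitive_test:
  assumes R: "0 \<le> R"
  shows "ext_deriv 3 (primitive R) \<in> test_forms 2 3"
proof -
  have "ext_deriv 3 (primitive R) x J = 0" if "J \<notin> multi_idx 2 3" for x J
  proof (cases "sorted_wrt (<) J \<and> set J \<subseteq> {..<3}")
    case True
    then have l: "length J \<noteq> 2" using that by (auto simp: multi_idx_def)
    have "(\<lambda>y. primitive R y (drop_nth j J)) = (\<lambda>_. 0)" if "j < length J" for j
    proof -
      have "length (drop_nth j J) \<noteq> 1" using that l by (auto simp: drop_nth_def)
      then show ?thesis by (auto simp: primitive_def)
    qed
    then show ?thesis by (simp add: ext_deriv_def partial_zero)
  qed (auto simp: ext_deriv_def)
  moreover have "norm x \<le> R + 1" if "ext_deriv 3 (primitive R) x J \<noteq> 0" for x J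
  proof (rule ccontr)
    assume "\<not> norm x \<le> R + 1"
    then have "partial i (\<lambda>y. primitive R y I) x = 0" for i I
      by (intro partial_vanishing[of "R + 1"] primitive_support R) auto
    then show False using that by (simp add: ext_deriv_def split: if_splits)
  qed
  moreover have "ext_deriv 3 (primitive R) x K = 0" if "x \<notin> euc 3" for x K
    using that by (simp add: ext_deriv_def)
  ultimately show ?thesis
    using smooth_on_euc_C_on[OF smooth_on_euc_ext_deriv[OF primitive_smooth]]
    by (intro test_formsI) blast+
qed

lemma partial_primitive:
  assumes x: "x \<in> euc 3" "norm x < R" and i: "i < 3"
  shows "partial i (\<lambda>y. primitive R y I) x = (if i = 0 then if I = [1] then c else if I = [2] then s else 0 else 0)"
proof -
  let ?k = "if I = [1] then c else if I = [2] then s else 0"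
  have "((\<lambda>t. coord (x + t *\<^sub>R ebasis i) 0 * ?k) has_vector_derivative (if i = 0 then ?k else 0)) (at 0)"
    by (auto intro!: derivative_eq_intros simp flip: has_real_derivative_iff_has_vector_derivative)
  then show ?thesis
    by (rule partial_local[OF _ x(2) _ x(1) i]) (simp add: primitive_def cutoff_eq_1)
qed

text \<open>Near such a point the cutoff is constant. Farther out its derivative enters and the
  comass is not controlled, which is why \<open>calib\<close> is kept as a form of its own.\<close>

lemma ext_deriv_primitive:
  assumes x: "x \<in> euc 3" "norm x < R"
  shows "K \<in> multi_idx 2 3 \<Longrightarrow> ext_deriv 3 (primitive R) x K = calib R x K"
proof -
  assume K: "K \<in> multi_idx 2 3"
  have "cutoff R x = 1" using x by (simp add: cutoff_eq_1)
  then have "ext_deriv 3 (primitive R) x [a, b] = calib R x [a, b]" if "(a, b) \<in> {(0, 1), (0, 2), (1, 2)}" for a b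
    using that x(1) by (auto simp: ext_deriv_pair partial_primitive[OF x] calib_def)
  then show ?thesis using K unfolding multi_idx_2 by blast
qed

text \<open>On an orthonormal pair the value is a factor between 0 and 1 times the determinant
  \<open>a * q - p * b\<close>. By Bessel's inequality \<open>(a, b)\<close> and
  \<open>(p, q)\<close> have length at most 1, and Lagrange's identity bounds the
  determinant.\<close>

lemma calib_comass: "comass_le_1 2 3 (calib R x)"
  unfolding comass_le_1_def
proof (intro allI impI)
  fix w assume w: "orthonormal 2 w \<and> (\<forall>i<2. w i \<in> euc 3)"
  then have o: "inner (w 0) (w 0) = 1" "inner (w 1) (w 1) = 1" "inner (w 0) (w 1) = 0" "inner (w 1) (w 0) = 0"
    by (simp_all add: orthonormal_def)
  have bessel: "(inner (w 0) z)\<^sup>2 + (inner (w 1) z)\<^sup>2 \<le> 1" if z: "inner z z = 1" for z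
  proof -
    let ?y = "z - inner (w 0) z *\<^sub>R w 0 - inner (w 1) z *\<^sub>R w 1"
    have "inner ?y ?y = 1 - ((inner (w 0) z)\<^sup>2 + (inner (w 1) z)\<^sup>2)"
    proof -
      have "inner z (w 0) = inner (w 0) z" "inner z (w 1) = inner (w 1) z" by (rule inner_commute)+
      then show ?thesis
        unfolding inner_diff_left inner_diff_right inner_scaleR_left inner_scaleR_right o z
        by (simp add: power2_eq_square)
    qed
    then show ?thesis using inner_ge_zero[of ?y] by linarith
  qed
  define a b p q where "a = inner (w 0) u" and "b = inner (w 1) u" and "p = inner (w 0) v" and "q = inner (w 1) v"
  have "a\<^sup>2 + b\<^sup>2 \<le> 1" "p\<^sup>2 + q\<^sup>2 \<le> 1" unfolding a_def b_def p_def q_def by (intro bessel; simp)+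
  then have "(a\<^sup>2 + b\<^sup>2) * (p\<^sup>2 + q\<^sup>2) \<le> 1" by (intro mult_le_one) auto
  moreover have "(a * q - p * b)\<^sup>2 = (a\<^sup>2 + b\<^sup>2) * (p\<^sup>2 + q\<^sup>2) - (a * p + b * q)\<^sup>2"
    by (simp add: power2_eq_square algebra_simps)
  ultimately have "(a * q - p * b)\<^sup>2 \<le> 1" using zero_le_power2[of "a * p + b * q"] by linarith
  then have ab: "\<bar>a * q - p * b\<bar> \<le> 1" by (simp add: abs_square_le_1)
  have "pairing 2 3 (calib R x) (wedge 2 w) = (if x \<in> euc 3 then cutoff R x else 0) * (a * q - p * b)"
    unfolding pairing_def multi_idx_2
    by (simp add: wedge_2 calib_def a_def b_def p_def q_def u_def v_def inner_add_right inner_ebasis algebra_simps)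
  moreover have "\<bar>(if x \<in> euc 3 then cutoff R x else 0) * (a * q - p * b)\<bar> \<le> 1"
    using ab cutoff_bounds[of R x] by (auto simp: abs_mult intro: mult_le_one)
  ultimately show "\<bar>pairing 2 3 (calib R x) (wedge 2 w)\<bar> \<le> 1" by simp
qed

section \<open>Mass of the disc and of its competitors\<close>

definition disc_area :: real where
  "disc_area = set_lebesgue_integral lborel (cball 0 1 :: (real \<times> real) set) (\<lambda>_. 1)"

lemma continuous_pairing:
  assumes "\<omega> \<in> test_forms 2 3"
  shows "continuous_on (euc 3) (\<lambda>x. pairing 2 3 (\<omega> x) \<xi>)"
proof -
  have "continuous_on (euc 3) (\<lambda>x. \<omega> x I)" for I
    by (rule C_on_continuous(1)[OF test_forms_C_on[OF assms]])
  then show ?thesis unfolding pairing_def by (intro continuous_intros)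
qed

text \<open>A form of comass at most 1 is at most 1 on the unit 2-vector \<open>wedge 2 uv\<close>,
  which orients the disc away from the vertex.\<close>

lemma mass_disc_le: "mass 2 3 (current_of 2 3 D (\<lambda>_. 1) (cone_orient \<tau>)) \<le> ereal disc_area"
  unfolding mass_def
proof (rule SUP_least)
  fix \<omega> assume "\<omega> \<in> {\<omega> \<in> test_forms 2 3. \<forall>x\<in>euc 3. comass_le_1 2 3 (\<omega> x)}"
  then have \<omega>: "\<omega> \<in> test_forms 2 3" and cm: "\<And>x. x \<in> euc 3 \<Longrightarrow> comass_le_1 2 3 (\<omega> x)" by auto
  note g = continuous_pairing[OF \<omega>, of "wedge 2 uv"]
  have "orthonormal 2 uv \<and> (\<forall>i<2. uv i \<in> euc 3)"
    using uv_euc by (auto simp: orthonormal_def uv_def less_2_cases_iff)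
  then have "\<bar>pairing 2 3 (\<omega> (\<Phi> z)) (wedge 2 uv)\<bar> \<le> 1" for z
    using cm[of "\<Phi> z"] P_euc unfolding comass_le_1_def P_def by blast
  then have le: "pairing 2 3 (\<omega> (\<Phi> z)) (wedge 2 uv) \<le> 1" for z using abs_le_D1 by blast
  have "current_of 2 3 D (\<lambda>_. 1) (cone_orient \<tau>) \<omega>
      = set_lebesgue_integral lborel (cball 0 1) (\<lambda>z. pairing 2 3 (\<omega> (\<Phi> z)) (wedge 2 uv))"
    by (rule disc_current[OF g])
  also have "\<dots> \<le> disc_area"
    unfolding disc_area_def
  proof (rule set_integral_mono)
    show "set_integrable lborel (cball 0 1) (\<lambda>z. pairing 2 3 (\<omega> (\<Phi> z)) (wedge 2 uv))"
      unfolding set_integrable_def by (rule borel_integrable_compact[OF _ continuous_on_\<Phi>_compose[OF g]]) simp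
    show "set_integrable lborel (cball 0 1 :: (real \<times> real) set) (\<lambda>_. 1 :: real)"
      unfolding set_integrable_def by (rule borel_integrable_compact[OF _ continuous_on_const]) simp
  qed (rule le)
  finally show "ereal (current_of 2 3 D (\<lambda>_. 1) (cone_orient \<tau>) \<omega>) \<le> ereal disc_area" by simp
qed

text \<open>On the disc the cutoff is 1, and the calibration takes the value
  \<open>c^2 + s^2 = 1\<close> on the orienting 2-vector.\<close>

lemma disc_primitive:
  assumes R: "1 < R"
  shows "current_of 2 3 D (\<lambda>_. 1) (cone_orient \<tau>) (ext_deriv 3 (primitive R)) = disc_area"
proof -
  have "ext_deriv 3 (primitive R) \<in> test_forms 2 3" using R by (intro ext_deriv_primitive_test) simp
  then have "current_of 2 3 D (\<lambda>_. 1) (cone_orient \<tau>) (ext_deriv 3 (primitive R))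
      = set_lebesgue_integral lborel (cball 0 1) (\<lambda>z. pairing 2 3 (ext_deriv 3 (primitive R) (\<Phi> z)) (wedge 2 uv))"
    by (intro disc_current continuous_pairing)
  also have "\<dots> = disc_area"
    unfolding disc_area_def
  proof (rule set_lebesgue_integral_cong)
    show "\<forall>z. z \<in> cball 0 1 \<longrightarrow> pairing 2 3 (ext_deriv 3 (primitive R) (\<Phi> z)) (wedge 2 uv) = 1"
    proof (intro allI impI)
      fix z :: "real \<times> real" assume "z \<in> cball 0 1"
      then have z: "norm (\<Phi> z) < R" "norm (\<Phi> z) \<le> R" "\<Phi> z \<in> euc 3" using R P_euc by (auto simp: norm_\<Phi> P_def)
      then show "pairing 2 3 (ext_deriv 3 (primitive R) (\<Phi> z)) (wedge 2 uv) = 1"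
        using cs by (simp add: pairing_uv ext_deriv_primitive multi_idx_2 calib_def cutoff_eq_1 power2_eq_square)
    qed
  qed simp
  finally show ?thesis .
qed

text \<open>\<open>T\<close> takes the same value at \<open>calib R\<close> as at the derivative of
  \<open>primitive R\<close>. The latter value depends on the boundary only, so it is that of the
  disc, its area; the former is at most the mass of \<open>T\<close>.\<close>

lemma area_minimizing_L: "area_minimizing_cone 2 1 L \<tau>"
  unfolding area_minimizing_cone_def
proof (intro conjI allI impI spans_link_L)
  fix T assume "spans_link 2 1 L \<tau> T"
  then have T: "integral_current 2 3 T" and bT: "eq_current 1 3 (boundary 3 T) (current_of 1 3 L (\<lambda>_. 1) \<tau>)"
    unfolding spans_link_def one_add_one by simp_all
  obtain E \<theta> \<xi> where E: "oriented_rectifiable 2 3 E \<xi>" "bounded E"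
    and eq: "eq_current 2 3 T (current_of 2 3 E \<theta> \<xi>)"
    using T unfolding integral_current_def rectifiable_current_def by blast
  obtain r where r: "\<And>x. x \<in> E \<Longrightarrow> norm x \<le> r" using E(2) by (auto simp: bounded_iff)
  \<comment> \<open>Larger than the norms of all points of \<open>E\<close> and of the unit disc,
    with room to spare, so that the cutoff is 1 near each of these points.\<close>
  define R where "R = max r 1 + 1"
  have R: "1 < R" "0 \<le> R" "\<And>x. x \<in> E \<Longrightarrow> norm x < R" using r by (force simp: R_def)+
  have Ee: "E \<subseteq> euc 3" using E(1) by (simp add: oriented_rectifiable_def)
  have "T (calib R) = current_of 2 3 E \<theta> \<xi> (calib R)"
    using eq calib_test[OF R(2)] by (simp add: eq_current_def)
  \<comment> \<open>The two forms may differ far out, but the integral sees them on \<open>E\<close>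
    only; boundedness of \<open>E\<close> is used here.\<close>
  also have "\<dots> = current_of 2 3 E \<theta> \<xi> (ext_deriv 3 (primitive R))"
    unfolding current_of_def
  proof (rule set_lebesgue_integral_cong)
    show "E \<in> sets (hausdorff 2)" using E(1) by (simp add: oriented_rectifiable_def)
    have "pairing 2 3 (calib R x) (\<xi> x) = pairing 2 3 (ext_deriv 3 (primitive R) x) (\<xi> x)" if "x \<in> E" for x
      unfolding pairing_def using that Ee R(3) by (intro sum.cong) (auto simp: ext_deriv_primitive)
    then show "\<forall>x. x \<in> E \<longrightarrow> real (\<theta> x) * pairing 2 3 (calib R x) (\<xi> x)
        = real (\<theta> x) * pairing 2 3 (ext_deriv 3 (primitive R) x) (\<xi> x)" by simp
  qed
  also have "\<dots> = T (ext_deriv 3 (primitive R))"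
    using eq ext_deriv_primitive_test[OF R(2)] by (simp add: eq_current_def)
  also have "\<dots> = current_of 1 3 L (\<lambda>_. 1) \<tau> (primitive R)"
    using bT primitive_test[OF R(2)] by (simp add: eq_current_def boundary_def)
  also have "\<dots> = current_of 2 3 D (\<lambda>_. 1) (cone_orient \<tau>) (ext_deriv 3 (primitive R))"
    by (rule stokes[OF primitive_test[OF R(2)], symmetric])
  also have "\<dots> = disc_area" by (rule disc_primitive[OF R(1)])
  finally have "ereal disc_area = ereal (T (calib R))" by simp
  also have "\<dots> \<le> mass 2 3 T"
    unfolding mass_def by (rule SUP_upper) (use calib_test[OF R(2)] calib_comass in auto)
  finally have "mass 2 3 (truncated_cone 2 1 L \<tau>) \<le> mass 2 3 T"
    unfolding truncated_cone_L using mass_disc_le order_trans by blast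
  then show "mass (1 + 1) (2 + 1) (truncated_cone 2 1 L \<tau>) \<le> mass (1 + 1) (2 + 1) T"
    unfolding one_add_one by simp
qed

lemma regular_minimizing_cones_L: "(3, P, cone_orient \<tau>) \<in> regular_minimizing_cones"
proof -
  have "(3, P, cone_orient \<tau>) = (2 + 1, cone_over L, cone_orient \<tau>)" by (simp add: cone_over_L)
  moreover have "(1::nat) \<le> 2" "(1::nat) + 1 > 1" by simp_all
  ultimately show ?thesis
    unfolding regular_minimizing_cones_def mem_Collect_eq
    using closed_submanifold_L orientation_L area_minimizing_L by blast
qed

end

section \<open>Cardinalities\<close>

definition dense_seq :: "'a::metric_space set \<Rightarrow> nat \<Rightarrow> 'a" where
  "dense_seq L = (SOME f. range f \<subseteq> L \<and> L \<subseteq> closure (range f))"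

text \<open>Total boundedness gives finite nets of radius 1/(n+1), whose union is countable and
  dense.\<close>

lemma dense_seq:
  fixes L :: "'a::metric_space set"
  assumes L: "compact L" "L \<noteq> {}"
  shows "closure (range (dense_seq L)) = L" "dense_seq L i \<in> L"
proof -
  have "\<exists>k. finite k \<and> k \<subseteq> L \<and> L \<subseteq> (\<Union>x\<in>k. ball x (inverse (real (Suc n))))" for n
    using seq_compact_imp_totally_bounded[OF compact_imp_seq_compact[OF L(1)]] by simp
  then obtain K where K: "\<And>n. finite (K n)" "\<And>n. K n \<subseteq> L"
    "\<And>n. L \<subseteq> (\<Union>x\<in>K n. ball x (inverse (real (Suc n))))" by metis
  define S where "S = (\<Union>n. K n)"
  have S: "countable S" "S \<subseteq> L" using K by (auto simp: S_def intro: countable_finite)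
  obtain x0 where "x0 \<in> L" using L(2) by blast
  then obtain y0 where "y0 \<in> K 0" using K(3)[of 0] by blast
  then have "S \<noteq> {}" by (auto simp: S_def)
  have "x \<in> closure S" if x: "x \<in> L" for x
    unfolding closure_approachable
  proof (intro allI impI)
    fix e :: real assume "0 < e"
    then obtain n where n: "inverse (real (Suc n)) < e" using reals_Archimedean by blast
    obtain y where "y \<in> K n" "dist y x < inverse (real (Suc n))" using K(3)[of n] x by auto
    then show "\<exists>y\<in>S. dist y x < e" using n by (auto simp: S_def intro!: bexI[of _ y])
  qed
  then have "range (from_nat_into S) \<subseteq> L \<and> L \<subseteq> closure (range (from_nat_into S))"
    using S \<open>S \<noteq> {}\<close> by (simp add: range_from_nat_into subset_iff)
  then have *: "range (dense_seq L) \<subseteq> L \<and> L \<subseteq> closure (range (dense_seq L))"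
    unfolding dense_seq_def
    by (rule someI[where P="\<lambda>f. range f \<subseteq> L \<and> L \<subseteq> closure (range f)"])
  then show "closure (range (dense_seq L)) = L"
    using closure_minimal compact_imp_closed[OF L(1)] by blast
  show "dense_seq L i \<in> L" using * by blast
qed

text \<open>A real is coded by a set of naturals, so a countable family of reals by a set of pairs
  and again by a set of naturals.\<close>

lemma countable_families_lepoll_reals: "(UNIV :: ('a::countable \<Rightarrow> real) set) \<lesssim> (UNIV :: real set)"
proof -
  obtain r :: "real \<Rightarrow> nat set" where r: "inj r"
    using eqpoll_imp_lepoll[OF eqpoll_sym[OF nat_sets_eqpoll_reals]] by (auto simp: lepoll_def)
  let ?F = "\<lambda>h :: 'a \<Rightarrow> real. {to_nat (a, m) | a m. m \<in> r (h a)}"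
  have "inj ?F"
  proof (rule injI, rule ext)
    fix h g :: "'a \<Rightarrow> real" and a assume eq: "?F h = ?F g"
    have "m \<in> r (h a) \<longleftrightarrow> to_nat (a, m) \<in> ?F h" for h :: "'a \<Rightarrow> real" and m by auto
    then have "r (h a) = r (g a)" using eq by blast
    then show "h a = g a" using r by (rule injD[rotated])
  qed
  then have "(UNIV :: ('a \<Rightarrow> real) set) \<lesssim> (UNIV :: nat set set)" by (auto simp: lepoll_def)
  then show ?thesis using eqpoll_imp_lepoll[OF nat_sets_eqpoll_reals] lepoll_trans by blast
qed

text \<open>A common source for both upper bounds: it contains the minimal submanifolds, and the
  minimizing cones lie in its image under the cone construction.\<close>

definition oriented_submanifolds :: "(nat \<times> rseq set \<times> (rseq \<Rightarrow> multivector)) set" where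
  "oriented_submanifolds = {(N, L, \<tau>). \<exists>k. closed_submanifold N k L \<and> orientation k L \<tau>}"

lemma oriented_submanifolds_lepoll_reals: "oriented_submanifolds \<lesssim> (UNIV :: real set)"
proof -
  define code :: "nat \<times> rseq set \<times> (rseq \<Rightarrow> multivector) \<Rightarrow> unit + nat \<times> nat + nat \<times> nat list \<Rightarrow> real" where
    "code = (\<lambda>(N, L, \<tau>) a. case a of Inl _ \<Rightarrow> real N | Inr (Inl (i, j)) \<Rightarrow> coord (dense_seq L i) j
      | Inr (Inr (i, I)) \<Rightarrow> \<tau> (dense_seq L i) I)"
  have "inj_on code oriented_submanifolds"
  proof (rule inj_onI)
    fix A A' assume A: "A \<in> oriented_submanifolds" "A' \<in> oriented_submanifolds" and "code A = code A'"
    obtain N L \<tau> N' L' \<tau>' where AA: "A = (N, L, \<tau>)" "A' = (N', L', \<tau>')" by (metis prod_cases3)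
    with \<open>code A = code A'\<close> have eq: "code (N, L, \<tau>) = code (N', L', \<tau>')" by simp
    from A AA obtain k k' where M: "closed_submanifold N k L" "orientation k L \<tau>"
      "closed_submanifold N' k' L'" "orientation k' L' \<tau>'"
      by (auto simp: oriented_submanifolds_def)
    have L: "compact L" "L \<noteq> {}" and L': "compact L'" "L' \<noteq> {}"
      using M by (auto simp: closed_submanifold_def)
    have N: "N = N'" using fun_cong[OF eq, of "Inl ()"] by (simp add: code_def)
    have "dense_seq L i = dense_seq L' i" for i
      using fun_cong[OF eq, of "Inr (Inl (i, _))"] by (intro rseq_eqI) (simp add: code_def)
    then have d: "dense_seq L = dense_seq L'" by blast
    have LL: "L = L'" using dense_seq(1)[OF L, unfolded d] dense_seq(1)[OF L'] by metis
    have "\<tau> p = \<tau>' p" for p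
    proof (cases "p \<in> L")
      case True
      show ?thesis
      proof
        fix I
        have "continuous_on L (\<lambda>x. \<tau> x I)" "continuous_on L (\<lambda>x. \<tau>' x I)"
          using M LL continuous_on_product_then_coordinatewise[of L _ I] by (auto simp: orientation_def)
        then have "continuous_on (closure (range (dense_seq L))) (\<lambda>x. \<tau> x I - \<tau>' x I)"
          unfolding dense_seq(1)[OF L] by (rule continuous_on_diff)
        moreover have "\<tau> x I - \<tau>' x I = 0" if x: "x \<in> range (dense_seq L)" for x
        proof -
          obtain i where "x = dense_seq L i" using x by blast
          then show ?thesis using fun_cong[OF eq, of "Inr (Inr (i, I))"] d by (simp add: code_def)
        qed
        ultimately have "\<tau> p I - \<tau>' p I = 0"
          using True continuous_constant_on_closure[of "range (dense_seq L)" "\<lambda>x. \<tau> x I - \<tau>' x I" 0 p]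
          by (simp add: dense_seq(1)[OF L])
        then show "\<tau> p I = \<tau>' p I" by simp
      qed
    next
      case False
      \<comment> \<open>Off \<open>L\<close> both orientations are 0, since orientations are
        extended by zero.\<close>
      then show ?thesis using M LL by (simp add: orientation_def)
    qed
    then have "\<tau> = \<tau>'" by (rule ext)
    then show "A = A'" using N LL AA by simp
  qed
  then have "oriented_submanifolds \<lesssim> (UNIV :: (unit + nat \<times> nat + nat \<times> nat list \<Rightarrow> real) set)"
    by (auto simp: lepoll_def)
  then show ?thesis using countable_families_lepoll_reals lepoll_trans by blast
qed

lemma minimal_submanifolds_lepoll_reals: "minimal_submanifolds \<lesssim> (UNIV :: real set)"
proof -
  have "minimal_submanifolds \<subseteq> oriented_submanifolds"
    by (auto simp: minimal_submanifolds_def oriented_submanifolds_def)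
  then show ?thesis
    using subset_imp_lepoll oriented_submanifolds_lepoll_reals lepoll_trans by blast
qed

lemma regular_minimizing_cones_lepoll_reals: "regular_minimizing_cones \<lesssim> (UNIV :: real set)"
proof -
  have "regular_minimizing_cones \<subseteq> (\<lambda>(N, L, \<tau>). (N + 1, cone_over L, cone_orient \<tau>)) ` oriented_submanifolds"
    by (force simp: regular_minimizing_cones_def oriented_submanifolds_def)
  then show ?thesis
    using subset_imp_lepoll image_lepoll oriented_submanifolds_lepoll_reals lepoll_trans by meson
qed

section \<open>A one-parameter family of great circles\<close>

text \<open>The parameter is the ratio \<open>x = c / s\<close>. A plane determines
  \<open>(c, s)\<close> only up to a common sign, which the ratio does not see.\<close>

lemma great_circle_slope: "great_circle (x / sqrt (1 + x\<^sup>2)) (1 / sqrt (1 + x\<^sup>2))"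
proof
  have "0 < 1 + x\<^sup>2" by (rule add_pos_nonneg) auto
  then show "(x / sqrt (1 + x\<^sup>2))\<^sup>2 + (1 / sqrt (1 + x\<^sup>2))\<^sup>2 = 1"
    by (simp add: power_divide add_divide_distrib[symmetric] add.commute)
qed

definition circle :: "real \<Rightarrow> rseq set" where
  "circle x = great_circle.L (x / sqrt (1 + x\<^sup>2)) (1 / sqrt (1 + x\<^sup>2))"

text \<open>Injectivity is shown for the planes and passes to the circles, so one statement serves
  both lower bounds.\<close>

lemma inj_cone_circle: "inj (\<lambda>x. cone_over (circle x))"
proof (rule injI)
  fix x y assume eq: "cone_over (circle x) = cone_over (circle y)"
  interpret X: great_circle "x / sqrt (1 + x\<^sup>2)" "1 / sqrt (1 + x\<^sup>2)" by (rule great_circle_slope)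
  interpret Y: great_circle "y / sqrt (1 + y\<^sup>2)" "1 / sqrt (1 + y\<^sup>2)" by (rule great_circle_slope)
  have "X.P = Y.P" using eq by (simp add: circle_def X.cone_over_L Y.cone_over_L)
  moreover have "X.\<Phi> (0, 1) \<in> X.P" by (simp add: X.P_def)
  \<comment> \<open>The coordinates 1 and 2 of this vector give two equations with the same factor
    \<open>snd z\<close>, from which the ratios \<open>x\<close> and \<open>y\<close> are
    compared.\<close>
  ultimately obtain z where z: "X.\<Phi> (0, 1) = Y.\<Phi> z" by (auto simp: Y.P_def)
  have p: "sqrt (1 + x\<^sup>2) \<noteq> 0" "sqrt (1 + y\<^sup>2) \<noteq> 0" by (smt (verit) real_sqrt_eq_0_iff zero_le_power2)+
  have 1: "x / sqrt (1 + x\<^sup>2) = snd z * (y / sqrt (1 + y\<^sup>2))"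
    using arg_cong[OF z, of "\<lambda>w. coord w 1"] by (simp add: X.coord_\<Phi> Y.coord_\<Phi>)
  have 2: "1 / sqrt (1 + x\<^sup>2) = snd z / sqrt (1 + y\<^sup>2)"
    using arg_cong[OF z, of "\<lambda>w. coord w 2"] by (simp add: X.coord_\<Phi> Y.coord_\<Phi>)
  have "x * (1 / sqrt (1 + x\<^sup>2)) = snd z * (y / sqrt (1 + y\<^sup>2))" using 1 by simp
  also have "\<dots> = y * (snd z / sqrt (1 + y\<^sup>2))" by simp
  also have "\<dots> = y * (1 / sqrt (1 + x\<^sup>2))" by (simp only: 2)
  finally show "x = y" using p by simp
qed

lemma reals_lepoll_minimal_submanifolds: "(UNIV :: real set) \<lesssim> minimal_submanifolds"
proof -
  let ?f = "\<lambda>x. (2 :: nat, circle x, great_circle.\<tau> (x / sqrt (1 + x\<^sup>2)) (1 / sqrt (1 + x\<^sup>2)))"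
  have "inj ?f" using inj_cone_circle unfolding inj_on_def by auto
  moreover have "range ?f \<subseteq> minimal_submanifolds"
    using great_circle.minimal_submanifolds_L[OF great_circle_slope] by (auto simp: circle_def)
  ultimately show ?thesis unfolding lepoll_def by blast
qed

lemma reals_lepoll_regular_minimizing_cones: "(UNIV :: real set) \<lesssim> regular_minimizing_cones"
proof -
  let ?f = "\<lambda>x. (3 :: nat, cone_over (circle x),
    cone_orient (great_circle.\<tau> (x / sqrt (1 + x\<^sup>2)) (1 / sqrt (1 + x\<^sup>2))))"
  have "inj ?f" using inj_cone_circle unfolding inj_on_def by auto
  moreover have "?f x \<in> regular_minimizing_cones" for x
    using great_circle.regular_minimizing_cones_L[OF great_circle_slope[of x]]
      great_circle.cone_over_L[OF great_circle_slope[of x]] by (simp add: circle_def)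
  ultimately show ?thesis unfolding lepoll_def by blast
qed

theorem corollary1p5:
  shows "minimal_submanifolds \<approx> regular_minimizing_cones"
proof -
  have "minimal_submanifolds \<approx> (UNIV :: real set)"
    by (rule lepoll_antisym[OF minimal_submanifolds_lepoll_reals reals_lepoll_minimal_submanifolds])
  moreover have "(UNIV :: real set) \<approx> regular_minimizing_cones"
    by (rule lepoll_antisym[OF reals_lepoll_regular_minimizing_cones regular_minimizing_cones_lepoll_reals])
  ultimately show ?thesis by (rule eqpoll_trans)
qed

end
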